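(* Let $K$ be a field, $f:\mathbb Z_{\ge0}\to\mathbb R_{\ge0}$ with $\lim_{n\to\infty}f(n)/n=0$, and $B=\bigoplus_{n\ge0}B_n$ an integral graded $K$-algebra of finite type over $K$, generated as $K$-algebra by $B_1$. Suppose: (i) the Krull dimension $\dim B$ is $>0$; (ii) for every $n\ge1$, $B_n$ carries a separated, exhaustive and left continuous $\mathbb R$-filtration making $B$ an $f$-quasi-filtered graded $K$-algebra; (iii) $\limsup_{n\to\infty}\sup_{0\ne a\in B_n}\lambda(a)/n<+\infty$. For $n\ge1$ let $\nu_n=T_{1/n}\nu_{B_n}$. Then (1) $\lim_{n\to\infty}\frac1n\min_{0\ne a\in B_n}\lambda(a)$ exists in $\mathbb R$; (2) the supports of the $\nu_n$ ($n\ge1$) are contained in a common bounded interval and $(\nu_n)_{n\ge1}$ converges vaguely to a Borel probability measure on $\mathbb R$.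
   Context: Filtrations: a decreasing family $(\mathcal F_rW)_{r\in\mathbb R}$ of subspaces; separated: $\bigcap_r\mathcal F_rW=0$; exhaustive: $\bigcup_r\mathcal F_rW=W$; left continuous: $\mathcal F_rW=\bigcap_{s<r}\mathcal F_sW$. Index: $\lambda(x)=\sup\{r:x\in\mathcal F_rW\}$. For nonzero finite-dimensional $W$, $\nu_W$ is the Borel probability measure with $\nu_W([r,+\infty[)=\dim\mathcal F_rW/\dim W$. $T_\varepsilon\nu$ is the image of $\nu$ under $x\mapsto\varepsilon x$. Vague convergence: convergence of integrals of all continuous compactly supported functions. $B$ (with filtrations $(B_{n,s})_s$) is $f$-quasi-filtered if there is $n_0\ge0$ such that for all $r>0$, $(n_i)\in\mathbb Z_{\ge n_0}^r$, $(s_i)\in\mathbb R^r$: $B_{n_1,s_1}\cdots B_{n_r,s_r}\subseteq B_{N,S}$, $N=\sum n_i$, $S=\sum(s_i-f(n_i))$. *)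

theory Defs
  imports "HOL-Analysis.Analysis" "HOL-Probability.Probability"
begin

text \<open>A K-algebra structure on a commutative ring 'b is given by a ring homomorphism phi
  from the field 'k; the scalar multiplication is c x = phi c * x.\<close>

definition alg_hom_str :: "('k::field \<Rightarrow> 'b::comm_ring_1) \<Rightarrow> bool" where
  "alg_hom_str \<phi> \<longleftrightarrow> \<phi> 1 = 1 \<and> (\<forall>a b. \<phi> (a + b) = \<phi> a + \<phi> b)
      \<and> (\<forall>a b. \<phi> (a * b) = \<phi> a * \<phi> b)"

definition kscale :: "('k::field \<Rightarrow> 'b::comm_ring_1) \<Rightarrow> 'k \<Rightarrow> 'b \<Rightarrow> 'b" where
  "kscale \<phi> c x = \<phi> c * x"

inductive_set alg_gen :: "('k::field \<Rightarrow> 'b::comm_ring_1) \<Rightarrow> 'b set \<Rightarrow> 'b set"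
  for \<phi> S where
  scal: "\<phi> c \<in> alg_gen \<phi> S"
| gen: "x \<in> S \<Longrightarrow> x \<in> alg_gen \<phi> S"
| add: "x \<in> alg_gen \<phi> S \<Longrightarrow> y \<in> alg_gen \<phi> S \<Longrightarrow> x + y \<in> alg_gen \<phi> S"
| mult: "x \<in> alg_gen \<phi> S \<Longrightarrow> y \<in> alg_gen \<phi> S \<Longrightarrow> x * y \<in> alg_gen \<phi> S"

definition finite_type :: "('k::field \<Rightarrow> 'b::comm_ring_1) \<Rightarrow> bool" where
  "finite_type \<phi> \<longleftrightarrow> (\<exists>S. finite S \<and> alg_gen \<phi> S = UNIV)"

text \<open>Prime ideals and positivity of the Krull dimension
  (the supremum of lengths of chains of prime ideals is > 0 iff there is a chain P < Q).\<close>
definition prime_ideal :: "'b::comm_ring_1 set \<Rightarrow> bool" where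
  "prime_ideal P \<longleftrightarrow> 0 \<in> P \<and> P \<noteq> UNIV \<and> (\<forall>x\<in>P. \<forall>y\<in>P. x + y \<in> P)
     \<and> (\<forall>x\<in>P. \<forall>y. y * x \<in> P) \<and> (\<forall>x y. x * y \<in> P \<longrightarrow> x \<in> P \<or> y \<in> P)"

definition krull_dim_pos :: "'b::comm_ring_1 itself \<Rightarrow> bool" where
  "krull_dim_pos _ \<longleftrightarrow> (\<exists>P Q :: 'b set. prime_ideal P \<and> prime_ideal Q \<and> P \<subset> Q)"

definition graded_algebra :: "('k::field \<Rightarrow> 'b::comm_ring_1) \<Rightarrow> (nat \<Rightarrow> 'b set) \<Rightarrow> bool" where
  "graded_algebra \<phi> Bn \<longleftrightarrow>
     (\<forall>n. module.subspace (kscale \<phi>) (Bn n)) \<and>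
     (\<forall>m n x y. x \<in> Bn m \<longrightarrow> y \<in> Bn n \<longrightarrow> x * y \<in> Bn (m + n)) \<and>
     (\<forall>x. \<exists>!c :: nat \<Rightarrow> 'b. (\<forall>n. c n \<in> Bn n) \<and> finite {n. c n \<noteq> 0}
                            \<and> x = (\<Sum>n\<in>{n. c n \<noteq> 0}. c n))"

definition is_filtration :: "('k::field \<Rightarrow> 'b::comm_ring_1) \<Rightarrow> 'b set \<Rightarrow> (real \<Rightarrow> 'b set) \<Rightarrow> bool" where
  "is_filtration \<phi> W Fl \<longleftrightarrow> (\<forall>r. module.subspace (kscale \<phi>) (Fl r) \<and> Fl r \<subseteq> W)
      \<and> (\<forall>r s. r \<le> s \<longrightarrow> Fl s \<subseteq> Fl r)"

definition separated_filt :: "(real \<Rightarrow> 'b::zero set) \<Rightarrow> bool" where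
  "separated_filt Fl \<longleftrightarrow> (\<Inter>r. Fl r) = {0}"

definition exhaustive_filt :: "'b set \<Rightarrow> (real \<Rightarrow> 'b set) \<Rightarrow> bool" where
  "exhaustive_filt W Fl \<longleftrightarrow> (\<Union>r. Fl r) = W"

definition left_cont_filt :: "(real \<Rightarrow> 'b set) \<Rightarrow> bool" where
  "left_cont_filt Fl \<longleftrightarrow> (\<forall>r. Fl r = (\<Inter>s\<in>{s. s < r}. Fl s))"

definition filt_index :: "(real \<Rightarrow> 'b set) \<Rightarrow> 'b \<Rightarrow> ereal" where
  "filt_index Fl x = Sup {ereal r | r. x \<in> Fl r}"

text \<open>f-quasi-filtered: F n s is the filtration on B_n (used for n >= 1).\<close>
definition quasi_filtered :: "(nat \<Rightarrow> real) \<Rightarrow> (nat \<Rightarrow> real \<Rightarrow> 'b::comm_ring_1 set) \<Rightarrow> bool" where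
  "quasi_filtered f F \<longleftrightarrow> (\<exists>n0::nat. \<forall>r::nat. \<forall>n :: nat \<Rightarrow> nat. \<forall>s :: nat \<Rightarrow> real. \<forall>x :: nat \<Rightarrow> 'b.
      r > 0 \<longrightarrow> (\<forall>i<r. n i \<ge> n0 \<and> n i \<ge> 1 \<and> x i \<in> F (n i) (s i)) \<longrightarrow>
      (\<Prod>i<r. x i) \<in> F (\<Sum>i<r. n i) (\<Sum>i<r. s i - f (n i)))"

definition vague_conv :: "(nat \<Rightarrow> real measure) \<Rightarrow> real measure \<Rightarrow> bool" where
  "vague_conv \<mu>s \<mu> \<longleftrightarrow> (\<forall>g :: real \<Rightarrow> real. continuous_on UNIV g \<and>
      (\<exists>C. compact C \<and> (\<forall>x. x \<notin> C \<longrightarrow> g x = 0)) \<longrightarrow>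
      (\<lambda>n. integral\<^sup>L (\<mu>s n) g) \<longlonglongrightarrow> integral\<^sup>L \<mu> g)"

end

theory Submission
  imports Defs "HOL-Computational_Algebra.Polynomial_Factorial"
begin

text \<open>
  Let \<open>q + 1\<close> be the maximal number of algebraically independent elements \<open>x\<^sub>0, \<dots>, x\<^sub>q\<close> of
  degree one. Then \<open>dim B\<^sub>n = O(n\<^sup>q)\<close>, and by Chevalley's extension theorem the fraction field
  carries a valuation that separates the monomials in the \<open>x\<^sub>i\<close>. The growth of \<open>dim B\<^sub>n\<close> bounds
  its residue degree and the exponent \<open>e\<close> of its value group modulo the values of the monomials.
  If \<open>k\<close> is prime to \<open>e\<close>, the products \<open>b\<^sup>k x\<^sup>\<beta>\<close>, where \<open>b\<close> runs through elements of a subspace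
  \<open>U\<close> of \<open>B\<^sub>p\<close> with distinct values and \<open>\<beta>\<close> through a cube of side \<open>k\<close>, have distinct values; hence
  every subspace containing all \<open>b\<^sup>k y\<close> with \<open>b \<in> U\<close> and \<open>y \<in> B\<^sub>R\<close>, \<open>R \<ge> k q + O(1)\<close>, has dimension
  at least \<open>k\<^sup>q dim U\<close>. Applied to \<open>U = F\<^sub>p\<^sub>t B\<^sub>p\<close> this gives, for \<open>t' < t\<close>,
  \<open>liminf n\<^sup>-\<^sup>q dim F\<^sub>n\<^sub>t\<^sub>' B\<^sub>n \<ge> limsup n\<^sup>-\<^sup>q dim F\<^sub>n\<^sub>t B\<^sub>n\<close>, so that all weak limit points of the tight
  sequence \<open>\<nu>\<^sub>n\<close> coincide. Convergence of the minima is Fekete's lemma for almost superadditive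
  sequences.
\<close>

section \<open>Chevalley's extension theorem\<close>

text \<open>Over an arbitrary field there need not be a convenient valuation with one-dimensional
  residues whose values are those of monomials. This is why \<open>e\<close>, the residually
  independent sets and the coprimality appear. Pure powers are used because a filtration step
  \<open>U\<close> is only a subspace: what is controlled about it is the number of its values and
  the step that contains its products. Passing from \<open>b\<close> to \<open>b ^ k\<close>
  multiplies values by \<open>k\<close>, and the cube of monomials fills the gaps so created without
  collisions; this supplies the factor \<open>k ^ q\<close>. The monomials have degree only
  \<open>k * q\<close>, small against \<open>k * p\<close> once \<open>p\<close> is large. Counting
  values instead of dimensions loses a factor up to the maximal residue degree \<open>l\<close>. It
  is won back by multiplying with one fixed residually independent set of size \<open>l\<close>.
  Since no constant is lost, leading terms can be compared in the limit. The remainder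
  \<open>R\<close> in \<open>n = k * p + R\<close> houses these auxiliary factors. Its degree is
  small against \<open>n\<close>, and the linear lower bound for the minima makes its effect on the
  index small too.\<close>

definition proper_ideal_pair :: "'a::field set \<Rightarrow> 'a set \<Rightarrow> bool" where
  "proper_ideal_pair R I \<longleftrightarrow> 1 \<in> R \<and> 0 \<in> I \<and> I \<subseteq> R \<and> 1 \<notin> I
     \<and> (\<forall>x\<in>R. \<forall>y\<in>R. x + y \<in> R \<and> x * y \<in> R \<and> - x \<in> R)
     \<and> (\<forall>x\<in>I. \<forall>y\<in>I. x + y \<in> I) \<and> (\<forall>x\<in>I. \<forall>y\<in>R. x * y \<in> I)"

lemma proper_ideal_pairD:
  assumes "proper_ideal_pair R I"
  shows "1 \<in> R" "0 \<in> I" "I \<subseteq> R" "1 \<notin> I" "0 \<in> R"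
    "\<And>x y. x \<in> R \<Longrightarrow> y \<in> R \<Longrightarrow> x + y \<in> R"
    "\<And>x y. x \<in> R \<Longrightarrow> y \<in> R \<Longrightarrow> x * y \<in> R"
    "\<And>x. x \<in> R \<Longrightarrow> - x \<in> R"
    "\<And>x y. x \<in> I \<Longrightarrow> y \<in> I \<Longrightarrow> x + y \<in> I"
    "\<And>x y. x \<in> I \<Longrightarrow> y \<in> R \<Longrightarrow> x * y \<in> I"
  using assms unfolding proper_ideal_pair_def by blast+

text \<open>Zorn applies because each closure condition involves at most two elements, and a chain
  places them in a common member. Maximality is recorded for the ring, since adjoining an element to
  \<open>R\<close> is the enlargement that will be tested.\<close>

lemma proper_ideal_pair_maximal:
  assumes "proper_ideal_pair R0 I0"
  shows "\<exists>R I. proper_ideal_pair R I \<and> R0 \<subseteq> R \<and> I0 \<subseteq> I \<and>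
           (\<forall>R' I'. proper_ideal_pair R' I' \<longrightarrow> R \<subseteq> R' \<longrightarrow> I \<subseteq> I' \<longrightarrow> R' = R)"
proof -
  text \<open>Pairs \<open>(R, I)\<close> are encoded as subsets of a sum type, ordered by inclusion.\<close>
  define \<A> :: "('a + 'a) set set" where
    "\<A> = {A. proper_ideal_pair (Inl -` A) (Inr -` A) \<and> R0 \<subseteq> Inl -` A \<and> I0 \<subseteq> Inr -` A}"
  have vim: "Inl -` (Inl ` R \<union> Inr ` I) = R" "Inr -` (Inl ` R \<union> Inr ` I) = I" for R I :: "'a set"
    by auto
  have "\<exists>M\<in>\<A>. \<forall>X\<in>\<A>. M \<subseteq> X \<longrightarrow> X = M"
  proof (rule subset_Zorn_nonempty)
    have "Inl ` R0 \<union> Inr ` I0 \<in> \<A>" unfolding \<A>_def mem_Collect_eq vim using assms by simp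
    thus "\<A> \<noteq> {}" by blast
  next
    fix \<C> assume ne: "\<C> \<noteq> {}" and ch: "subset.chain \<A> \<C>"
    have mem: "proper_ideal_pair (Inl -` A) (Inr -` A)" "R0 \<subseteq> Inl -` A" "I0 \<subseteq> Inr -` A"
      if "A \<in> \<C>" for A
      using that ch unfolding subset.chain_def \<A>_def by auto
    obtain A0 where A0: "A0 \<in> \<C>" using ne by blast
    have up: "\<exists>A\<in>\<C>. u \<in> A \<and> v \<in> A" if uv: "u \<in> \<Union>\<C>" "v \<in> \<Union>\<C>" for u v
    proof -
      obtain A B where AB: "A \<in> \<C>" "u \<in> A" "B \<in> \<C>" "v \<in> B" using uv by blast
      have "A \<subseteq> B \<or> B \<subseteq> A" using ch AB unfolding subset.chain_def by blast
      thus ?thesis using AB by blast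
    qed
    have "proper_ideal_pair (Inl -` \<Union>\<C>) (Inr -` \<Union>\<C>)"
      unfolding proper_ideal_pair_def
    proof (intro conjI ballI)
      show "1 \<in> Inl -` \<Union>\<C>" "0 \<in> Inr -` \<Union>\<C>"
        using proper_ideal_pairD(1,2)[OF mem(1)[OF A0]] A0 by auto
      show "Inr -` \<Union>\<C> \<subseteq> Inl -` \<Union>\<C>" "1 \<notin> Inr -` \<Union>\<C>"
        using proper_ideal_pairD(3,4)[OF mem(1)] by blast+
    next
      fix x y assume "x \<in> Inl -` \<Union>\<C>" "y \<in> Inl -` \<Union>\<C>"
      then obtain A where "A \<in> \<C>" "x \<in> Inl -` A" "y \<in> Inl -` A" using up[of "Inl x" "Inl y"] by auto
      thus "x + y \<in> Inl -` \<Union>\<C>" "x * y \<in> Inl -` \<Union>\<C>" "- x \<in> Inl -` \<Union>\<C>"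
        using proper_ideal_pairD(6,7,8)[OF mem(1)] by blast+
    next
      fix x y assume "x \<in> Inr -` \<Union>\<C>" "y \<in> Inr -` \<Union>\<C>"
      then obtain A where "A \<in> \<C>" "x \<in> Inr -` A" "y \<in> Inr -` A" using up[of "Inr x" "Inr y"] by auto
      thus "x + y \<in> Inr -` \<Union>\<C>"
        using proper_ideal_pairD(9)[OF mem(1)] by blast
    next
      fix x y assume "x \<in> Inr -` \<Union>\<C>" "y \<in> Inl -` \<Union>\<C>"
      then obtain A where "A \<in> \<C>" "x \<in> Inr -` A" "y \<in> Inl -` A" using up[of "Inr x" "Inl y"] by auto
      thus "x * y \<in> Inr -` \<Union>\<C>"
        using proper_ideal_pairD(10)[OF mem(1)] by blast
    qed
    thus "\<Union>\<C> \<in> \<A>" using A0 mem(2,3)[OF A0] unfolding \<A>_def by blast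
  qed
  then obtain M where M: "M \<in> \<A>" "\<And>X. X \<in> \<A> \<Longrightarrow> M \<subseteq> X \<Longrightarrow> X = M" by blast
  show ?thesis
  proof (intro exI conjI allI impI)
    show "proper_ideal_pair (Inl -` M) (Inr -` M)" "R0 \<subseteq> Inl -` M" "I0 \<subseteq> Inr -` M"
      using M(1) unfolding \<A>_def by auto
  next
    fix R' I' assume *: "proper_ideal_pair R' I'" "Inl -` M \<subseteq> R'" "Inr -` M \<subseteq> I'"
    have "Inl ` R' \<union> Inr ` I' \<in> \<A>" using * M(1) unfolding \<A>_def mem_Collect_eq vim by auto
    moreover have "M \<subseteq> Inl ` R' \<union> Inr ` I'"
    proof
      fix u assume "u \<in> M" thus "u \<in> Inl ` R' \<union> Inr ` I'" using *(2,3) by (cases u) auto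
    qed
    ultimately have "Inl ` R' \<union> Inr ` I' = M" by (rule M(2))
    thus "R' = Inl -` M" using vim(1)[of R' I'] by simp
  qed
qed

lemma proper_ideal_pair_sum:
  assumes "proper_ideal_pair R I" "\<And>i. i \<in> A \<Longrightarrow> g i \<in> I"
  shows "sum g A \<in> I"
  using assms(2) by (induction A rule: infinite_finite_induct)
     (auto intro: proper_ideal_pairD(2,9)[OF assms(1)])

lemma proper_ideal_pair_sum_ring:
  assumes "proper_ideal_pair R I" "\<And>i. i \<in> A \<Longrightarrow> g i \<in> R"
  shows "sum g A \<in> R"
  using assms(2) by (induction A rule: infinite_finite_induct)
     (auto intro: proper_ideal_pairD(5,6)[OF assms(1)])

text \<open>Of two such relations the longer can be shortened: the other one, multiplied by a
  suitable power, expresses the top term through lower ones. The descent is on \<open>n + m\<close>,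
  and exchanging \<open>x\<close> with \<open>inverse x\<close> reduces to the case
  \<open>m \<le> n\<close>.\<close>

lemma no_unit_relation_in_both:
  assumes RI: "proper_ideal_pair R I" and "x \<noteq> 0"
    and "\<And>i. t i \<in> I" "(\<Sum>i\<le>n. t i * x ^ i) = 1"
    and "\<And>i. s i \<in> I" "(\<Sum>i\<le>m. s i * inverse x ^ i) = 1"
  shows False
  using assms(2-)
proof (induction "n + m" arbitrary: n m t s x rule: less_induct)
  case less
  note ID = proper_ideal_pairD[OF RI]
  have reduce: False
    if x: "x \<noteq> 0" and t: "\<And>i. t i \<in> I" "(\<Sum>i\<le>n. t i * x ^ i) = 1"
      and s: "\<And>i. s i \<in> I" "(\<Sum>i\<le>m. s i * inverse x ^ i) = 1" and mn: "m \<le> n"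
      and IH: "\<And>n' t'. n' < n \<Longrightarrow> (\<And>i. t' i \<in> I) \<Longrightarrow> (\<Sum>i\<le>n'. t' i * x ^ i) = 1 \<Longrightarrow> False"
    for x :: 'a and t s n m
  proof (cases m)
    case 0
    thus False using s(1)[of 0] s(2) ID(4) by simp
  next
    case (Suc m')
    then obtain n' where n: "n = Suc n'" using mn by (cases n) auto
    \<comment> \<open>\<open>1 - s 0\<close> need not be a unit of \<open>R\<close>. So the relation
      for \<open>x\<close> is multiplied by it, the relation for \<open>inverse x\<close> rewrites
      the top term \<open>t n * x ^ n * (1 - s 0)\<close> in lower powers, and adding
      \<open>s 0\<close> restores the right-hand side 1.\<close>
    define t' where "t' i = (if i = 0 then s 0 else 0) + (1 - s 0) * t i
        + (if n - m \<le> i \<and> i < n then t n * s (n - i) else 0)" for i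
    have sR: "s i \<in> R" for i using s(1) ID(3) by blast
    have "1 - s 0 \<in> R" using ID(6)[OF ID(1) ID(8)[OF sR[of 0]]] by simp
    hence t'I: "t' i \<in> I" for i
      unfolding t'_def using s(1) t(1) sR ID(2)
      by (auto intro!: ID(9) simp: mult.commute[of "1 - s 0"] ID(10))
    have "(\<Sum>j\<in>{1..m}. s j * inverse x ^ j) = 1 - s 0"
    proof -
      have "(\<Sum>i\<le>m. s i * inverse x ^ i) = s 0 + (\<Sum>j\<in>{1..m}. s j * inverse x ^ j)"
        by (simp add: atMost_atLeast0 sum.atLeast_Suc_atMost)
      thus ?thesis using s(2) by (simp add: algebra_simps)
    qed
    from this[symmetric] have "t n * x ^ n * (1 - s 0) = (\<Sum>j\<in>{1..m}. t n * s j * (x ^ n * inverse x ^ j))"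
      by (simp only: sum_distrib_left mult.assoc) (simp add: mult_ac)
    also have "\<dots> = (\<Sum>j\<in>{1..m}. t n * s j * x ^ (n - j))"
      using x mn by (intro sum.cong refl) (simp add: power_diff field_simps)
    also have "\<dots> = (\<Sum>i\<in>{n - m..<n}. t n * s (n - i) * x ^ i)"
      by (rule sum.reindex_bij_witness[of _ "\<lambda>i. n - i" "\<lambda>j. n - j"]) (use mn in auto)
    also have "\<dots> = (\<Sum>i\<le>n'. (if n - m \<le> i \<and> i < n then t n * s (n - i) else 0) * x ^ i)"
      by (rule sum.mono_neutral_cong_left) (use n in auto)
    finally have top: "t n * x ^ n * (1 - s 0)
      = (\<Sum>i\<le>n'. (if n - m \<le> i \<and> i < n then t n * s (n - i) else 0) * x ^ i)" .
    have "(\<Sum>i\<le>n'. t' i * x ^ i) = (\<Sum>i\<le>n'. (if i = 0 then s 0 else 0) * x ^ i)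
       + (1 - s 0) * (\<Sum>i\<le>n'. t i * x ^ i) + t n * x ^ n * (1 - s 0)"
      unfolding top t'_def by (simp add: algebra_simps sum.distrib sum_distrib_left sum_subtractf)
    also have "(\<Sum>i\<le>n'. (if i = 0 then s 0 else 0) * x ^ i) = s 0"
      by (simp add: if_distrib[of "\<lambda>u. u * _"] cong: if_cong)
    also have "s 0 + (1 - s 0) * (\<Sum>i\<le>n'. t i * x ^ i) + t n * x ^ n * (1 - s 0)
       = s 0 + (1 - s 0) * (\<Sum>i\<le>n. t i * x ^ i)"
      unfolding n by (simp add: algebra_simps)
    finally have "(\<Sum>i\<le>n'. t' i * x ^ i) = 1" using t(2) by simp
    thus False using IH[of n' t'] t'I n by simp
  qed
  show False
  proof (cases "m \<le> n")
    case True
    show False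
      by (rule reduce[OF less.prems True]) (use less.prems in \<open>auto intro!: less.hyps[of _ m x _ s]\<close>)
  next
    case False
    show False
    proof (rule reduce[of "inverse x" s m t n])
      fix n' t' assume "n' < m" "\<And>i. t' i \<in> I" "(\<Sum>i\<le>n'. t' i * inverse x ^ i) = 1"
      thus False using less.prems less.hyps[of n n' x t t'] by auto
    qed (use less.prems False in auto)
  qed
qed

text \<open>The ring of a maximal pair works. For \<open>x\<close> outside it, adjoining
  \<open>x\<close> must destroy properness, so 1 is a polynomial in \<open>x\<close> with
  coefficients in \<open>I\<close>; this cannot happen for both \<open>x\<close> and
  \<open>inverse x\<close>. An element of \<open>I0\<close> stays in the proper ideal
  \<open>I\<close>, so its inverse is not in the ring.\<close>

theorem valuation_ring_exists:
  fixes R0 I0 :: "'a::field set"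
  assumes "proper_ideal_pair R0 I0"
  obtains R where "R0 \<subseteq> R" "1 \<in> R" "\<And>x y. x \<in> R \<Longrightarrow> y \<in> R \<Longrightarrow> x + y \<in> R"
    "\<And>x y. x \<in> R \<Longrightarrow> y \<in> R \<Longrightarrow> x * y \<in> R" "\<And>x. x \<noteq> 0 \<Longrightarrow> x \<in> R \<or> inverse x \<in> R"
    "\<And>t. t \<in> I0 \<Longrightarrow> t \<noteq> 0 \<Longrightarrow> inverse t \<notin> R"
proof -
  obtain R I where RI: "proper_ideal_pair R I" "R0 \<subseteq> R" "I0 \<subseteq> I"
    and max: "\<And>R' I'. proper_ideal_pair R' I' \<Longrightarrow> R \<subseteq> R' \<Longrightarrow> I \<subseteq> I' \<Longrightarrow> R' = R"
    using proper_ideal_pair_maximal[OF assms] by blast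
  note ID = proper_ideal_pairD[OF RI(1)]
  have adj: "x \<in> R \<or> (\<exists>t n. (\<forall>i. t i \<in> I) \<and> (\<Sum>i\<le>n. t i * x ^ i) = 1)" for x
  proof (cases "\<exists>p. (\<forall>i. coeff p i \<in> I) \<and> poly p x = 1")
    case True
    thus ?thesis unfolding poly_altdef by blast
  next
    case False
    \<comment> \<open>Since 1 is not in \<open>I[x]\<close>, the pair of \<open>R[x]\<close> and
      \<open>I[x]\<close> is again proper, and maximality yields \<open>x \<in> R\<close>.\<close>
    define R' where "R' = {poly p x | p. \<forall>i. coeff p i \<in> R}"
    define I' where "I' = {poly p x | p. \<forall>i. coeff p i \<in> I}"
    have sub: "R \<subseteq> R'" "I \<subseteq> I'"
    proof -
      show "R \<subseteq> R'" unfolding R'_def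
        by (auto intro!: exI[of _ "[:_:]"] simp: coeff_pCons ID split: nat.splits)
      show "I \<subseteq> I'" unfolding I'_def
        by (auto intro!: exI[of _ "[:_:]"] simp: coeff_pCons ID split: nat.splits)
    qed
    have "proper_ideal_pair R' I'" unfolding proper_ideal_pair_def
    proof (intro conjI ballI)
      show "1 \<in> R'" "0 \<in> I'" using sub ID by auto
      show "I' \<subseteq> R'" unfolding R'_def I'_def using ID(3) by blast
      show "1 \<notin> I'" using False unfolding I'_def by auto
    next
      fix u v assume "u \<in> R'" "v \<in> R'"
      then obtain p r where pr: "u = poly p x" "v = poly r x" "\<forall>i. coeff p i \<in> R" "\<forall>i. coeff r i \<in> R"
        unfolding R'_def by blast
      show "u + v \<in> R'" unfolding R'_def using pr ID by (auto intro!: exI[of _ "p + r"])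
      show "- u \<in> R'" unfolding R'_def using pr ID by (auto intro!: exI[of _ "- p"])
      show "u * v \<in> R'" unfolding R'_def using pr ID
        by (auto intro!: exI[of _ "p * r"] proper_ideal_pair_sum_ring[OF RI(1)] simp: coeff_mult)
    next
      fix u v assume "u \<in> I'" "v \<in> I'"
      then obtain p r where pr: "u = poly p x" "v = poly r x" "\<forall>i. coeff p i \<in> I" "\<forall>i. coeff r i \<in> I"
        unfolding I'_def by blast
      show "u + v \<in> I'" unfolding I'_def using pr ID by (auto intro!: exI[of _ "p + r"])
    next
      fix u v assume "u \<in> I'" "v \<in> R'"
      then obtain p r where pr: "u = poly p x" "v = poly r x" "\<forall>i. coeff p i \<in> I" "\<forall>i. coeff r i \<in> R"
        unfolding I'_def R'_def by blast
      show "u * v \<in> I'" unfolding I'_def using pr ID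
        by (auto intro!: exI[of _ "p * r"] proper_ideal_pair_sum[OF RI(1)] simp: coeff_mult)
    qed
    hence "R' = R" by (rule max[OF _ sub])
    moreover have "x \<in> R'" unfolding R'_def
      by (auto intro!: exI[of _ "[:0,1:]"] simp: coeff_pCons ID split: nat.splits)
    ultimately show ?thesis by simp
  qed
  show ?thesis
  proof (rule that[of R])
    fix x :: 'a assume "x \<noteq> 0"
    show "x \<in> R \<or> inverse x \<in> R"
      using adj[of x] adj[of "inverse x"] no_unit_relation_in_both[OF RI(1) \<open>x \<noteq> 0\<close>] by metis
  next
    fix t assume "t \<in> I0" "t \<noteq> 0"
    thus "inverse t \<notin> R" using ID(4) ID(10)[of t "inverse t"] RI(3) by auto
  qed (use RI ID in auto)
qed

section \<open>Algebras generated by monomials\<close>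

definition mons :: "'b::comm_ring_1 set \<Rightarrow> nat \<Rightarrow> 'b set" where
  "mons S n = {prod_list ys | ys. set ys \<subseteq> S \<and> length ys = n}"

lemma mons_0 [simp]: "mons S 0 = {1}"
  unfolding mons_def by auto

lemma mons_1 [simp]: "mons S (Suc 0) = S"
  unfolding mons_def by (auto simp: length_Suc_conv intro!: exI[of _ "[_]"])

lemma mons_mult: "a \<in> mons S m \<Longrightarrow> b \<in> mons S n \<Longrightarrow> a * b \<in> mons S (m + n)"
proof -
  assume "a \<in> mons S m" "b \<in> mons S n"
  then obtain xs ys where "a = prod_list xs" "set xs \<subseteq> S" "length xs = m"
    "b = prod_list ys" "set ys \<subseteq> S" "length ys = n" unfolding mons_def by auto
  thus ?thesis unfolding mons_def by (auto intro!: exI[of _ "xs @ ys"])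
qed

lemma mons_mono: "S \<subseteq> T \<Longrightarrow> mons S n \<subseteq> mons T n"
  unfolding mons_def by auto

lemma mons_power: "a \<in> mons S m \<Longrightarrow> a ^ k \<in> mons S (k * m)"
  by (induction k) (auto intro: mons_mult)

lemma finite_mons: "finite S \<Longrightarrow> finite (mons S n)"
proof -
  assume "finite S"
  have "mons S n = prod_list ` {ys. set ys \<subseteq> S \<and> length ys = n}" unfolding mons_def by auto
  thus ?thesis using finite_lists_length_eq[OF \<open>finite S\<close>, of n] by simp
qed

lemma mons_split:
  assumes "a \<in> mons S (m + n)"
  obtains b c where "b \<in> mons S m" "c \<in> mons S n" "a = b * c"
proof -
  obtain ys where ys: "a = prod_list ys" "set ys \<subseteq> S" "length ys = m + n"
    using assms unfolding mons_def by auto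
  have "prod_list ys = prod_list (take m ys) * prod_list (drop m ys)"
    by (metis append_take_drop_id prod_list.append)
  moreover have "prod_list (take m ys) \<in> mons S m"
    unfolding mons_def using ys(2,3) set_take_subset[of m ys] by (auto intro!: exI[of _ "take m ys"])
  moreover have "prod_list (drop m ys) \<in> mons S n"
    unfolding mons_def using ys(2,3) set_drop_subset[of m ys] by (auto intro!: exI[of _ "drop m ys"])
  ultimately show ?thesis using that ys(1) by blast
qed

lemma mons_insert:
  assumes "a \<in> mons (insert y S) n"
  shows "\<exists>l\<le>n. \<exists>b\<in>mons S (n - l). a = b * y ^ l"
proof -
  obtain ys where ys: "a = prod_list ys" "set ys \<subseteq> insert y S" "length ys = n"
    using assms unfolding mons_def by auto
  have "\<exists>l\<le>length ys. \<exists>b\<in>mons S (length ys - l). prod_list ys = b * y ^ l"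
    using ys(2)
  proof (induction ys)
    case (Cons z ys)
    then obtain l b where l: "l \<le> length ys" "b \<in> mons S (length ys - l)" "prod_list ys = b * y ^ l"
      by auto
    show ?case
    proof (cases "z \<in> S")
      case True
      hence "z * b \<in> mons S (length (z # ys) - l)"
        using mons_mult[of z S 1 b "length ys - l"] l by (simp add: Suc_diff_le)
      thus ?thesis using l by (intro exI[of _ l]) (auto simp: mult.assoc intro!: bexI[of _ "z * b"])
    next
      case False
      hence "z = y" using Cons.prems by auto
      thus ?thesis using l by (intro exI[of _ "Suc l"]) (auto simp: mult_ac intro!: bexI[of _ b])
    qed
  qed auto
  thus ?thesis using ys by simp
qed

section \<open>Dimension counts in a domain over a field\<close>

locale kalgebra =
  fixes \<phi> :: "'k::field \<Rightarrow> 'b::idom"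
  assumes hom: "alg_hom_str \<phi>"
begin

sublocale V: vector_space "kscale \<phi>"
  using hom unfolding alg_hom_str_def
  by unfold_locales (auto simp: kscale_def algebra_simps)

lemma phi_0 [simp]: "\<phi> 0 = 0"
  using hom unfolding alg_hom_str_def by (metis add_cancel_right_right)

lemma phi_1 [simp]: "\<phi> 1 = 1" and phi_add: "\<phi> (a + b) = \<phi> a + \<phi> b" and phi_mult: "\<phi> (a * b) = \<phi> a * \<phi> b"
  using hom unfolding alg_hom_str_def by auto

lemma phi_minus: "\<phi> (- a) = - \<phi> a"
  using phi_add[of a "- a"] by (simp add: eq_neg_iff_add_eq_0 add.commute)

lemma phi_eq_0_iff [simp]: "\<phi> c = 0 \<longleftrightarrow> c = 0"
proof
  assume "\<phi> c = 0"
  hence "\<phi> (c * inverse c) = 0" by (simp add: phi_mult)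
  thus "c = 0" by (cases "c = 0") auto
qed simp

lemma subspace_phi: "V.subspace S \<Longrightarrow> x \<in> S \<Longrightarrow> \<phi> c * x \<in> S"
  using V.subspace_scale[of S x c] by (simp add: kscale_def)

lemma span_mult:
  assumes "a \<in> V.span S" "b \<in> V.span T" "\<And>s t. s \<in> S \<Longrightarrow> t \<in> T \<Longrightarrow> s * t \<in> W" "V.subspace W"
  shows "a * b \<in> W"
proof -
  have 1: "s * b \<in> W" if s: "s \<in> S" for s
    using assms(2)
  proof (induction rule: V.span_induct_alt)
    case base thus ?case using assms(4) by (simp add: V.subspace_0)
  next
    case (step c x y)
    have "s * (kscale \<phi> c x + y) = kscale \<phi> c (s * x) + s * y" by (simp add: kscale_def algebra_simps)
    thus ?case using step s assms(3,4) V.subspace_add V.subspace_scale by metis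
  qed
  show ?thesis using assms(1)
  proof (induction rule: V.span_induct_alt)
    case base thus ?case using assms(4) by (simp add: V.subspace_0)
  next
    case (step c x y)
    have "(kscale \<phi> c x + y) * b = kscale \<phi> c (x * b) + y * b" by (simp add: kscale_def algebra_simps)
    thus ?case using step 1 assms(4) V.subspace_add V.subspace_scale by metis
  qed
qed

lemma span_mons_mult:
  "a \<in> V.span (mons S m) \<Longrightarrow> b \<in> V.span (mons S n) \<Longrightarrow> a * b \<in> V.span (mons S (m + n))"
  by (erule (1) span_mult) (auto intro: V.span_base mons_mult)

lemma span_mons_power: "a \<in> V.span (mons S m) \<Longrightarrow> a ^ k \<in> V.span (mons S (k * m))"
  by (induction k) (auto intro: span_mons_mult V.span_base)

text \<open>\<open>V.dim\<close> is a cardinality and becomes 0 for an infinite basis, so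
  comparisons of dimensions carry this condition.\<close>

definition findim :: "'b set \<Rightarrow> bool" where
  "findim W \<longleftrightarrow> (\<exists>T. finite T \<and> W \<subseteq> V.span T)"

lemma findim_subset: "findim W \<Longrightarrow> U \<subseteq> W \<Longrightarrow> findim U"
  unfolding findim_def by blast

lemma independent_le_dim:
  assumes "findim W" "V.independent S" "S \<subseteq> W"
  shows "finite S" "card S \<le> V.dim W"
proof -
  obtain T where T: "finite T" "W \<subseteq> V.span T" using assms(1) unfolding findim_def by blast
  show "finite S" using V.independent_span_bound[OF T(1) assms(2)] T assms(3) by blast
  obtain B where B: "B \<subseteq> W" "V.independent B" "W \<subseteq> V.span B" "card B = V.dim W"
    using V.basis_exists by blast
  have "finite B" using V.independent_span_bound[OF T(1) B(2)] B(1) T(2) by blast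
  thus "card S \<le> V.dim W"
    using V.independent_span_bound[OF _ assms(2), of B] B assms(3) by auto
qed

lemma dim_mono: "findim W \<Longrightarrow> U \<subseteq> W \<Longrightarrow> V.dim U \<le> V.dim W"
  by (metis V.basis_exists independent_le_dim(2) order_trans)

lemma dim_eq_0_subset: "findim W \<Longrightarrow> V.dim W = 0 \<Longrightarrow> W \<subseteq> {0}"
proof
  fix x assume *: "findim W" "V.dim W = 0" "x \<in> W"
  show "x \<in> {0}"
  proof (rule ccontr)
    assume "x \<notin> {0}"
    hence "card {x} \<le> V.dim W" using * by (intro independent_le_dim(2)) auto
    thus False using * by simp
  qed
qed

text \<open>Families indexed by exponents or pairs occur below. The coefficient criterion also
  excludes repetitions: \<open>g i = g j\<close> would be a relation with coefficients 1 and
  -1.\<close>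

lemma independent_family:
  assumes "finite J"
    and "\<And>c. (\<Sum>j\<in>J. \<phi> (c j) * g j) = 0 \<Longrightarrow> \<forall>j\<in>J. c j = 0"
  shows "inj_on g J" "V.independent (g ` J)"
proof -
  show inj: "inj_on g J"
  proof (rule inj_onI, rule ccontr)
    fix i j assume ij: "i \<in> J" "j \<in> J" "g i = g j" "i \<noteq> j"
    define c :: "_ \<Rightarrow> 'k" where "c l = (if l = i then 1 else if l = j then - 1 else 0)" for l
    have "(\<Sum>l\<in>J. \<phi> (c l) * g l) = (\<Sum>l\<in>{i,j}. \<phi> (c l) * g l)"
      by (rule sum.mono_neutral_right) (use ij assms(1) in \<open>auto simp: c_def\<close>)
    also have "\<dots> = 0" using ij by (simp add: c_def phi_minus)
    finally show False using assms(2)[of c] ij(1) by (auto simp: c_def)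
  qed
  show "V.independent (g ` J)"
  proof (rule V.independent_if_scalars_zero)
    show "finite (g ` J)" using assms(1) by simp
    fix f x assume *: "(\<Sum>x\<in>g ` J. kscale \<phi> (f x) x) = 0" "x \<in> g ` J"
    have "(\<Sum>j\<in>J. \<phi> (f (g j)) * g j) = 0"
      using *(1) by (simp add: sum.reindex[OF inj] kscale_def)
    thus "f x = 0" using assms(2)[of "\<lambda>j. f (g j)"] *(2) by auto
  qed
qed

lemma card_family_le_dim:
  assumes "finite J" "findim W" "\<And>j. j \<in> J \<Longrightarrow> g j \<in> W"
    and "\<And>c. (\<Sum>j\<in>J. \<phi> (c j) * g j) = 0 \<Longrightarrow> \<forall>j\<in>J. c j = 0"
  shows "card J \<le> V.dim W"
proof -
  have "card (g ` J) \<le> V.dim W"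
    using independent_family[OF assms(1,4)] assms(3) by (intro independent_le_dim[OF assms(2)]) auto
  thus ?thesis using card_image[OF independent_family(1)[OF assms(1,4)]] by simp
qed

text \<open>Multiplication by a nonzero element of a domain is injective, so denominators can be
  cleared without losing dimension.\<close>

lemma dim_le_of_mult:
  assumes "findim U" "findim W" "a \<noteq> 0" "\<And>u. u \<in> U \<Longrightarrow> a * u \<in> W"
  shows "V.dim U \<le> V.dim W"
proof -
  obtain B where B: "B \<subseteq> U" "V.independent B" "card B = V.dim U"
    by (rule V.basis_exists[of U]) blast
  have fB: "finite B" using independent_le_dim(1)[OF assms(1) B(2,1)] .
  have "card B \<le> V.dim W"
  proof (rule card_family_le_dim[OF fB assms(2), of "\<lambda>b. a * b"])
    fix c assume *: "(\<Sum>b\<in>B. \<phi> (c b) * (a * b)) = 0"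
    have "a * (\<Sum>b\<in>B. kscale \<phi> (c b) b) = (\<Sum>b\<in>B. \<phi> (c b) * (a * b))"
      unfolding sum_distrib_left by (intro sum.cong refl) (simp only: kscale_def mult.left_commute)
    hence "(\<Sum>b\<in>B. kscale \<phi> (c b) b) = 0" using * assms(3) by simp
    thus "\<forall>b\<in>B. c b = 0" using V.independentD[OF B(2) fB order_refl] by blast
  qed (use B assms in auto)
  thus ?thesis using B by simp
qed

lemma dim_span_UN_le:
  assumes "finite L" "\<And>l. l \<in> L \<Longrightarrow> findim (M l)"
  shows "V.dim (V.span (\<Union>l\<in>L. M l)) \<le> (\<Sum>l\<in>L. V.dim (M l))"
    "findim (V.span (\<Union>l\<in>L. M l))"
proof -
  have "\<exists>B. finite B \<and> M l \<subseteq> V.span B \<and> card B = V.dim (M l)" if "l \<in> L" for l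
    using V.basis_exists[of "M l"] independent_le_dim(1)[OF assms(2)[OF that]] by metis
  then obtain B where B: "\<And>l. l \<in> L \<Longrightarrow> finite (B l) \<and> M l \<subseteq> V.span (B l) \<and> card (B l) = V.dim (M l)"
    by metis
  have fin: "finite (\<Union>l\<in>L. B l)" using assms(1) B by auto
  have "(\<Union>l\<in>L. M l) \<subseteq> V.span (\<Union>l\<in>L. B l)"
  proof (rule UN_least)
    fix l assume "l \<in> L"
    hence "M l \<subseteq> V.span (B l)" "B l \<subseteq> (\<Union>l\<in>L. B l)" using B by auto
    thus "M l \<subseteq> V.span (\<Union>l\<in>L. B l)" using V.span_mono by blast
  qed
  hence sub: "V.span (\<Union>l\<in>L. M l) \<subseteq> V.span (\<Union>l\<in>L. B l)" by (simp add: V.span_minimal)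
  thus "findim (V.span (\<Union>l\<in>L. M l))" using fin unfolding findim_def by blast
  have "V.dim (V.span (\<Union>l\<in>L. M l)) \<le> card (\<Union>l\<in>L. B l)"
    using V.dim_le_card[OF sub fin] .
  also have "\<dots> \<le> (\<Sum>l\<in>L. card (B l))" by (rule card_UN_le[OF assms(1)])
  also have "\<dots> = (\<Sum>l\<in>L. V.dim (M l))" using B by simp
  finally show "V.dim (V.span (\<Union>l\<in>L. M l)) \<le> (\<Sum>l\<in>L. V.dim (M l))" .
qed

lemma findim_span_finite: "finite T \<Longrightarrow> findim (V.span T)"
  unfolding findim_def by blast

section \<open>Generators in degree one and the graded pieces\<close>

lemma alg_gen_span_mons: "alg_gen \<phi> Y \<subseteq> V.span (\<Union>n. mons Y n)"
proof
  fix x assume "x \<in> alg_gen \<phi> Y"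
  thus "x \<in> V.span (\<Union>n. mons Y n)"
  proof induction
    case (scal c)
    have "\<phi> c * 1 \<in> V.span (\<Union>n. mons Y n)"
      by (intro subspace_phi V.subspace_span V.span_base UN_I[of 0]) auto
    thus ?case by simp
  next
    case (gen x) thus ?case by (intro V.span_base UN_I[of 1]) auto
  next
    case (add x y) thus ?case by (intro V.span_add)
  next
    case (mult x y)
    show ?case
      by (rule span_mult[OF mult.IH]) (auto intro!: V.span_base mons_mult)
  qed
qed

lemma alg_gen_mono: "S \<subseteq> T \<Longrightarrow> alg_gen \<phi> S \<subseteq> alg_gen \<phi> T"
proof
  fix x assume "S \<subseteq> T" "x \<in> alg_gen \<phi> S"
  from this(2,1) show "x \<in> alg_gen \<phi> T"
    by induction (auto intro: alg_gen.intros)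
qed

lemma alg_gen_finitary:
  assumes "x \<in> alg_gen \<phi> S"
  shows "\<exists>Y. finite Y \<and> Y \<subseteq> S \<and> x \<in> alg_gen \<phi> Y"
  using assms
proof induction
  case (scal c) thus ?case by (intro exI[of _ "{}"]) (auto intro: alg_gen.intros)
next
  case (gen x) thus ?case by (intro exI[of _ "{x}"]) (auto intro: alg_gen.intros)
next
  case (add x y)
  then obtain Y Z where "finite Y" "Y \<subseteq> S" "x \<in> alg_gen \<phi> Y" "finite Z" "Z \<subseteq> S" "y \<in> alg_gen \<phi> Z" by blast
  thus ?case using alg_gen_mono[of Y "Y \<union> Z"] alg_gen_mono[of Z "Y \<union> Z"]
    by (intro exI[of _ "Y \<union> Z"]) (auto intro!: alg_gen.add)
next
  case (mult x y)
  then obtain Y Z where "finite Y" "Y \<subseteq> S" "x \<in> alg_gen \<phi> Y" "finite Z" "Z \<subseteq> S" "y \<in> alg_gen \<phi> Z" by blast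
  thus ?case using alg_gen_mono[of Y "Y \<union> Z"] alg_gen_mono[of Z "Y \<union> Z"]
    by (intro exI[of _ "Y \<union> Z"]) (auto intro!: alg_gen.mult)
qed

lemma alg_gen_trans: "S \<subseteq> alg_gen \<phi> T \<Longrightarrow> alg_gen \<phi> S \<subseteq> alg_gen \<phi> T"
proof
  fix x assume "S \<subseteq> alg_gen \<phi> T" "x \<in> alg_gen \<phi> S"
  from this(2,1) show "x \<in> alg_gen \<phi> T"
    by induction (auto intro: alg_gen.intros)
qed

text \<open>Each of finitely many generators of the algebra is a polynomial expression in finitely
  many elements of \<open>S\<close>; these together already generate. With \<open>S = Bn 1\<close>
  this gives finitely many generators of degree one.\<close>

lemma finite_generators_in:
  assumes "finite_type \<phi>" "alg_gen \<phi> S = UNIV"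
  obtains Y where "finite Y" "Y \<subseteq> S" "alg_gen \<phi> Y = UNIV"
proof -
  obtain G where G: "finite G" "alg_gen \<phi> G = UNIV" using assms(1) unfolding finite_type_def by blast
  have "\<forall>g\<in>G. \<exists>Y. finite Y \<and> Y \<subseteq> S \<and> g \<in> alg_gen \<phi> Y"
    using alg_gen_finitary assms(2) by blast
  then obtain Y where Y: "\<And>g. g \<in> G \<Longrightarrow> finite (Y g) \<and> Y g \<subseteq> S \<and> g \<in> alg_gen \<phi> (Y g)" by metis
  have "G \<subseteq> alg_gen \<phi> (\<Union>(Y ` G))" using Y alg_gen_mono by (meson UN_upper subset_iff)
  hence "alg_gen \<phi> (\<Union>(Y ` G)) = UNIV" using alg_gen_trans G(2) by blast
  moreover have "finite (\<Union>(Y ` G))" "\<Union>(Y ` G) \<subseteq> S" using Y G(1) by auto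
  ultimately show ?thesis using that by blast
qed

text \<open>Degree 0 is excluded because \<open>mons Y 0 = {1}\<close>: that 1 is homogeneous of
  degree 0 is not an axiom of \<open>graded_algebra\<close> and is derived only in the next
  lemma.\<close>

lemma graded_mons:
  assumes "graded_algebra \<phi> Bn" "Y \<subseteq> Bn 1" "n > 0"
  shows "mons Y n \<subseteq> Bn n"
  using assms(3)
proof (induction n)
  case (Suc n)
  show ?case
  proof (cases "n = 0")
    case False
    show ?thesis
    proof
      fix a assume "a \<in> mons Y (Suc n)"
      then obtain b c where "b \<in> mons Y n" "c \<in> mons Y 1" "a = b * c" using mons_split[of a Y n 1] by auto
      hence "b \<in> Bn n" "c \<in> Bn 1" using Suc.IH False assms(2) by auto
      hence "b * c \<in> Bn (n + 1)" using assms(1) unfolding graded_algebra_def by blast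
      thus "a \<in> Bn (Suc n)" using \<open>a = b * c\<close> by simp
    qed
  qed (use assms in auto)
qed simp

lemma graded_eq_span_mons:
  assumes gr: "graded_algebra \<phi> Bn" and "Y \<subseteq> Bn 1" and gen: "alg_gen \<phi> Y = UNIV" and n: "n > 0"
  shows "Bn n = V.span (mons Y n)"
proof
  have sub: "V.subspace (Bn k)" for k using gr unfolding graded_algebra_def by auto
  \<comment> \<open>Uniqueness of components, rephrased for sums over initial segments of possibly
    different lengths.\<close>
  have uniq: "c = c'" if "\<forall>n. c n \<in> Bn n" "\<forall>n. c' n \<in> Bn n" "\<forall>k\<ge>N. c k = 0" "\<forall>k\<ge>N'. c' k = 0"
     "(\<Sum>k<N. c k) = (\<Sum>k<N'. c' k)" for c c' N N'
  proof -
    have s: "{n. c n \<noteq> 0} \<subseteq> {..<N}" "{n. c' n \<noteq> 0} \<subseteq> {..<N'}"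
      using that(3,4) not_le by blast+
    hence fin: "finite {n. c n \<noteq> 0}" "finite {n. c' n \<noteq> 0}"
      using finite_subset by blast+
    have e1: "(\<Sum>k<N. c k) = (\<Sum>k\<in>{n. c n \<noteq> 0}. c k)"
      by (rule sum.mono_neutral_right) (use s in auto)
    have e2: "(\<Sum>k<N'. c' k) = (\<Sum>k\<in>{n. c' n \<noteq> 0}. c' k)"
      by (rule sum.mono_neutral_right) (use s in auto)
    have "\<exists>!d. (\<forall>n. d n \<in> Bn n) \<and> finite {n. d n \<noteq> 0} \<and> (\<Sum>k<N. c k) = (\<Sum>n\<in>{n. d n \<noteq> 0}. d n)"
      using gr unfolding graded_algebra_def by blast
    moreover have "(\<forall>n. c n \<in> Bn n) \<and> finite {n. c n \<noteq> 0} \<and> (\<Sum>k<N. c k) = (\<Sum>n\<in>{n. c n \<noteq> 0}. c n)"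
      using that(1) fin(1) e1 by simp
    moreover have "(\<forall>n. c' n \<in> Bn n) \<and> finite {n. c' n \<noteq> 0} \<and> (\<Sum>k<N. c k) = (\<Sum>n\<in>{n. c' n \<noteq> 0}. c' n)"
      using that(2,5) fin(2) e2 by simp
    ultimately show ?thesis by blast
  qed
  have one: "1 \<in> Bn 0"
  proof -
    obtain c where c: "\<forall>n. c n \<in> Bn n" "finite {n. c n \<noteq> 0}" "(1::'b) = (\<Sum>n\<in>{n. c n \<noteq> 0}. c n)"
    proof -
      have "\<exists>!c. (\<forall>n. c n \<in> Bn n) \<and> finite {n. c n \<noteq> 0} \<and> (1::'b) = (\<Sum>n\<in>{n. c n \<noteq> 0}. c n)"
        using gr unfolding graded_algebra_def by blast
      thus ?thesis using that by blast
    qed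
    obtain N where "\<forall>n\<in>{n. c n \<noteq> 0}. n < N" using c(2) unfolding finite_nat_set_iff_bounded by blast
    hence N: "\<forall>k\<ge>N. c k = 0" by (metis (mono_tags) mem_Collect_eq not_le)
    have s1: "(1::'b) = (\<Sum>k<N. c k)" unfolding c(3) using N
      by (intro sum.mono_neutral_left) (auto simp: not_le[symmetric])
    \<comment> \<open>Comparing components of degree \<open>m\<close> in
      \<open>b = (\<Sum>k<N. c k) * b\<close> shows that \<open>c 0\<close> fixes every homogeneous
      element, hence every \<open>c k\<close> and their sum 1.\<close>
    have "c 0 * b = b" if b: "b \<in> Bn m" for b m
    proof -
      define d where "d k = (if k < m then 0 else c (k - m) * b)" for k
      define d' where "d' k = (if k = m then b else 0)" for k
      have "d k \<in> Bn k" for k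
      proof (cases "k < m")
        case True thus ?thesis by (simp add: d_def V.subspace_0[OF sub])
      next
        case False
        hence "c (k - m) * b \<in> Bn (k - m + m)" using c(1) b gr unfolding graded_algebra_def by blast
        thus ?thesis using False by (simp add: d_def)
      qed
      moreover have "d' k \<in> Bn k" for k using b by (simp add: d'_def V.subspace_0[OF sub])
      moreover have "\<forall>k\<ge>m + N. d k = 0" using N by (auto simp: d_def)
      moreover have "\<forall>k\<ge>Suc m. d' k = 0" by (auto simp: d'_def)
      moreover have "(\<Sum>k<m + N. d k) = (\<Sum>k<Suc m. d' k)"
      proof -
        have "(\<Sum>k<m + N. d k) = (\<Sum>k\<in>{m..<m + N}. c (k - m) * b)"
          by (rule sum.mono_neutral_cong_right) (auto simp: d_def)
        also have "\<dots> = (\<Sum>k<N. c k * b)"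
          by (rule sum.reindex_bij_witness[of _ "\<lambda>k. k + m" "\<lambda>k. k - m"]) auto
        also have "\<dots> = b" using s1 by (simp add: sum_distrib_right[symmetric])
        finally show ?thesis by (simp add: d'_def)
      qed
      ultimately have "d = d'" using uniq[of d d' "m + N" "Suc m"] by blast
      hence "d m = d' m" by simp
      thus ?thesis by (simp add: d_def d'_def)
    qed
    hence "c 0 * c k = c k" for k using c(1) by blast
    hence "c 0 * (\<Sum>k<N. c k) = (\<Sum>k<N. c k)" unfolding sum_distrib_left by (intro sum.cong refl)
    hence "c 0 = 1" using s1 by simp
    thus ?thesis using c(1) by metis
  qed
  have mB: "V.span (mons Y k) \<subseteq> Bn k" for k
    using graded_mons[OF gr assms(2), of k] one by (intro V.span_minimal sub) (cases "k = 0"; auto)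
  show "V.span (mons Y n) \<subseteq> Bn n" by (rule mB)
  show "Bn n \<subseteq> V.span (mons Y n)"
  proof
    fix b assume b: "b \<in> Bn n"
    have "b \<in> V.span (\<Union>n. mons Y n)" using alg_gen_span_mons gen by blast
    \<comment> \<open>The monomials in an expression for \<open>b\<close> are sorted by degree;
      uniqueness then forces the part of degree \<open>n\<close> to be \<open>b\<close>
      itself.\<close>
    hence "\<exists>c N. (\<forall>k. c k \<in> V.span (mons Y k)) \<and> (\<forall>k\<ge>N. c k = 0) \<and> b = (\<Sum>k<N. c k)"
    proof (induction rule: V.span_induct_alt)
      case base thus ?case by (intro exI[of _ "\<lambda>_. 0"] exI[of _ 0]) (auto intro: V.span_zero)
    next
      case (step a x y)
      then obtain c N where c: "\<forall>k. c k \<in> V.span (mons Y k)" "\<forall>k\<ge>N. c k = 0" "y = (\<Sum>k<N. c k)" by blast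
      obtain m where m: "x \<in> mons Y m" using step by auto
      define c' where "c' k = (if k = m then kscale \<phi> a x else 0) + c k" for k
      have "\<forall>k. c' k \<in> V.span (mons Y k)" unfolding c'_def using c(1) m
        by (auto intro: V.span_add V.span_scale V.span_base)
      moreover have "\<forall>k\<ge>N + Suc m. c' k = 0" using c(2) by (auto simp: c'_def)
      moreover have "(\<Sum>k<N + Suc m. c' k) = kscale \<phi> a x + (\<Sum>k<N + Suc m. c k)"
        unfolding c'_def sum.distrib by simp
      moreover have "(\<Sum>k<N + Suc m. c k) = y" unfolding c(3) using c(2)
        by (intro sum.mono_neutral_right) auto
      ultimately show ?case by metis
    qed
    then obtain c N where c: "\<forall>k. c k \<in> V.span (mons Y k)" "\<forall>k\<ge>N. c k = 0" "b = (\<Sum>k<N. c k)" by blast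
    define d where "d k = (if k = n then b else 0)" for k
    have "c = d" by (rule uniq[of _ _ N "Suc n"])
       (use c mB b in \<open>auto simp: d_def V.subspace_0[OF sub]\<close>)
    hence "c n = b" by (simp add: d_def)
    thus "b \<in> V.span (mons Y n)" using c(1) by metis
  qed
qed

end

section \<open>Algebraic independence and growth\<close>

text \<open>The value 0 from index \<open>d\<close> on makes equality of functions the same as
  equality of exponents.\<close>

definition expon :: "nat \<Rightarrow> nat \<Rightarrow> (nat \<Rightarrow> nat) set" where
  "expon d n = {\<beta>. (\<forall>i\<ge>d. \<beta> i = 0) \<and> (\<Sum>i<d. \<beta> i) = n}"

definition xpow :: "(nat \<Rightarrow> 'b::comm_ring_1) \<Rightarrow> nat \<Rightarrow> (nat \<Rightarrow> nat) \<Rightarrow> 'b" where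
  "xpow x d \<beta> = (\<Prod>i<d. x i ^ \<beta> i)"

lemma finite_expon: "finite (expon d n)"
proof -
  have "expon d n \<subseteq> {f. \<forall>i. (i \<in> {..<d} \<longrightarrow> f i \<in> {..n}) \<and> (i \<notin> {..<d} \<longrightarrow> f i = 0)}"
    unfolding expon_def by (auto intro: member_le_sum)
  thus ?thesis using finite_set_of_finite_funs[of "{..<d}" "{..n}" 0] finite_subset by blast
qed

text \<open>The first \<open>q\<close> exponents determine the last one through the degree; hence
  \<open>q + 1\<close> variables give growth of order \<open>q\<close>.\<close>

lemma card_expon_le: "card (expon (Suc q) n) \<le> (n + 1) ^ q"
proof -
  have le: "\<beta> i \<le> n" if "\<beta> \<in> expon (Suc q) n" "i < Suc q" for \<beta> i
    using that unfolding expon_def by (auto intro: member_le_sum simp del: sum.lessThan_Suc)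
  have "card (expon (Suc q) n) \<le> card (PiE {..<q} (\<lambda>_. {..n}))"
  proof (rule card_inj_on_le[of "\<lambda>\<beta>. restrict \<beta> {..<q}"])
    show "inj_on (\<lambda>\<beta>. restrict \<beta> {..<q}) (expon (Suc q) n)"
    proof (rule inj_onI)
      fix \<beta> \<gamma> assume *: "\<beta> \<in> expon (Suc q) n" "\<gamma> \<in> expon (Suc q) n"
        "restrict \<beta> {..<q} = restrict \<gamma> {..<q}"
      have eq: "\<beta> i = \<gamma> i" if "i < q" for i using fun_cong[OF *(3), of i] that by simp
      hence "(\<Sum>i<q. \<beta> i) = (\<Sum>i<q. \<gamma> i)" by simp
      hence "\<beta> q = \<gamma> q" using *(1,2) unfolding expon_def by auto
      show "\<beta> = \<gamma>"
      proof
        fix i show "\<beta> i = \<gamma> i"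
          using *(1,2) eq[of i] \<open>\<beta> q = \<gamma> q\<close> unfolding expon_def
          by (cases "i < q"; cases "i = q") auto
      qed
    qed
    show "(\<lambda>\<beta>. restrict \<beta> {..<q}) ` expon (Suc q) n \<subseteq> PiE {..<q} (\<lambda>_. {..n})"
      using le by (intro image_subsetI restrict_PiE_iff[THEN iffD2]) auto
  qed (auto intro: finite_PiE)
  thus ?thesis by (simp add: card_PiE)
qed

lemma xpow_cong: "(\<And>i. i < d \<Longrightarrow> x i = y i) \<Longrightarrow> (\<And>i. i < d \<Longrightarrow> \<beta> i = \<gamma> i) \<Longrightarrow> xpow x d \<beta> = xpow y d \<gamma>"
  unfolding xpow_def by (rule prod.cong) auto

lemma xpow_add: "xpow x d (\<lambda>i. \<beta> i + \<gamma> i) = xpow x d \<beta> * xpow x d \<gamma>"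
  unfolding xpow_def by (simp add: power_add prod.distrib)

lemma xpow_scale: "xpow x d (\<lambda>i. k * \<beta> i) = xpow x d \<beta> ^ k"
  unfolding xpow_def by (simp add: mult.commute[of k] power_mult prod_power_distrib)

lemma xpow_in_mons: "x ` {..<d} \<subseteq> S \<Longrightarrow> xpow x d \<beta> \<in> mons S (\<Sum>i<d. \<beta> i)"
proof (induction d)
  case (Suc d)
  have "xpow x d \<beta> * x d ^ \<beta> d \<in> mons S ((\<Sum>i<d. \<beta> i) + \<beta> d * 1)"
    by (intro mons_mult mons_power Suc.IH) (use Suc.prems in auto)
  thus ?case by (simp add: xpow_def)
qed (simp add: xpow_def)

lemma mons_image_eq: "mons (x ` {..<d}) n = xpow x d ` expon d n"
proof
  show "xpow x d ` expon d n \<subseteq> mons (x ` {..<d}) n"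
    using xpow_in_mons[of x d "x ` {..<d}"] unfolding expon_def by auto
  show "mons (x ` {..<d}) n \<subseteq> xpow x d ` expon d n"
  proof
    fix a assume "a \<in> mons (x ` {..<d}) n"
    then obtain ys where ys: "a = prod_list ys" "set ys \<subseteq> x ` {..<d}" "length ys = n" unfolding mons_def by auto
    have "prod_list ys \<in> xpow x d ` expon d (length ys)" using ys(2)
    proof (induction ys)
      case Nil
      have "(\<lambda>_. 0) \<in> expon d 0" "xpow x d (\<lambda>_. 0) = 1" by (auto simp: expon_def xpow_def)
      thus ?case by (metis image_eqI list.size(3) prod_list.Nil)
    next
      case (Cons y ys)
      then obtain \<beta> where \<beta>: "\<beta> \<in> expon d (length ys)" "prod_list ys = xpow x d \<beta>" by auto
      obtain j where j: "j < d" "y = x j" using Cons.prems by auto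
      define \<delta> :: "nat \<Rightarrow> nat" where "\<delta> i = (if i = j then 1 else 0)" for i
      have "xpow x d \<delta> = x j" unfolding xpow_def \<delta>_def
        using j by (simp add: if_distrib[of "\<lambda>u. _ ^ u"] prod.delta cong: if_cong)
      hence "prod_list (y # ys) = xpow x d (\<lambda>i. \<delta> i + \<beta> i)"
        using \<beta>(2) j by (simp add: xpow_add)
      moreover have "(\<lambda>i. \<delta> i + \<beta> i) \<in> expon d (length (y # ys))"
        using \<beta>(1) j unfolding expon_def \<delta>_def by (auto simp: sum.distrib)
      ultimately show ?case by blast
    qed
    thus "a \<in> xpow x d ` expon d n" using ys by simp
  qed
qed

context kalgebra
begin

text \<open>Only homogeneous relations are tested. For elements of degree one in a graded algebra
  this is ordinary algebraic independence, and each relation stays inside one graded piece.\<close>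

definition alg_indep :: "(nat \<Rightarrow> 'b) \<Rightarrow> nat \<Rightarrow> bool" where
  "alg_indep x d \<longleftrightarrow> (\<forall>n c. (\<Sum>\<beta>\<in>expon d n. \<phi> (c \<beta>) * xpow x d \<beta>) = 0 \<longrightarrow> (\<forall>\<beta>\<in>expon d n. c \<beta> = 0))"

lemma alg_indepD:
  assumes "alg_indep x d" "(\<Sum>\<beta>\<in>expon d n. \<phi> (c \<beta>) * xpow x d \<beta>) = 0" "\<beta> \<in> expon d n"
  shows "c \<beta> = 0"
  using assms unfolding alg_indep_def by blast

lemma alg_indep_inj:
  assumes "alg_indep x d" shows "inj_on (xpow x d) (expon d n)"
  using assms independent_family(1)[OF finite_expon[of d n], of "xpow x d"] unfolding alg_indep_def by blast

lemma alg_indep_inj_on: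
  assumes "alg_indep x d" shows "inj_on x {..<d}"
proof (rule inj_onI)
  fix i j assume ij: "i \<in> {..<d}" "j \<in> {..<d}" "x i = x j"
  define \<delta> :: "nat \<Rightarrow> nat \<Rightarrow> nat" where "\<delta> j i = (if i = j then 1 else 0)" for i j
  have 1: "xpow x d (\<delta> j) = x j" if "j < d" for j unfolding xpow_def \<delta>_def
    using that by (simp add: if_distrib[of "\<lambda>u. _ ^ u"] prod.delta cong: if_cong)
  have 2: "\<delta> j \<in> expon d 1" if "j < d" for j using that unfolding expon_def \<delta>_def by auto
  have "\<delta> i = \<delta> j" using alg_indep_inj[OF assms, of 1] 1 2 ij unfolding inj_on_def by (metis lessThan_iff)
  from fun_cong[OF this, of i] show "i = j" by (simp add: \<delta>_def split: if_splits)
qed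

lemma alg_indep_xpow_nonzero:
  assumes "alg_indep x d" shows "xpow x d \<beta> \<noteq> 0"
proof
  assume z: "xpow x d \<beta> = 0"
  define \<gamma> where "\<gamma> i = (if i < d then \<beta> i else 0)" for i
  define n where "n = (\<Sum>i<d. \<gamma> i)"
  have \<gamma>: "\<gamma> \<in> expon d n" unfolding expon_def n_def by (auto simp: \<gamma>_def)
  have "xpow x d \<gamma> = 0" using z xpow_cong[of d x x \<beta> \<gamma>] by (simp add: \<gamma>_def)
  hence "(\<Sum>\<beta>\<in>expon d n. \<phi> (if \<beta> = \<gamma> then 1 else 0) * xpow x d \<beta>) = 0"
    by (intro sum.neutral) auto
  from assms[unfolded alg_indep_def, rule_format, OF this \<gamma>] show False by simp
qed

text \<open>A dependence relation is sorted by powers of \<open>y\<close>. Independence of the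
  \<open>x i\<close> makes some coefficient nonzero; \<open>a\<close> is the highest such
  coefficient. Homogeneity of the relation fixes the degrees of all coefficients.\<close>

lemma algebraic_relation:
  assumes ind: "alg_indep x d" and dep: "\<not> alg_indep (x(d := y)) (Suc d)"
  obtains s D a p where "D > 0" "a \<noteq> 0" "a \<in> V.span (mons (x ` {..<d}) s)"
    "a * y ^ D = (\<Sum>i<D. p i * y ^ i)" "\<And>i. i < D \<Longrightarrow> p i \<in> V.span (mons (x ` {..<d}) (s + D - i))"
proof -
  obtain n c \<beta>0 where c: "(\<Sum>\<beta>\<in>expon (Suc d) n. \<phi> (c \<beta>) * xpow (x(d := y)) (Suc d) \<beta>) = 0"
    and \<beta>0: "\<beta>0 \<in> expon (Suc d) n" "c \<beta>0 \<noteq> 0" using dep unfolding alg_indep_def by blast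
  define P where "P l = (\<Sum>\<beta>\<in>expon d (n - l). \<phi> (c (\<beta>(d := l))) * xpow x d \<beta>)" for l
  have xs: "xpow (x(d := y)) (Suc d) (\<beta>(d := l)) = xpow x d \<beta> * y ^ l" for \<beta> l
  proof -
    have "xpow (x(d := y)) (Suc d) (\<beta>(d := l)) = xpow (x(d := y)) d (\<beta>(d := l)) * y ^ l"
      unfolding xpow_def by simp
    also have "xpow (x(d := y)) d (\<beta>(d := l)) = xpow x d \<beta>" by (rule xpow_cong) auto
    finally show ?thesis .
  qed
  have "(\<Sum>l\<le>n. P l * y ^ l) = (\<Sum>l\<le>n. \<Sum>\<beta>\<in>expon d (n - l). \<phi> (c (\<beta>(d := l))) * xpow x d \<beta> * y ^ l)"
    unfolding P_def sum_distrib_right ..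
  also have "\<dots> = (\<Sum>(l,\<beta>)\<in>Sigma {..n} (\<lambda>l. expon d (n - l)). \<phi> (c (\<beta>(d := l))) * xpow x d \<beta> * y ^ l)"
    by (rule sum.Sigma) (auto intro: finite_expon)
  also have "\<dots> = (\<Sum>\<beta>\<in>expon (Suc d) n. \<phi> (c \<beta>) * xpow (x(d := y)) (Suc d) \<beta>)"
  proof (rule sum.reindex_bij_witness[of _ "\<lambda>\<beta>. (\<beta> d, \<beta>(d := 0))" "\<lambda>(l,\<beta>). \<beta>(d := l)"])
    fix p assume "p \<in> Sigma {..n} (\<lambda>l. expon d (n - l))"
    then obtain l \<beta> where p: "p = (l, \<beta>)" "l \<le> n" "\<beta> \<in> expon d (n - l)" by auto
    show "(case p of (l, \<beta>) \<Rightarrow> \<beta>(d := l)) \<in> expon (Suc d) n" using p unfolding expon_def by auto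
    show "((case p of (l, \<beta>) \<Rightarrow> \<beta>(d := l)) d, (case p of (l, \<beta>) \<Rightarrow> \<beta>(d := l))(d := 0)) = p"
      using p unfolding expon_def by (auto simp: fun_eq_iff)
    show "\<phi> (c (case p of (l, \<beta>) \<Rightarrow> \<beta>(d := l))) * xpow (x(d := y)) (Suc d) (case p of (l, \<beta>) \<Rightarrow> \<beta>(d := l)) =
         (case p of (l, \<beta>) \<Rightarrow> \<phi> (c (\<beta>(d := l))) * xpow x d \<beta> * y ^ l)"
      using p by (simp add: xs mult.assoc)
  next
    fix \<beta> assume "\<beta> \<in> expon (Suc d) n"
    thus "(\<beta> d, \<beta>(d := 0)) \<in> Sigma {..n} (\<lambda>l. expon d (n - l))" unfolding expon_def
      by (auto simp: le_Suc_eq)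
  qed auto
  finally have rel: "(\<Sum>l\<le>n. P l * y ^ l) = 0" using c by simp
  have l0: "\<beta>0 d \<le> n" "\<beta>0(d := 0) \<in> expon d (n - \<beta>0 d)"
    using \<beta>0 unfolding expon_def by (auto simp: le_Suc_eq)
  have "P (\<beta>0 d) \<noteq> 0"
  proof
    assume "P (\<beta>0 d) = 0"
    from alg_indepD[OF ind this[unfolded P_def] l0(2)] show False using \<beta>0(2) by simp
  qed
  define D where "D = Max {l. l \<le> n \<and> P l \<noteq> 0}"
  have fin: "finite {l. l \<le> n \<and> P l \<noteq> 0}" by (rule finite_subset[of _ "{..n}"]) auto
  have D: "D \<le> n" "P D \<noteq> 0" using Max_in[OF fin] l0(1) \<open>P (\<beta>0 d) \<noteq> 0\<close> unfolding D_def by blast+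
  have Dmax: "P l = 0" if "D < l" "l \<le> n" for l
  proof (rule ccontr)
    assume "P l \<noteq> 0"
    hence "l \<in> {l. l \<le> n \<and> P l \<noteq> 0}" using that by simp
    from Max_ge[OF fin this] show False using that(1) unfolding D_def by simp
  qed
  have "(\<Sum>l\<le>n. P l * y ^ l) = (\<Sum>l\<in>insert D {..<D}. P l * y ^ l)"
    by (rule sum.mono_neutral_right) (use D Dmax in \<open>auto simp: not_less\<close>)
  hence top: "P D * y ^ D + (\<Sum>l<D. P l * y ^ l) = 0" using rel by simp
  have span: "P l \<in> V.span (mons (x ` {..<d}) (n - l))" for l
    unfolding P_def mons_image_eq
    by (intro V.span_sum subspace_phi V.subspace_span V.span_base imageI)
  show ?thesis
  proof (rule that[of D "P D" "n - D" "\<lambda>l. - P l"])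
    \<comment> \<open>For \<open>D = 0\<close> the relation would reduce to
      \<open>P D = 0\<close>.\<close>
    show "D > 0" using D top by (cases "D = 0") auto
    show "P D \<noteq> 0" by fact
    show "P D \<in> V.span (mons (x ` {..<d}) (n - D))" by (rule span)
    show "P D * y ^ D = (\<Sum>i<D. - P i * y ^ i)"
      using top by (simp add: sum_negf eq_neg_iff_add_eq_0)
    show "- P i \<in> V.span (mons (x ` {..<d}) (n - D + D - i))" if "i < D" for i
      using V.span_neg[OF span[of i]] D by simp
  qed
qed

section \<open>Growth under adjunction of algebraic elements\<close>

lemma dim_image_mult_le:
  assumes "findim H"
  shows "findim ((*) u ` H)" "V.dim ((*) u ` H) \<le> V.dim H"
proof -
  obtain T where T: "T \<subseteq> H" "V.independent T" "H \<subseteq> V.span T" "card T = V.dim H"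
    by (rule V.basis_exists[of H]) blast
  have fT: "finite T" using independent_le_dim(1)[OF assms T(2,1)] .
  have "(*) u ` H \<subseteq> V.span ((*) u ` T)"
  proof (rule image_subsetI)
    fix h assume "h \<in> H"
    thus "u * h \<in> V.span ((*) u ` T)" using T(3)
      by (intro span_mult[of u "{u}" h T]) (auto intro: V.span_base)
  qed
  thus "findim ((*) u ` H)" "V.dim ((*) u ` H) \<le> V.dim H"
    using fT V.dim_le_card[of "(*) u ` H" "(*) u ` T"] card_image_le[OF fT, of "(*) u"] T(4)
    unfolding findim_def by auto
qed

text \<open>After multiplication by \<open>a ^ l\<close>, the power \<open>y ^ l\<close> reduces to
  powers of \<open>y\<close> below \<open>D\<close>. So multiplication by \<open>a ^ n\<close>
  embeds degree \<open>n\<close> of the larger algebra into a sum of \<open>D\<close> multiples of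
  graded pieces of the smaller one, of degrees \<open>n * s + n - i\<close>. As
  \<open>n * s + n + 1 \<le> (s + 1) * (n + 1)\<close>, the order \<open>q\<close> is kept.\<close>

lemma adjoin_dim_bound:
  assumes S: "finite S" and D: "D > 0" and a: "a \<noteq> 0" "a \<in> V.span (mons S s)"
    and rel: "a * y ^ D = (\<Sum>i<D. p i * y ^ i)"
    and p: "\<And>i. i < D \<Longrightarrow> p i \<in> V.span (mons S (s + D - i))"
    and bound: "\<And>n. V.dim (V.span (mons S n)) \<le> C * (n + 1) ^ q"
  shows "V.dim (V.span (mons (insert y S) n)) \<le> D * (C * (s + 1) ^ q) * (n + 1) ^ q"
proof -
  \<comment> \<open>Degrees such as \<open>l * s + l - i\<close> can be negative; \<open>H\<close>
    is zero there, so that products still respect degrees.\<close>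
  define H where "H k = (if k < 0 then {0} else V.span (mons S (nat k)))" for k :: int
  have Hsub: "V.subspace (H k)" for k unfolding H_def by (auto intro: V.subspace_single_0)
  have Hnat: "H (int k) = V.span (mons S k)" for k unfolding H_def by simp
  have Hmult: "u * v \<in> H (j + k)" if "u \<in> H j" "v \<in> H k" for u v j k
  proof (cases "j < 0 \<or> k < 0")
    case True
    hence uv: "u * v = 0" using that by (auto simp: H_def)
    show ?thesis unfolding uv by (rule V.subspace_0[OF Hsub])
  next
    case False
    thus ?thesis using that span_mons_mult[of u S "nat j" v "nat k"] by (auto simp: H_def nat_add_distrib)
  qed
  have Hfin: "findim (H k)" for k
    unfolding H_def findim_def using finite_mons[OF S] V.span_zero by auto
  have red: "\<exists>r. (\<forall>i<D. r i \<in> H (int (l * s + l) - int i)) \<and> a ^ l * y ^ l = (\<Sum>i<D. r i * y ^ i)" for l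
  proof (induction l)
    case 0
    have "1 \<in> H 0" unfolding H_def by (simp add: V.span_base)
    hence "\<forall>i<D. (if i = 0 then 1 else 0) \<in> H (int (0 * s + 0) - int i)"
      using V.subspace_0[OF Hsub] by auto
    moreover have "a ^ 0 * y ^ 0 = (\<Sum>i<D. (if i = 0 then 1 else 0) * y ^ i)"
      using D by (simp add: if_distrib[of "\<lambda>u. u * _"] cong: if_cong)
    ultimately show ?case by (intro exI[of _ "\<lambda>i. if i = 0 then 1 else 0"] conjI)
  next
    case (Suc l)
    then obtain r where r: "\<And>i. i < D \<Longrightarrow> r i \<in> H (int (l * s + l) - int i)"
      "a ^ l * y ^ l = (\<Sum>i<D. r i * y ^ i)" by blast
    obtain D' where D': "D = Suc D'" using D by (cases D) auto
    \<comment> \<open>Multiplication by \<open>a * y\<close> raises each exponent by one, and the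
      term that reaches \<open>y ^ D\<close> is rewritten by the relation.\<close>
    define r' where "r' i = (if i = 0 then 0 else a * r (i - 1)) + r D' * p i" for i
    have "a ^ Suc l * y ^ Suc l = a * y * (\<Sum>i<D. r i * y ^ i)"
      unfolding r(2)[symmetric] by (simp add: mult_ac)
    also have "\<dots> = (\<Sum>i<D'. a * r i * y ^ Suc i) + r D' * (a * y ^ D)"
      unfolding D' by (simp add: sum_distrib_left algebra_simps)
    also have "(\<Sum>i<D'. a * r i * y ^ Suc i) = (\<Sum>i<D. (if i = 0 then 0 else a * r (i - 1)) * y ^ i)"
      unfolding D' by (subst sum.lessThan_Suc_shift) simp
    also have "r D' * (a * y ^ D) = (\<Sum>i<D. r D' * p i * y ^ i)"
      unfolding rel by (simp add: sum_distrib_left mult_ac)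
    finally have "a ^ Suc l * y ^ Suc l = (\<Sum>i<D. r' i * y ^ i)"
      unfolding r'_def by (simp add: sum.distrib algebra_simps)
    moreover have "r' i \<in> H (int (Suc l * s + Suc l) - int i)" if i: "i < D" for i
    proof -
      have "p i \<in> H (int (s + D - i))" unfolding Hnat using p[OF i] .
      hence "r D' * p i \<in> H ((int (l * s + l) - int D') + int (s + D - i))"
        using r(1)[of D'] D' by (intro Hmult) auto
      also have "(int (l * s + l) - int D') + int (s + D - i) = int (Suc l * s + Suc l) - int i"
        using i D' by (simp add: of_nat_diff algebra_simps)
      finally have 1: "r D' * p i \<in> H (int (Suc l * s + Suc l) - int i)" .
      have 2: "a * r (i - 1) \<in> H (int (Suc l * s + Suc l) - int i)" if "i \<noteq> 0"
      proof -
        have "a * r (i - 1) \<in> H (int s + (int (l * s + l) - int (i - 1)))"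
          using r(1)[of "i - 1"] i a(2) by (intro Hmult) (auto simp: Hnat)
        also have "int s + (int (l * s + l) - int (i - 1)) = int (Suc l * s + Suc l) - int i"
          using that by (simp add: of_nat_diff algebra_simps)
        finally show ?thesis .
      qed
      show ?thesis unfolding r'_def using 1 2 V.subspace_0[OF Hsub] by (auto intro: V.subspace_add[OF Hsub])
    qed
    ultimately show ?case by blast
  qed
  define W where "W = V.span (\<Union>i\<in>{..<D}. (*) (y ^ i) ` H (int (n * s + n) - int i))"
  have sub: "V.subspace W" unfolding W_def by simp
  have "a ^ n * u \<in> W" if u: "u \<in> V.span (mons (insert y S) n)" for u
  proof (rule span_mult[OF _ u _ sub])
    show "a ^ n \<in> V.span {a ^ n}" by (simp add: V.span_base)
    fix w t assume "w \<in> {a ^ n}" "t \<in> mons (insert y S) n"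
    then obtain l b where w: "w = a ^ n" and l: "l \<le> n" "b \<in> mons S (n - l)" "t = b * y ^ l"
      using mons_insert[of t y S n] by auto
    obtain r where r: "\<And>i. i < D \<Longrightarrow> r i \<in> H (int (l * s + l) - int i)"
      "a ^ l * y ^ l = (\<Sum>i<D. r i * y ^ i)" using red[of l] by blast
    have "a ^ n = a ^ (n - l) * a ^ l" using l(1) by (simp add: power_add[symmetric])
    hence "w * t = a ^ (n - l) * b * (a ^ l * y ^ l)" using w l by (simp add: mult_ac)
    also have "\<dots> = (\<Sum>i<D. y ^ i * (a ^ (n - l) * b * r i))"
      unfolding r(2) by (simp add: sum_distrib_left mult_ac)
    finally have wt: "w * t = (\<Sum>i<D. y ^ i * (a ^ (n - l) * b * r i))" .
    have "a ^ (n - l) * b * r i \<in> H (int (n * s + n) - int i)" if "i < D" for i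
    proof -
      have "a ^ (n - l) \<in> H (int ((n - l) * s))" "b \<in> H (int (n - l))"
        unfolding Hnat using span_mons_power[OF a(2), of "n - l"] l(2) by (auto intro: V.span_base)
      hence "a ^ (n - l) * b * r i \<in> H (int ((n - l) * s) + int (n - l) + (int (l * s + l) - int i))"
        using r(1)[OF that] by (intro Hmult)
      also have "int ((n - l) * s) + int (n - l) + (int (l * s + l) - int i) = int (n * s + n) - int i"
        using l(1) by (simp add: of_nat_diff algebra_simps)
      finally show ?thesis .
    qed
    thus "w * t \<in> W" unfolding wt W_def by (intro V.span_sum V.span_base) auto
  qed
  hence "V.dim (V.span (mons (insert y S) n)) \<le> V.dim W"
    using a(1) S dim_span_UN_le(2)[of "{..<D}" "\<lambda>i. (*) (y ^ i) ` H (int (n * s + n) - int i)"]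
      dim_image_mult_le(1)[OF Hfin]
    by (intro dim_le_of_mult[of _ _ "a ^ n"]) (auto simp: W_def intro!: findim_span_finite finite_mons)
  also have "\<dots> \<le> (\<Sum>i<D. V.dim ((*) (y ^ i) ` H (int (n * s + n) - int i)))"
    unfolding W_def by (rule dim_span_UN_le(1)) (auto intro: dim_image_mult_le(1)[OF Hfin])
  also have "\<dots> \<le> (\<Sum>i<D. C * (s + 1) ^ q * (n + 1) ^ q)"
  proof (rule sum_mono)
    fix i
    have "V.dim ((*) (y ^ i) ` H (int (n * s + n) - int i)) \<le> V.dim (H (int (n * s + n) - int i))"
      by (rule dim_image_mult_le(2)[OF Hfin])
    also have "\<dots> \<le> C * ((s + 1) * (n + 1)) ^ q"
    proof (cases "i \<le> n * s + n")
      case True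
      have "V.dim (H (int (n * s + n) - int i)) = V.dim (V.span (mons S (n * s + n - i)))"
        using True Hnat[of "n * s + n - i"] by (simp add: of_nat_diff)
      also have "\<dots> \<le> C * (n * s + n - i + 1) ^ q" by (rule bound)
      also have "\<dots> \<le> C * ((s + 1) * (n + 1)) ^ q"
        by (intro mult_left_mono power_mono) (auto simp: algebra_simps)
      finally show ?thesis .
    next
      case False
      hence "int (n * s + n) - int i < 0" by (simp only: not_le of_nat_less_iff diff_less_0_iff_less)
      hence "H (int (n * s + n) - int i) = V.span {}" unfolding H_def by (simp only: if_True V.span_empty)
      hence "V.dim (H (int (n * s + n) - int i)) \<le> 0" using V.dim_le_card[of "V.span {}" "{}"] by simp
      thus ?thesis by simp
    qed
    also have "\<dots> = C * (s + 1) ^ q * (n + 1) ^ q" by (simp only: power_mult_distrib mult.assoc)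
    finally show "V.dim ((*) (y ^ i) ` H (int (n * s + n) - int i)) \<le> C * (s + 1) ^ q * (n + 1) ^ q" .
  qed
  finally show ?thesis by (simp add: mult_ac)
qed

text \<open>A largest independent family exists since independent elements are distinct, so its
  length is at most \<open>card Y\<close>. A nonzero element of a domain is independent by itself,
  so the length is positive and can be written \<open>Suc q\<close>.\<close>

lemma transcendence_basis_exists:
  assumes "finite Y" "y \<in> Y" "y \<noteq> 0"
  obtains x q where "x ` {..<Suc q} \<subseteq> Y" "alg_indep x (Suc q)"
    "\<And>y. y \<in> Y \<Longrightarrow> \<not> alg_indep (x(Suc q := y)) (Suc (Suc q))"
proof -
  define P where "P d \<longleftrightarrow> (\<exists>x. x ` {..<d} \<subseteq> Y \<and> alg_indep x d)" for d
  have "alg_indep (\<lambda>_. y) 1" unfolding alg_indep_def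
  proof (intro allI impI ballI)
    fix n c \<beta> assume *: "(\<Sum>\<beta>\<in>expon 1 n. \<phi> (c \<beta>) * xpow (\<lambda>_. y) 1 \<beta>) = 0" "\<beta> \<in> expon 1 n"
    have "expon 1 n = {\<beta>}" using *(2) unfolding expon_def by (auto simp: fun_eq_iff Suc_le_eq)
         (metis gr0I)
    thus "c \<beta> = 0" using * assms(3) by (simp add: xpow_def)
  qed
  hence P1: "P 1" unfolding P_def using assms(2) by (intro exI[of _ "\<lambda>_. y"]) auto
  have bd: "d \<le> card Y" if "P d" for d
  proof -
    obtain x where x: "x ` {..<d} \<subseteq> Y" "alg_indep x d" using \<open>P d\<close> unfolding P_def by blast
    thus ?thesis using card_inj_on_le[OF alg_indep_inj_on[OF x(2)] x(1) assms(1)] by simp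
  qed
  define d where "d = (GREATEST d. P d)"
  have d: "P d" unfolding d_def using GreatestI_nat[of P 1 "card Y"] P1 bd by blast
  have dmax: "e \<le> d" if "P e" for e unfolding d_def using Greatest_le_nat[of P e "card Y"] that bd by blast
  obtain q where q: "d = Suc q" using dmax[OF P1] by (cases d) auto
  obtain x where x: "x ` {..<d} \<subseteq> Y" "alg_indep x d" using d unfolding P_def by blast
  show ?thesis
  proof (rule that[of x q])
    fix z assume z: "z \<in> Y"
    show "\<not> alg_indep (x(Suc q := z)) (Suc (Suc q))"
    proof
      assume "alg_indep (x(Suc q := z)) (Suc (Suc q))"
      moreover have "(x(Suc q := z)) ` {..<Suc (Suc q)} \<subseteq> Y" using x(1) z q by (auto simp: less_Suc_eq)
      ultimately have "P (Suc d)" unfolding P_def q by blast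
      thus False using dmax[of "Suc d"] by simp
    qed
  qed (use x q in auto)
qed

text \<open>The other generators are adjoined one at a time. Each satisfies a relation over the
  \<open>x i\<close>, so only the constant grows, not the order \<open>q\<close>.\<close>

lemma mons_dim_bound:
  assumes "finite Y" "x ` {..<Suc q} \<subseteq> Y" "alg_indep x (Suc q)"
    and "\<And>y. y \<in> Y \<Longrightarrow> \<not> alg_indep (x(Suc q := y)) (Suc (Suc q))"
  shows "\<exists>C. \<forall>n. V.dim (V.span (mons Y n)) \<le> C * (n + 1) ^ q"
proof -
  have "\<exists>C. \<forall>n. V.dim (V.span (mons (x ` {..<Suc q} \<union> Z) n)) \<le> C * (n + 1) ^ q" if "Z \<subseteq> Y" for Z
    using finite_subset[OF that assms(1)] that
  proof (induction Z rule: finite_induct)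
    case empty
    have "V.dim (V.span (mons (x ` {..<Suc q}) n)) \<le> 1 * (n + 1) ^ q" for n
    proof -
      have "V.dim (V.span (mons (x ` {..<Suc q}) n)) \<le> card (mons (x ` {..<Suc q}) n)"
        by (rule V.dim_le_card) (auto intro: finite_mons)
      also have "\<dots> \<le> card (expon (Suc q) n)" unfolding mons_image_eq by (rule card_image_le[OF finite_expon])
      also have "\<dots> \<le> (n + 1) ^ q" by (rule card_expon_le)
      finally show ?thesis by simp
    qed
    thus ?case by (metis sup_bot.right_neutral)
  next
    case (insert y Z)
    then obtain C where C: "\<And>n. V.dim (V.span (mons (x ` {..<Suc q} \<union> Z) n)) \<le> C * (n + 1) ^ q" by auto
    obtain s D a p where r: "D > 0" "a \<noteq> 0" "a \<in> V.span (mons (x ` {..<Suc q}) s)"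
      "a * y ^ D = (\<Sum>i<D. p i * y ^ i)" "\<And>i. i < D \<Longrightarrow> p i \<in> V.span (mons (x ` {..<Suc q}) (s + D - i))"
      by (rule algebraic_relation[OF assms(3) assms(4)[of y]]) (use insert.prems in auto)
    have sp: "V.span (mons (x ` {..<Suc q}) m) \<subseteq> V.span (mons (x ` {..<Suc q} \<union> Z) m)" for m
      by (intro V.span_mono mons_mono) auto
    have "V.dim (V.span (mons (insert y (x ` {..<Suc q} \<union> Z)) n)) \<le> D * (C * (s + 1) ^ q) * (n + 1) ^ q" for n
      by (rule adjoin_dim_bound[OF _ r(1,2) _ r(4) _ C]) (use r(3,5) sp insert.hyps in auto)
    thus ?case by (metis Un_insert_right)
  qed
  from this[OF order_refl] show ?thesis using assms(2) by (simp add: sup.absorb2)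
qed

end

section \<open>A valuation separating monomials\<close>

definition lexlt :: "(nat \<Rightarrow> nat) \<Rightarrow> (nat \<Rightarrow> nat) \<Rightarrow> bool" where
  "lexlt \<beta> \<gamma> \<longleftrightarrow> (\<exists>i. \<beta> i < \<gamma> i \<and> (\<forall>j<i. \<beta> j = \<gamma> j))"

lemma lexlt_irrefl: "\<not> lexlt \<beta> \<beta>"
  unfolding lexlt_def by auto

lemma lexlt_total:
  assumes "\<beta> \<noteq> \<gamma>" shows "lexlt \<beta> \<gamma> \<or> lexlt \<gamma> \<beta>"
proof -
  obtain i where "\<beta> i \<noteq> \<gamma> i" using assms by auto
  define k where "k = (LEAST i. \<beta> i \<noteq> \<gamma> i)"
  have "\<beta> k \<noteq> \<gamma> k" unfolding k_def by (rule LeastI, fact)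
  moreover have "\<forall>j<k. \<beta> j = \<gamma> j" unfolding k_def using not_less_Least by blast
  ultimately show ?thesis unfolding lexlt_def by (metis linorder_neq_iff)
qed

lemma lexlt_add:
  assumes "lexlt \<beta> \<gamma>" "lexlt \<beta>' \<gamma>' \<or> \<beta>' = \<gamma>'"
  shows "lexlt (\<lambda>i. \<beta> i + \<beta>' i) (\<lambda>i. \<gamma> i + \<gamma>' i)"
proof -
  obtain i where i: "\<beta> i < \<gamma> i" "\<forall>j<i. \<beta> j = \<gamma> j" using assms(1) unfolding lexlt_def by auto
  show ?thesis
  proof (cases "\<beta>' = \<gamma>'")
    case True thus ?thesis using i unfolding lexlt_def by auto
  next
    case False
    then obtain j where j: "\<beta>' j < \<gamma>' j" "\<forall>k<j. \<beta>' k = \<gamma>' k" using assms(2) unfolding lexlt_def by auto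
    show ?thesis unfolding lexlt_def
      by (rule exI[of _ "min i j"]) (use i j in \<open>cases i j rule: linorder_cases; auto simp: min_def add_strict_mono\<close>)
  qed
qed

text \<open>\<open>le a b\<close> means \<open>v a \<le> v b\<close> for a valuation \<open>v\<close>; the value of zero is infinite.\<close>

locale valued_algebra = kalgebra \<phi> for \<phi> :: "'k::field \<Rightarrow> 'b::idom" +
  fixes le :: "'b \<Rightarrow> 'b \<Rightarrow> bool"
  assumes le_total: "le a b \<or> le b a"
    and le_trans: "le a b \<Longrightarrow> le b c \<Longrightarrow> le a c"
    and le_mult: "le a b \<Longrightarrow> le (a * c) (b * c)"
    and le_cancel: "c \<noteq> 0 \<Longrightarrow> le (a * c) (b * c) \<Longrightarrow> le a b"
    and le_add: "le a b \<Longrightarrow> le a c \<Longrightarrow> le a (b + c)"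
    and le_scalar: "le a (\<phi> t * a)"
    and le_zeroD: "le 0 b \<Longrightarrow> b = 0"

text \<open>The valuation extends the one given by the lexicographically least monomial.
  \<open>R0\<close> consists of fractions with a monomial denominator and a numerator built from
  monomials of the same degree that are not smaller; in \<open>I0\<close> they are strictly larger.
  Chevalley's theorem extends this to the fraction field, and the quotient of a larger monomial by a
  smaller one, lying in \<open>I0\<close>, acquires strictly positive value. Numerators and
  denominators share their degree because \<open>alg_indep\<close> speaks of one degree at a
  time.\<close>

theorem (in kalgebra) monomial_valuation_exists:
  assumes ind: "alg_indep x d"
  obtains le where "valued_algebra \<phi> le"
    "\<And>n \<beta> \<gamma>. \<beta> \<in> expon d n \<Longrightarrow> \<gamma> \<in> expon d n \<Longrightarrow>
       le (xpow x d \<beta>) (xpow x d \<gamma>) \<Longrightarrow> le (xpow x d \<gamma>) (xpow x d \<beta>) \<Longrightarrow> \<beta> = \<gamma>"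
proof -
  define Ge where "Ge \<gamma> n = V.span (xpow x d ` {\<beta> \<in> expon d n. lexlt \<gamma> \<beta> \<or> \<gamma> = \<beta>})" for \<gamma> n
  define Gt where "Gt \<gamma> n = V.span (xpow x d ` {\<beta> \<in> expon d n. lexlt \<gamma> \<beta>})" for \<gamma> n
  define R0 where "R0 = {to_fract a / to_fract (xpow x d \<gamma>) | a \<gamma> n. \<gamma> \<in> expon d n \<and> a \<in> Ge \<gamma> n}"
  define I0 where "I0 = {to_fract a / to_fract (xpow x d \<gamma>) | a \<gamma> n. \<gamma> \<in> expon d n \<and> a \<in> Gt \<gamma> n}"
  have nz: "to_fract (xpow x d \<gamma>) \<noteq> 0" for \<gamma> using alg_indep_xpow_nonzero[OF ind] by simp
  have sum_exp: "(\<lambda>i. \<beta> i + \<gamma> i) \<in> expon d (m + n)" if "\<beta> \<in> expon d m" "\<gamma> \<in> expon d n" for \<beta> \<gamma> m n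
    using that unfolding expon_def by (auto simp: sum.distrib)
  have GeGe: "a * b \<in> Ge (\<lambda>i. \<gamma> i + \<gamma>' i) (m + n)" if "a \<in> Ge \<gamma> m" "b \<in> Ge \<gamma>' n" for a b \<gamma> \<gamma>' m n
    using that unfolding Ge_def
  proof (rule span_mult)
    fix s t assume "s \<in> xpow x d ` {\<beta> \<in> expon d m. lexlt \<gamma> \<beta> \<or> \<gamma> = \<beta>}"
      "t \<in> xpow x d ` {\<beta> \<in> expon d n. lexlt \<gamma>' \<beta> \<or> \<gamma>' = \<beta>}"
    then obtain \<beta> \<beta>' where b: "\<beta> \<in> expon d m" "lexlt \<gamma> \<beta> \<or> \<gamma> = \<beta>" "s = xpow x d \<beta>"
       "\<beta>' \<in> expon d n" "lexlt \<gamma>' \<beta>' \<or> \<gamma>' = \<beta>'" "t = xpow x d \<beta>'" by auto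
    have "lexlt (\<lambda>i. \<gamma> i + \<gamma>' i) (\<lambda>i. \<beta> i + \<beta>' i) \<or> (\<lambda>i. \<gamma> i + \<gamma>' i) = (\<lambda>i. \<beta> i + \<beta>' i)"
      using lexlt_add[of \<gamma> \<beta> \<gamma>' \<beta>'] lexlt_add[of \<gamma>' \<beta>' \<gamma> \<beta>] b(2,5) by (auto simp: add.commute)
    thus "s * t \<in> V.span (xpow x d ` {\<beta> \<in> expon d (m + n). lexlt (\<lambda>i. \<gamma> i + \<gamma>' i) \<beta> \<or> (\<lambda>i. \<gamma> i + \<gamma>' i) = \<beta>})"
      using b sum_exp[OF b(1,4)] unfolding b(3,6) xpow_add[symmetric] by (intro V.span_base imageI) auto
  qed simp
  have GtGe: "a * b \<in> Gt (\<lambda>i. \<gamma> i + \<gamma>' i) (m + n)" if "a \<in> Gt \<gamma> m" "b \<in> Ge \<gamma>' n" for a b \<gamma> \<gamma>' m n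
    using that unfolding Ge_def Gt_def
  proof (rule span_mult)
    fix s t assume "s \<in> xpow x d ` {\<beta> \<in> expon d m. lexlt \<gamma> \<beta>}"
      "t \<in> xpow x d ` {\<beta> \<in> expon d n. lexlt \<gamma>' \<beta> \<or> \<gamma>' = \<beta>}"
    then obtain \<beta> \<beta>' where b: "\<beta> \<in> expon d m" "lexlt \<gamma> \<beta>" "s = xpow x d \<beta>"
       "\<beta>' \<in> expon d n" "lexlt \<gamma>' \<beta>' \<or> \<gamma>' = \<beta>'" "t = xpow x d \<beta>'" by auto
    have "lexlt (\<lambda>i. \<gamma> i + \<gamma>' i) (\<lambda>i. \<beta> i + \<beta>' i)"
      using lexlt_add[of \<gamma> \<beta> \<gamma>' \<beta>'] b(2,5) by auto
    thus "s * t \<in> V.span (xpow x d ` {\<beta> \<in> expon d (m + n). lexlt (\<lambda>i. \<gamma> i + \<gamma>' i) \<beta>})"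
      using b sum_exp[OF b(1,4)] unfolding b(3,6) xpow_add[symmetric] by (intro V.span_base imageI) auto
  qed simp
  have xGe: "xpow x d \<gamma> \<in> Ge \<gamma> n" if "\<gamma> \<in> expon d n" for \<gamma> n
    unfolding Ge_def using that by (intro V.span_base imageI) auto
  have GtsubGe: "Gt \<gamma> n \<subseteq> Ge \<gamma> n" for \<gamma> n
    unfolding Ge_def Gt_def by (intro V.span_mono image_mono) auto
  have e0: "(\<lambda>_. 0) \<in> expon d 0" "xpow x d (\<lambda>_. 0) = 1" by (auto simp: expon_def xpow_def)
  have frac_add: "to_fract a / to_fract s + to_fract b / to_fract t = to_fract (a * t + b * s) / to_fract (s * t)"
    if "to_fract s \<noteq> 0" "to_fract t \<noteq> 0" for a b s t :: 'b
    using that by (simp add: field_simps)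
  have frac_mult: "to_fract a / to_fract s * (to_fract b / to_fract t) = to_fract (a * b) / to_fract (s * t)"
    for a b s t :: 'b by simp
  have phiR: "to_fract (\<phi> c) \<in> R0" for c
  proof -
    have "\<phi> c * 1 \<in> Ge (\<lambda>_. 0) 0" using xGe[OF e0(1)] e0(2) unfolding Ge_def
      by (intro subspace_phi) auto
    hence "to_fract (\<phi> c * 1) / to_fract (xpow x d (\<lambda>_. 0)) \<in> R0" unfolding R0_def using e0(1) by blast
    thus ?thesis using e0(2) by simp
  qed
  have pair: "proper_ideal_pair R0 I0"
    unfolding proper_ideal_pair_def
  proof (intro conjI ballI)
    show "1 \<in> R0" using phiR[of 1] by simp
    have "0 \<in> Gt (\<lambda>_. 0) 0" unfolding Gt_def by (rule V.span_zero)
    thus "0 \<in> I0" unfolding I0_def using e0 by (auto intro!: exI[of _ 0] exI[of _ "\<lambda>_. 0"])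
    show "I0 \<subseteq> R0" unfolding I0_def R0_def using GtsubGe by blast
    \<comment> \<open>Otherwise a monomial would be a combination of strictly larger monomials of
      its own degree.\<close>
    show "1 \<notin> I0"
    proof
      assume "1 \<in> I0"
      then obtain a \<gamma> n where a: "1 = to_fract a / to_fract (xpow x d \<gamma>)" "\<gamma> \<in> expon d n" "a \<in> Gt \<gamma> n"
        unfolding I0_def by blast
      have "to_fract a = to_fract (xpow x d \<gamma>)" using a(1) nz[of \<gamma>] by (simp add: field_simps)
      hence a': "a = xpow x d \<gamma>" by (simp add: to_fract_eq_iff)
      have ii: "inj_on (xpow x d) (expon d n)" "V.independent (xpow x d ` expon d n)"
        using independent_family[OF finite_expon[of d n], of "xpow x d"] ind unfolding alg_indep_def by blast+
      have "xpow x d ` {\<beta> \<in> expon d n. lexlt \<gamma> \<beta>} \<subseteq> xpow x d ` expon d n - {xpow x d \<gamma>}"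
        using inj_onD[OF ii(1)] a(2) lexlt_irrefl by blast
      hence "xpow x d \<gamma> \<in> V.span (xpow x d ` expon d n - {xpow x d \<gamma>})"
        using a(3) a' V.span_mono unfolding Gt_def by blast
      thus False using ii(2) a(2) unfolding V.dependent_def by blast
    qed
  next
    fix u v assume "u \<in> R0" "v \<in> R0"
    then obtain a \<gamma> m b \<gamma>' n where *: "u = to_fract a / to_fract (xpow x d \<gamma>)" "\<gamma> \<in> expon d m" "a \<in> Ge \<gamma> m"
      "v = to_fract b / to_fract (xpow x d \<gamma>')" "\<gamma>' \<in> expon d n" "b \<in> Ge \<gamma>' n" unfolding R0_def by blast
    have "a * xpow x d \<gamma>' + b * xpow x d \<gamma> \<in> Ge (\<lambda>i. \<gamma> i + \<gamma>' i) (m + n)"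
      using GeGe[OF *(3) xGe[OF *(5)]] GeGe[OF xGe[OF *(2)] *(6)] unfolding Ge_def
      by (auto intro!: V.span_add simp: mult.commute)
    thus "u + v \<in> R0" unfolding *(1,4) frac_add[OF nz nz] xpow_add[symmetric] R0_def
      using sum_exp[OF *(2,5)] by blast
    show "u * v \<in> R0" unfolding *(1,4) frac_mult xpow_add[symmetric] R0_def
      using sum_exp[OF *(2,5)] GeGe[OF *(3,6)] by blast
    have "- a \<in> Ge \<gamma> m" using *(3) unfolding Ge_def by (rule V.span_neg)
    moreover have "- u = to_fract (- a) / to_fract (xpow x d \<gamma>)" unfolding *(1) by simp
    ultimately show "- u \<in> R0" unfolding R0_def using *(2) by blast
  next
    fix u v assume "u \<in> I0" "v \<in> I0"
    then obtain a \<gamma> m b \<gamma>' n where *: "u = to_fract a / to_fract (xpow x d \<gamma>)" "\<gamma> \<in> expon d m" "a \<in> Gt \<gamma> m"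
      "v = to_fract b / to_fract (xpow x d \<gamma>')" "\<gamma>' \<in> expon d n" "b \<in> Gt \<gamma>' n" unfolding I0_def by blast
    have "(\<lambda>i. \<gamma>' i + \<gamma> i) = (\<lambda>i. \<gamma> i + \<gamma>' i)" "n + m = m + n" by (auto simp: add.commute)
    hence "a * xpow x d \<gamma>' + b * xpow x d \<gamma> \<in> Gt (\<lambda>i. \<gamma> i + \<gamma>' i) (m + n)"
      using GtGe[OF *(3) xGe[OF *(5)]] GtGe[OF *(6) xGe[OF *(2)]] unfolding Gt_def
      by (auto intro!: V.span_add simp: add.commute[of n m])
    thus "u + v \<in> I0" unfolding *(1,4) frac_add[OF nz nz] xpow_add[symmetric] I0_def
      using sum_exp[OF *(2,5)] by blast
  next
    fix u v assume "u \<in> I0" "v \<in> R0"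
    then obtain a \<gamma> m b \<gamma>' n where *: "u = to_fract a / to_fract (xpow x d \<gamma>)" "\<gamma> \<in> expon d m" "a \<in> Gt \<gamma> m"
      "v = to_fract b / to_fract (xpow x d \<gamma>')" "\<gamma>' \<in> expon d n" "b \<in> Ge \<gamma>' n" unfolding I0_def R0_def by blast
    show "u * v \<in> I0" unfolding *(1,4) frac_mult xpow_add[symmetric] I0_def
      using sum_exp[OF *(2,5)] GtGe[OF *(3,6)] by blast
  qed
  obtain R where R: "R0 \<subseteq> R" "1 \<in> R" "\<And>x y. x \<in> R \<Longrightarrow> y \<in> R \<Longrightarrow> x + y \<in> R"
    "\<And>x y. x \<in> R \<Longrightarrow> y \<in> R \<Longrightarrow> x * y \<in> R" "\<And>x. x \<noteq> 0 \<Longrightarrow> x \<in> R \<or> inverse x \<in> R"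
    "\<And>t. t \<in> I0 \<Longrightarrow> t \<noteq> 0 \<Longrightarrow> inverse t \<notin> R"
    using valuation_ring_exists[OF pair] by blast
  have phiR': "to_fract (\<phi> c) \<in> R" for c using phiR R(1) by blast
  \<comment> \<open>Divisibility by elements of the valuation ring; written without a quotient, it
    also covers \<open>a = 0\<close>.\<close>
  define le where "le a b \<longleftrightarrow> (\<exists>r\<in>R. to_fract b = r * to_fract a)" for a b :: 'b
  show ?thesis
  proof (rule that[of le])
    show "valued_algebra \<phi> le"
    proof unfold_locales
      fix a b c :: 'b
      show "le a b \<or> le b a"
      proof (cases "a = 0 \<or> b = 0")
        case True
        thus ?thesis using phiR'[of 0] unfolding le_def by (auto intro: bexI[of _ 0])
      next
        case False
        hence "to_fract b / to_fract a \<in> R \<or> inverse (to_fract b / to_fract a) \<in> R"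
          by (intro R(5)) auto
        moreover have "to_fract b = to_fract b / to_fract a * to_fract a"
          "to_fract a = inverse (to_fract b / to_fract a) * to_fract b" using False by auto
        ultimately show ?thesis unfolding le_def by blast
      qed
      show "le a b \<Longrightarrow> le b c \<Longrightarrow> le a c"
        unfolding le_def using R(4) by (metis mult.assoc)
      show "le a b \<Longrightarrow> le (a * c) (b * c)"
        unfolding le_def by (auto simp: mult.assoc)
      show "c \<noteq> 0 \<Longrightarrow> le (a * c) (b * c) \<Longrightarrow> le a b"
        unfolding le_def by (auto simp: mult.assoc[symmetric])
      show "le a b \<Longrightarrow> le a c \<Longrightarrow> le a (b + c)"
        unfolding le_def using R(3) by (metis distrib_right to_fract_add)
      show "le 0 b \<Longrightarrow> b = 0" unfolding le_def by auto
    next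
      fix a :: 'b and c show "le a (\<phi> c * a)" unfolding le_def using phiR' by auto
    qed
  next
    fix n \<beta> \<gamma> assume *: "\<beta> \<in> expon d n" "\<gamma> \<in> expon d n"
      "le (xpow x d \<beta>) (xpow x d \<gamma>)" "le (xpow x d \<gamma>) (xpow x d \<beta>)"
    have no: False if "\<beta> \<in> expon d n" "\<gamma> \<in> expon d n" "le (xpow x d \<beta>) (xpow x d \<gamma>)" "lexlt \<gamma> \<beta>" for \<beta> \<gamma>
    proof -
      have "xpow x d \<beta> \<in> Gt \<gamma> n" unfolding Gt_def using that by (intro V.span_base) auto
      hence "to_fract (xpow x d \<beta>) / to_fract (xpow x d \<gamma>) \<in> I0" unfolding I0_def using that(2) by blast
      hence "to_fract (xpow x d \<gamma>) / to_fract (xpow x d \<beta>) \<notin> R" using R(6)[of "to_fract (xpow x d \<beta>) / to_fract (xpow x d \<gamma>)"] nz by auto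
      thus False using that(3) nz unfolding le_def by (metis nonzero_mult_div_cancel_right)
    qed
    show "\<beta> = \<gamma>" using no[OF *(1,2,3)] no[OF *(2,1,4)] lexlt_total[of \<beta> \<gamma>] by blast
  qed
qed

section \<open>Counting dimensions by values and residues\<close>

context valued_algebra
begin

definition eqv :: "'b \<Rightarrow> 'b \<Rightarrow> bool" where
  "eqv a b \<longleftrightarrow> le a b \<and> le b a"

lemma le_refl: "le a a"
  using le_total by blast

lemma eqv_refl: "eqv a a" and eqv_sym: "eqv a b \<Longrightarrow> eqv b a"
  unfolding eqv_def using le_refl by auto

lemma eqv_trans: "eqv a b \<Longrightarrow> eqv b c \<Longrightarrow> eqv a c"
  unfolding eqv_def using le_trans by blast

lemma le_mult_mono: "le a b \<Longrightarrow> le c e \<Longrightarrow> le (a * c) (b * e)"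
  by (metis le_mult le_trans mult.commute)

lemma eqv_mult: "eqv a b \<Longrightarrow> eqv c e \<Longrightarrow> eqv (a * c) (b * e)"
  unfolding eqv_def using le_mult_mono by blast

lemma eqv_cancel: "c \<noteq> 0 \<Longrightarrow> eqv (a * c) (b * c) \<Longrightarrow> eqv a b"
  unfolding eqv_def using le_cancel by blast

lemma le_power: "le a b \<Longrightarrow> le (a ^ k) (b ^ k)"
  by (induction k) (auto intro: le_mult_mono le_refl)

lemma eqv_power: "eqv a b \<Longrightarrow> eqv (a ^ k) (b ^ k)"
  unfolding eqv_def using le_power by blast

text \<open>An ordered value group is torsion free. The values of \<open>a ^ m * b\<close>,
  \<open>b ^ m * b\<close> and \<open>a ^ m * a\<close> are in ascending order, and the common
  factor \<open>a ^ m\<close> of the first and last cancels.\<close>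

lemma le_power_cancel:
  assumes "k > 0" "le a b" "le (b ^ k) (a ^ k)"
  shows "le b a"
proof (cases "a = 0")
  case True thus ?thesis using le_scalar[of b 0] by simp
next
  case False
  obtain m where m: "k = Suc m" using assms(1) by (cases k) auto
  have "le (a ^ m * b) (b ^ m * b)" by (intro le_mult le_power assms)
  moreover have "le (b ^ m * b) (a ^ m * a)" using assms(3) m by (simp add: mult.commute)
  ultimately have "le (b * a ^ m) (a * a ^ m)" using le_trans by (metis mult.commute)
  thus ?thesis using False by (auto intro: le_cancel[of "a ^ m"])
qed

lemma eqv_power_cancel: "k > 0 \<Longrightarrow> eqv (a ^ k) (b ^ k) \<Longrightarrow> eqv a b"
  unfolding eqv_def using le_power_cancel le_total by blast

lemma eqv_scalar: "t \<noteq> 0 \<Longrightarrow> eqv a (\<phi> t * a)"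
proof -
  assume "t \<noteq> 0"
  hence "a = \<phi> (inverse t) * (\<phi> t * a)" by (simp add: phi_mult[symmetric] mult.assoc[symmetric])
  thus ?thesis unfolding eqv_def using le_scalar by metis
qed

lemma eqv_nonzero: "eqv a b \<Longrightarrow> a \<noteq> 0 \<Longrightarrow> b \<noteq> 0"
  unfolding eqv_def using le_zeroD by blast

lemma not_le_add: "\<not> le b a \<Longrightarrow> \<not> le c a \<Longrightarrow> \<not> le (b + c) a"
  using le_total[of b c] le_add[of b b c] le_add[of c b c] le_refl le_trans by blast

lemma not_le_sum:
  assumes "finite I" "a \<noteq> 0" "\<And>i. i \<in> I \<Longrightarrow> \<not> le (w i) a"
  shows "\<not> le (sum w I) a"
  using assms(1,3) by (induction I rule: finite_induct) (use assms(2) le_zeroD not_le_add in auto)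

lemma exists_le_min:
  assumes "finite I" "I \<noteq> {}"
  shows "\<exists>j\<in>I. \<forall>i\<in>I. le (w j) (w i)"
  using assms
proof (induction I rule: finite_ne_induct)
  case (insert i I)
  then obtain j where j: "j \<in> I" "\<forall>i\<in>I. le (w j) (w i)" by blast
  thus ?case using le_total[of "w i" "w j"] le_trans le_refl by (metis insert_iff)
qed (auto intro: le_refl)

text \<open>The term of least value cannot be cancelled, because the sum of the others has strictly
  larger value.\<close>

lemma sum_inequivalent_nonzero:
  assumes "finite I" "I \<noteq> {}" "\<And>i. i \<in> I \<Longrightarrow> w i \<noteq> 0"
    and "\<And>i j. i \<in> I \<Longrightarrow> j \<in> I \<Longrightarrow> eqv (w i) (w j) \<Longrightarrow> i = j"
  shows "sum w I \<noteq> 0"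
proof
  assume z: "sum w I = 0"
  obtain j where j: "j \<in> I" "\<forall>i\<in>I. le (w j) (w i)" using exists_le_min[OF assms(1,2)] by blast
  have "\<not> le (sum w (I - {j})) (w j)"
    using assms j by (intro not_le_sum) (auto simp: eqv_def)
  moreover have "w j = \<phi> (- 1) * sum w (I - {j})"
    using z sum.remove[OF assms(1) j(1), of w] by (simp add: phi_minus eq_neg_iff_add_eq_0)
  ultimately show False using le_scalar by metis
qed

text \<open>The residues of the quotients \<open>v / u\<close>, \<open>v \<in> U\<close>, are linearly independent over the base field.\<close>

definition resind :: "'b \<Rightarrow> 'b set \<Rightarrow> bool" where
  "resind u U \<longleftrightarrow> finite U \<and> u \<noteq> 0 \<and>
     (\<forall>c. (\<exists>v\<in>U. c v \<noteq> 0) \<longrightarrow> eqv u (\<Sum>v\<in>U. \<phi> (c v) * v))"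

lemma resindD:
  assumes "resind u U" "v \<in> U" "c v \<noteq> 0"
  shows "eqv u (\<Sum>v\<in>U. \<phi> (c v) * v)"
  using assms unfolding resind_def by blast

lemma resind_one: "resind 1 {1}"
  unfolding resind_def using eqv_scalar[of _ 1] by auto

text \<open>The products are linearly independent, as in the fundamental inequality for ramification
  index and residue degree. Grouped by \<open>i\<close>, every nontrivial inner combination has
  exactly the value of \<open>w i * u\<close>, and these values are distinct. For
  \<open>U = {1}\<close> this says that elements of distinct values are independent.\<close>

lemma resind_product_card_le:
  assumes "finite I" "\<And>i. i \<in> I \<Longrightarrow> w i \<noteq> 0"
    and ineq: "\<And>i j. i \<in> I \<Longrightarrow> j \<in> I \<Longrightarrow> eqv (w i) (w j) \<Longrightarrow> i = j"
    and U: "resind u U" and W: "findim W" "\<And>i v. i \<in> I \<Longrightarrow> v \<in> U \<Longrightarrow> w i * v \<in> W"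
  shows "card I * card U \<le> V.dim W"
proof -
  have fU: "finite U" using U unfolding resind_def by blast
  have "card (I \<times> U) \<le> V.dim W"
  proof (rule card_family_le_dim[where g = "\<lambda>(i,v). w i * v"])
    fix c assume z: "(\<Sum>j\<in>I \<times> U. \<phi> (c j) * (case j of (i, v) \<Rightarrow> w i * v)) = 0"
    define s where "s i = (\<Sum>v\<in>U. \<phi> (c (i, v)) * v)" for i
    define I' where "I' = {i \<in> I. \<exists>v\<in>U. c (i, v) \<noteq> 0}"
    have "(\<Sum>j\<in>I \<times> U. \<phi> (c j) * (case j of (i, v) \<Rightarrow> w i * v)) = (\<Sum>i\<in>I. \<Sum>v\<in>U. \<phi> (c (i, v)) * (w i * v))"
      by (simp add: sum.cartesian_product case_prod_unfold)
    also have "\<dots> = (\<Sum>i\<in>I. w i * s i)"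
      unfolding s_def sum_distrib_left by (intro sum.cong refl) (simp add: mult.left_commute)
    also have "\<dots> = (\<Sum>i\<in>I'. w i * s i)"
    proof (rule sum.mono_neutral_right)
      show "\<forall>i\<in>I - I'. w i * s i = 0"
      proof
        fix i assume "i \<in> I - I'"
        hence "s i = 0" unfolding s_def I'_def by (intro sum.neutral) auto
        thus "w i * s i = 0" by simp
      qed
    qed (use assms(1) in \<open>auto simp: I'_def\<close>)
    finally have z': "(\<Sum>i\<in>I'. w i * s i) = 0" using z by simp
    have s: "eqv u (s i)" if "i \<in> I'" for i
    proof -
      obtain v where "v \<in> U" "c (i, v) \<noteq> 0" using \<open>i \<in> I'\<close> unfolding I'_def by auto
      thus ?thesis unfolding s_def using resindD[OF U, of v "\<lambda>v. c (i, v)"] by simp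
    qed
    have u0: "u \<noteq> 0" using U unfolding resind_def by blast
    have "I' = {}"
    proof (rule ccontr)
      assume ne: "I' \<noteq> {}"
      have "(\<Sum>i\<in>I'. w i * s i) \<noteq> 0"
      proof (rule sum_inequivalent_nonzero[OF _ ne])
        show "finite I'" using assms(1) unfolding I'_def by simp
        fix i assume i: "i \<in> I'"
        show "w i * s i \<noteq> 0" using eqv_nonzero[OF s[OF i] u0] assms(2) i unfolding I'_def by simp
        fix j assume j: "j \<in> I'" and e: "eqv (w i * s i) (w j * s j)"
        have "eqv (w i * u) (w i * s i)" "eqv (w j * s j) (w j * u)"
          using eqv_mult[OF eqv_refl s[OF i]] eqv_mult[OF eqv_refl eqv_sym[OF s[OF j]]] by auto
        hence "eqv (w i * u) (w j * u)" using e eqv_trans by blast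
        hence "eqv (w i) (w j)" by (rule eqv_cancel[OF u0])
        thus "i = j" using ineq i j unfolding I'_def by blast
      qed
      thus False using z' by simp
    qed
    thus "\<forall>j\<in>I \<times> U. c j = 0" unfolding I'_def by auto
  qed (use assms fU in auto)
  thus ?thesis by (simp add: card_cartesian_product)
qed

text \<open>\<open>R\<close> represents every value taken on \<open>S - {0}\<close>. The dimension
  of \<open>S\<close> is the sum, over its values, of the dimensions of the residue spaces at that
  value, and each of these is at most \<open>l\<close>.\<close>

lemma inequivalent_representatives:
  assumes sub: "V.subspace S" and fin: "findim S"
    and bound: "\<And>u U. resind u U \<Longrightarrow> U \<subseteq> S \<Longrightarrow> card U \<le> l"
  obtains R where "finite R" "R \<subseteq> S - {0}" "\<And>a b. a \<in> R \<Longrightarrow> b \<in> R \<Longrightarrow> eqv a b \<Longrightarrow> a = b"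
    "V.dim S \<le> l * card R"
proof -
  define P where "P n \<longleftrightarrow> (\<exists>R. finite R \<and> R \<subseteq> S - {0} \<and> (\<forall>a\<in>R. \<forall>b\<in>R. eqv a b \<longrightarrow> a = b) \<and> card R = n)" for n
  have "P 0" unfolding P_def by (rule exI[of _ "{}"]) simp
  moreover have bd: "n \<le> V.dim S" if Pn: "P n" for n
  proof -
    obtain R where R: "finite R" "R \<subseteq> S - {0}" "\<forall>a\<in>R. \<forall>b\<in>R. eqv a b \<longrightarrow> a = b" "card R = n"
      using Pn unfolding P_def by blast
    have "card R * card {1::'b} \<le> V.dim S"
      by (rule resind_product_card_le[where w = "\<lambda>b. b", OF _ _ _ resind_one fin]) (use R in auto)
    thus ?thesis using R by simp
  qed
  ultimately have "P (Greatest P)" using GreatestI_nat[of P 0 "V.dim S"] by blast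
  then obtain R where R: "finite R" "R \<subseteq> S - {0}" "\<forall>a\<in>R. \<forall>b\<in>R. eqv a b \<longrightarrow> a = b" "card R = Greatest P"
    unfolding P_def by blast
  have Rmax: "\<exists>r\<in>R. eqv r v" if v: "v \<in> S" "v \<noteq> 0" for v
  proof (rule ccontr)
    assume no: "\<not> (\<exists>r\<in>R. eqv r v)"
    hence "v \<notin> R" using eqv_refl by blast
    moreover have "\<forall>a\<in>insert v R. \<forall>b\<in>insert v R. eqv a b \<longrightarrow> a = b"
      using R(3) no eqv_sym by blast
    ultimately have "P (card (insert v R))" unfolding P_def using R(1,2) v
      by (intro exI[of _ "insert v R"]) auto
    hence "P (Suc (Greatest P))" using \<open>v \<notin> R\<close> R(1,4) by simp
    hence "Suc (Greatest P) \<le> Greatest P" using Greatest_le_nat[of P _ "V.dim S"] bd by blast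
    thus False by simp
  qed
  \<comment> \<open>At each value a residually independent set of largest size inside
    \<open>S\<close> is taken; the bound \<open>l\<close> guarantees a maximum. Together these sets
    will span \<open>S\<close>.\<close>
  have "\<exists>U. resind r U \<and> U \<subseteq> S \<and> (\<forall>v\<in>U. le r v) \<and>
          (\<forall>U'. resind r U' \<and> U' \<subseteq> S \<longrightarrow> card U' \<le> card U)" if r: "r \<in> R" for r
  proof -
    define Q where "Q n \<longleftrightarrow> (\<exists>U. resind r U \<and> U \<subseteq> S \<and> card U = n)" for n
    have "Q 0" unfolding Q_def resind_def using R(2) r by (intro exI[of _ "{}"]) auto
    moreover have bdQ: "n \<le> l" if "Q n" for n using that bound unfolding Q_def by blast
    ultimately have "Q (Greatest Q)" using GreatestI_nat[of Q 0 l] by blast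
    then obtain U where U: "resind r U" "U \<subseteq> S" "card U = Greatest Q" unfolding Q_def by blast
    have "le r v" if v: "v \<in> U" for v
    proof -
      have fU: "finite U" using U(1) unfolding resind_def by blast
      have "(\<Sum>t\<in>U. \<phi> (if t = v then 1 else 0) * t) = v"
        using v fU by (simp add: if_distrib[of \<phi>] if_distrib[of "\<lambda>z. z * _"] cong: if_cong)
      moreover have "eqv r (\<Sum>t\<in>U. \<phi> (if t = v then 1 else 0) * t)"
        using resindD[OF U(1) v, of "\<lambda>t. if t = v then 1 else 0"] by simp
      ultimately show ?thesis unfolding eqv_def by simp
    qed
    moreover have "card U' \<le> card U" if "resind r U' \<and> U' \<subseteq> S" for U'
      using Greatest_le_nat[of Q "card U'" l] that bdQ U(3) unfolding Q_def by auto
    ultimately show ?thesis using U by blast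
  qed
  then obtain U where U: "\<And>r. r \<in> R \<Longrightarrow> resind r (U r)" "\<And>r. r \<in> R \<Longrightarrow> U r \<subseteq> S"
    "\<And>r v. r \<in> R \<Longrightarrow> v \<in> U r \<Longrightarrow> le r v"
    "\<And>r U'. r \<in> R \<Longrightarrow> resind r U' \<Longrightarrow> U' \<subseteq> S \<Longrightarrow> card U' \<le> card (U r)" by metis
  have fU: "finite (U r)" if "r \<in> R" for r using U(1)[OF that] unfolding resind_def by blast
  define T where "T = (\<Union>r\<in>R. U r)"
  have TS: "T \<subseteq> S" unfolding T_def using U(2) by blast
  hence spTS: "V.span T \<subseteq> S" using sub by (rule V.span_minimal)
  text \<open>Among the translates of an element outside the span choose one of maximal value; by
    maximality of \<open>U r\<close> the span contains a correction that increases the value further.\<close>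
  have "S \<subseteq> V.span T"
  proof (rule subsetI, rule ccontr)
    fix v assume v: "v \<in> S" "v \<notin> V.span T"
    define A where "A = {r \<in> R. \<exists>w\<in>V.span T. eqv r (v - w)}"
    have vw: "v - w \<in> S" "v - w \<noteq> 0" if "w \<in> V.span T" for w
      using that v spTS V.subspace_diff[OF sub] by auto
    have "v - 0 \<in> S" "v - 0 \<noteq> 0" using vw[OF V.span_zero] by auto
    hence "\<exists>r\<in>R. eqv r (v - 0)" by (rule Rmax)
    hence "A \<noteq> {}" unfolding A_def using V.span_zero by blast
    moreover have fA: "finite A" unfolding A_def using R(1) by simp
    ultimately obtain r where r: "r \<in> A" "\<forall>r'\<in>A. le r' r"
    proof -
      have "\<exists>r\<in>A. \<forall>r'\<in>A. le r' r" using fA \<open>A \<noteq> {}\<close>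
      proof (induction A rule: finite_ne_induct)
        case (insert i I)
        then obtain j where j: "j \<in> I" "\<forall>i\<in>I. le i j" by blast
        thus ?case using le_total[of i j] le_trans le_refl by (metis insert_iff)
      qed (auto intro: le_refl)
      thus ?thesis using that by blast
    qed
    then obtain w where w: "w \<in> V.span T" "eqv r (v - w)" and rR: "r \<in> R" unfolding A_def by blast
    define v' where "v' = v - w"
    have v'U: "v' \<notin> U r"
    proof
      assume "v' \<in> U r"
      hence "v' \<in> V.span T" unfolding T_def using rR by (auto intro: V.span_base)
      hence "v' + w \<in> V.span T" using w(1) by (rule V.span_add)
      thus False using v(2) unfolding v'_def by simp
    qed
    have "\<not> resind r (insert v' (U r))"
    proof
      assume "resind r (insert v' (U r))"
      hence "card (insert v' (U r)) \<le> card (U r)"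
        using U(4)[OF rR] U(2)[OF rR] vw(1)[OF w(1)] unfolding v'_def by blast
      thus False using v'U fU[OF rR] by simp
    qed
    moreover have r0: "r \<noteq> 0" using rR R(2) by blast
    ultimately obtain c where c: "\<exists>t\<in>insert v' (U r). c t \<noteq> 0" "\<not> eqv r (\<Sum>t\<in>insert v' (U r). \<phi> (c t) * t)"
      unfolding resind_def using fU[OF rR] by auto
    define z where "z = (\<Sum>t\<in>U r. \<phi> (c t) * t)"
    have sumz: "(\<Sum>t\<in>insert v' (U r). \<phi> (c t) * t) = \<phi> (c v') * v' + z"
      unfolding z_def using v'U fU[OF rR] by simp
    have cv: "c v' \<noteq> 0"
    proof
      assume "c v' = 0"
      then obtain t where "t \<in> U r" "c t \<noteq> 0" using c(1) by auto
      hence "eqv r z" unfolding z_def using resindD[OF U(1)[OF rR], of t c] by simp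
      thus False using c(2) sumz \<open>c v' = 0\<close> by simp
    qed
    have zT: "z \<in> V.span T" unfolding z_def
      by (intro V.span_sum subspace_phi V.subspace_span V.span_base) (use rR in \<open>auto simp: T_def\<close>)
    have lez: "le r z"
    proof -
      have "le r (sum (\<lambda>t. \<phi> (c t) * t) A)" if "A \<subseteq> U r" "finite A" for A
        using that(2,1) by (induction A rule: finite_induct)
          (use le_scalar[of r 0] U(3)[OF rR] le_scalar in \<open>auto intro!: le_add intro: le_trans\<close>)
      thus ?thesis unfolding z_def using fU[OF rR] by blast
    qed
    have "le r (\<phi> (c v') * v' + z)"
      using lez w(2) le_scalar le_trans unfolding v'_def eqv_def by (intro le_add) blast+
    hence nle: "\<not> le (\<phi> (c v') * v' + z) r" using c(2) sumz unfolding eqv_def by simp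
    \<comment> \<open>This correction makes \<open>v - w'\<close> a scalar multiple of the
      combination whose value exceeds that of \<open>r\<close>, against the choice of
      \<open>r\<close>.\<close>
    define w' where "w' = w - \<phi> (inverse (c v')) * z"
    have w'T: "w' \<in> V.span T" unfolding w'_def
      using w(1) zT by (intro V.span_diff subspace_phi V.subspace_span)
    have one: "\<phi> (inverse (c v')) * \<phi> (c v') = 1" using cv by (simp add: phi_mult[symmetric])
    have "v - w' = v' + \<phi> (inverse (c v')) * z" unfolding w'_def by (simp add: v'_def)
    also have "\<dots> = \<phi> (inverse (c v')) * (\<phi> (c v') * v' + z)"
      by (simp add: distrib_left mult.assoc[symmetric] one)
    finally have "v - w' = \<phi> (inverse (c v')) * (\<phi> (c v') * v' + z)" .
    hence nle': "\<not> le (v - w') r"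
      using nle le_trans le_scalar by metis
    obtain r' where r': "r' \<in> R" "eqv r' (v - w')" using Rmax[OF vw[OF w'T]] by blast
    hence "r' \<in> A" unfolding A_def using w'T by blast
    hence "le r' r" using r(2) by blast
    thus False using nle' r'(2) le_trans unfolding eqv_def by blast
  qed
  moreover have fT: "finite T" unfolding T_def using R(1) fU by simp
  ultimately have "V.dim S \<le> card T" by (rule V.dim_le_card)
  also have "\<dots> \<le> (\<Sum>r\<in>R. card (U r))" unfolding T_def by (rule card_UN_le[OF R(1)])
  also have "\<dots> \<le> (\<Sum>r\<in>R. l)" by (intro sum_mono bound[OF U(1) U(2)])
  finally have "V.dim S \<le> l * card R" by (simp add: mult.commute)
  thus ?thesis using that R by blast
qed

end

section \<open>Growth of powers of a subspace\<close>

text \<open>A set of \<open>k ^ q\<close> exponents of one common degree. The first \<open>q\<close>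
  entries are free and distinct choices are incongruent modulo \<open>k\<close>; the last entry
  absorbs the remaining degree.\<close>

definition cube :: "nat \<Rightarrow> nat \<Rightarrow> (nat \<Rightarrow> nat) set" where
  "cube q k = {\<beta> \<in> expon (Suc q) (k * q). \<forall>i<q. \<beta> i < k}"

lemma finite_cube: "finite (cube q k)"
  unfolding cube_def using finite_expon by simp

lemma card_cube_ge: "k ^ q \<le> card (cube q k)"
proof -
  define g where "g f i = (if i < q then f i else if i = q then k * q - (\<Sum>i<q. f i) else 0)"
    for f :: "nat \<Rightarrow> nat" and i
  have "card (PiE {..<q} (\<lambda>_. {..<k})) \<le> card (cube q k)"
  proof (rule card_inj_on_le[of g])
    show "inj_on g (PiE {..<q} (\<lambda>_. {..<k}))"
    proof (rule inj_onI)
      fix f f' assume *: "f \<in> PiE {..<q} (\<lambda>_. {..<k})" "f' \<in> PiE {..<q} (\<lambda>_. {..<k})" "g f = g f'"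
      have "f i = f' i" if "i \<in> {..<q}" for i using fun_cong[OF *(3), of i] that by (simp add: g_def)
      thus "f = f'" using *(1,2) by (intro PiE_ext)
    qed
    show "g ` PiE {..<q} (\<lambda>_. {..<k}) \<subseteq> cube q k"
    proof (rule image_subsetI)
      fix f assume f: "f \<in> PiE {..<q} (\<lambda>_. {..<k})"
      have "(\<Sum>i<q. f i) \<le> (\<Sum>i<q. k)" using f by (intro sum_mono) (auto dest!: PiE_mem)
      hence "(\<Sum>i<q. f i) \<le> k * q" by (simp add: mult.commute)
      moreover have "(\<Sum>i<q. g f i) = (\<Sum>i<q. f i)" by (rule sum.cong) (auto simp: g_def)
      moreover have "g f q = k * q - (\<Sum>i<q. f i)" by (simp add: g_def)
      ultimately have "(\<Sum>i<Suc q. g f i) = k * q" by simp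
      moreover have "\<forall>i\<ge>Suc q. g f i = 0" "\<forall>i<q. g f i < k" using f by (auto simp: g_def PiE_iff)
      ultimately show "g f \<in> cube q k" unfolding cube_def expon_def by simp
    qed
  qed (rule finite_cube)
  thus ?thesis by (simp add: card_PiE)
qed

text \<open>Let \<open>S\<close> represent the values on \<open>U\<close>, so that
  \<open>V.dim U \<le> l * card S\<close>. The products of \<open>b ^ k\<close>,
  \<open>X \<beta>\<close>, a power of \<open>x 0\<close> and \<open>v\<close>, for \<open>b\<close>
  in \<open>S\<close>, \<open>\<beta>\<close> in the cube and \<open>v\<close> in a residually
  independent set of maximal size \<open>l\<close>, lie in \<open>W\<close> and are independent. The
  degree \<open>h\<close> is where that set lives; \<open>e\<close> is an exponent turning the
  quotient of any two nonzero elements of equal degree into one with the value of a quotient of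
  monomials.\<close>

theorem (in kalgebra) power_growth:
  assumes Y: "finite Y" "y0 \<in> Y" "y0 \<noteq> 0"
  obtains q e h C where "e > 0" "\<And>n. V.dim (V.span (mons Y n)) \<le> C * (n + 1) ^ q"
    "\<And>p k R U W. k > 0 \<Longrightarrow> coprime k e \<Longrightarrow> k * q + h \<le> R \<Longrightarrow> V.subspace U \<Longrightarrow>
       U \<subseteq> V.span (mons Y p) \<Longrightarrow> W \<subseteq> V.span (mons Y (k * p + R)) \<Longrightarrow>
       (\<And>b y. b \<in> U \<Longrightarrow> y \<in> V.span (mons Y R) \<Longrightarrow> b ^ k * y \<in> W) \<Longrightarrow> k ^ q * V.dim U \<le> V.dim W"
proof -
  obtain x q where x: "x ` {..<Suc q} \<subseteq> Y" "alg_indep x (Suc q)"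
    and xmax: "\<And>y. y \<in> Y \<Longrightarrow> \<not> alg_indep (x(Suc q := y)) (Suc (Suc q))"
    using transcendence_basis_exists[OF Y] by blast
  obtain C where C: "\<And>n. V.dim (V.span (mons Y n)) \<le> C * (n + 1) ^ q"
    using mons_dim_bound[OF Y(1) x xmax] by blast
  obtain le where le: "valued_algebra \<phi> le"
    and leX: "\<And>n \<beta> \<gamma>. \<beta> \<in> expon (Suc q) n \<Longrightarrow> \<gamma> \<in> expon (Suc q) n \<Longrightarrow>
       le (xpow x (Suc q) \<beta>) (xpow x (Suc q) \<gamma>) \<Longrightarrow> le (xpow x (Suc q) \<gamma>) (xpow x (Suc q) \<beta>) \<Longrightarrow> \<beta> = \<gamma>"
    using monomial_valuation_exists[OF x(2)] by blast
  interpret valued_algebra \<phi> le by (rule le)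
  define X where "X = xpow x (Suc q)"
  define B where "B n = V.span (mons Y n)" for n
  have Xeq: "\<beta> = \<gamma>" if "\<beta> \<in> expon (Suc q) n" "\<gamma> \<in> expon (Suc q) n" "eqv (X \<beta>) (X \<gamma>)" for \<beta> \<gamma> n
    using leX that unfolding X_def eqv_def by blast
  have X0: "X \<beta> \<noteq> 0" for \<beta> unfolding X_def by (rule alg_indep_xpow_nonzero[OF x(2)])
  have XB: "X \<beta> \<in> B n" if "\<beta> \<in> expon (Suc q) n" for \<beta> n
    using xpow_in_mons[OF x(1), of \<beta>] that unfolding B_def X_def expon_def by (auto intro: V.span_base)
  have Bfin: "findim (B n)" for n unfolding B_def by (intro findim_span_finite finite_mons Y(1))
  have Bmult: "a * b \<in> B (m + n)" if "a \<in> B m" "b \<in> B n" for a b m n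
    using that unfolding B_def by (rule span_mons_mult)
  have Bpow: "a ^ k \<in> B (k * m)" if "a \<in> B m" for a k m
    using that unfolding B_def by (rule span_mons_power)
  have x0B: "x 0 \<in> B 1" "x 0 \<noteq> 0"
  proof -
    show "x 0 \<in> B 1" using x(1) unfolding B_def by (auto intro!: V.span_base)
    show "x 0 \<noteq> 0"
      using X0[of "\<lambda>i. if i = 0 then 1 else 0"] unfolding X_def xpow_def by (auto simp: lessThan_Suc_eq_insert_0)
  qed
  \<comment> \<open>From \<open>k * q + h + 1 \<le> k * (q + 1)\<close> for \<open>h < k\<close>: in
    such degrees the dimension is at most \<open>E\<close> times the size \<open>k ^ q\<close>
    guaranteed for the cube.\<close>
  define E where "E = C * (q + 1) ^ q"
  have bigdim: "V.dim (B (k * q + h)) \<le> E * k ^ q" if "h < k" for k h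
  proof -
    have "V.dim (B (k * q + h)) \<le> C * (k * q + h + 1) ^ q" unfolding B_def by (rule C)
    also have "\<dots> \<le> C * (k * (q + 1)) ^ q"
      using that by (intro mult_left_mono power_mono) auto
    also have "\<dots> = E * k ^ q" unfolding E_def by (simp only: power_mult_distrib) (simp add: mult_ac)
    finally show ?thesis .
  qed
  have cubeX: "\<beta> = \<gamma>" if "\<beta> \<in> cube q k" "\<gamma> \<in> cube q k" "eqv (X \<beta>) (X \<gamma>)" for \<beta> \<gamma> k
    using that Xeq unfolding cube_def by blast
  have cubeB: "X \<beta> \<in> B (k * q)" if "\<beta> \<in> cube q k" for \<beta> k
    using that XB unfolding cube_def by blast
  \<comment> \<open>The cube of side \<open>h + 1\<close>, the least side exceeding
    \<open>h\<close>, multiplied by \<open>U\<close> gives independent elements, so the residue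
    degree is bounded uniformly in \<open>h\<close>.\<close>
  have leaf: "card U \<le> E" if U: "resind u U" "U \<subseteq> B h" for u U h
  proof -
    have "card (cube q (h + 1)) * card U \<le> V.dim (B ((h + 1) * q + h))"
    proof (rule resind_product_card_le[where w = X, OF finite_cube X0 _ U(1) Bfin])
      show "X \<beta> * v \<in> B ((h + 1) * q + h)" if "\<beta> \<in> cube q (h + 1)" "v \<in> U" for \<beta> v
        using that U(2) by (intro Bmult cubeB) auto
    qed (rule cubeX)
    hence "(h + 1) ^ q * card U \<le> E * (h + 1) ^ q"
      using bigdim[of h "h + 1"] mult_le_mono1[OF card_cube_ge[of "h + 1" q], of "card U"] by linarith
    thus ?thesis by simp
  qed
  \<comment> \<open>Any positive difference of two numbers up to \<open>E\<close> divides
    \<open>e\<close>.\<close>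
  define e where "e = (fact E :: nat)"
  have expo: "\<exists>n. \<exists>\<beta>\<in>expon (Suc q) n. \<exists>\<gamma>\<in>expon (Suc q) n. eqv (a ^ e * X \<gamma>) (b ^ e * X \<beta>)"
    if ab: "a \<in> B h" "b \<in> B h" "a \<noteq> 0" "b \<noteq> 0" for a b h
  proof -
    \<comment> \<open>Large enough for the dimension bound in degree \<open>k * q + E * h\<close>.
      There the \<open>E + 1\<close> forms \<open>a ^ i * b ^ (E - i)\<close> times the cube are too
      many to have distinct values. A coincidence forces \<open>i \<noteq> j\<close>, and so a power
      of \<open>a / b\<close> with exponent at most \<open>E\<close> has the value of a quotient of
      monomials.\<close>
    define k where "k = E * h + 1"
    define w where "w p = a ^ fst p * b ^ (E - fst p) * X (snd p)" for p
    have "\<exists>p\<in>{..E} \<times> cube q k. \<exists>p'\<in>{..E} \<times> cube q k. eqv (w p) (w p') \<and> p \<noteq> p'"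
    proof (rule ccontr)
      assume no: "\<not> ?thesis"
      have "card ({..E} \<times> cube q k) * card {1::'b} \<le> V.dim (B (k * q + E * h))"
      proof (rule resind_product_card_le[where w = w, OF _ _ _ resind_one Bfin])
        fix p v assume p: "p \<in> {..E} \<times> cube q k" and v: "v \<in> {1::'b}"
        have "a ^ fst p * b ^ (E - fst p) \<in> B (fst p * h + (E - fst p) * h)"
          by (intro Bmult Bpow ab)
        hence "a ^ fst p * b ^ (E - fst p) \<in> B (E * h)" using p by (auto simp: add_mult_distrib[symmetric])
        thus "w p * v \<in> B (k * q + E * h)" unfolding w_def using Bmult[OF _ cubeB[of "snd p" k]] p v
          by (auto simp: add.commute)
      next
        show "finite ({..E} \<times> cube q k)" using finite_cube by simp
        show "w p \<noteq> 0" for p unfolding w_def using ab(3,4) X0 by simp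
        show "p = p'" if "p \<in> {..E} \<times> cube q k" "p' \<in> {..E} \<times> cube q k" "eqv (w p) (w p')" for p p'
          using no that by blast
      qed
      hence "(E + 1) * card (cube q k) \<le> E * k ^ q"
        using bigdim[of "E * h" k] by (simp add: card_cartesian_product k_def)
      hence "(E + 1) * k ^ q \<le> E * k ^ q" using mult_le_mono2[OF card_cube_ge[of k q], of "E + 1"] by linarith
      thus False by (simp add: k_def)
    qed
    then obtain i \<beta> j \<gamma> where *: "i \<le> E" "j \<le> E" "\<beta> \<in> cube q k" "\<gamma> \<in> cube q k" "(i, \<beta>) \<noteq> (j, \<gamma>)"
      "eqv (a ^ i * b ^ (E - i) * X \<beta>) (a ^ j * b ^ (E - j) * X \<gamma>)" unfolding w_def by auto
    have ij: "i \<noteq> j"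
    proof
      assume "i = j"
      hence "eqv (X \<beta> * (a ^ i * b ^ (E - i))) (X \<gamma> * (a ^ i * b ^ (E - i)))" using *(6) by (simp add: mult_ac)
      hence "eqv (X \<beta>) (X \<gamma>)" by (rule eqv_cancel[rotated]) (use ab in auto)
      thus False using cubeX *(3,4,5) \<open>i = j\<close> by blast
    qed
    have main: "\<exists>n. \<exists>\<beta>\<in>expon (Suc q) n. \<exists>\<gamma>\<in>expon (Suc q) n. eqv (a ^ e * X \<gamma>) (b ^ e * X \<beta>)"
      if *: "i < j" "j \<le> E" "\<beta> \<in> cube q k" "\<gamma> \<in> cube q k"
       "eqv (a ^ i * b ^ (E - i) * X \<beta>) (a ^ j * b ^ (E - j) * X \<gamma>)" for i j \<beta> \<gamma>
    proof -
      have "a ^ j = a ^ (j - i) * a ^ i" "b ^ (E - i) = b ^ (j - i) * b ^ (E - j)"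
        using *(1,2) by (auto simp: power_add[symmetric])
      hence "eqv (b ^ (j - i) * X \<beta> * (a ^ i * b ^ (E - j))) (a ^ (j - i) * X \<gamma> * (a ^ i * b ^ (E - j)))"
        using *(5) by (simp add: mult_ac)
      hence 1: "eqv (b ^ (j - i) * X \<beta>) (a ^ (j - i) * X \<gamma>)" by (rule eqv_cancel[rotated]) (use ab in auto)
      have "j - i dvd e" unfolding e_def using *(1,2) by (intro dvd_fact) auto
      then obtain m where m: "e = (j - i) * m" by blast
      have pw: "(c ^ (j - i) * X \<beta>) ^ m = c ^ e * X (\<lambda>i. m * \<beta> i)" for c \<beta>
        unfolding X_def xpow_scale m by (simp add: power_mult_distrib power_mult)
      have "eqv (a ^ e * X (\<lambda>i. m * \<gamma> i)) (b ^ e * X (\<lambda>i. m * \<beta> i))"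
        using eqv_power[OF eqv_sym[OF 1], of m] unfolding pw .
      moreover have "(\<lambda>i. m * \<beta> i) \<in> expon (Suc q) (m * (k * q))" if "\<beta> \<in> cube q k" for \<beta>
        using that unfolding cube_def expon_def by (auto simp: sum_distrib_left[symmetric] simp del: sum.lessThan_Suc)
      ultimately show ?thesis using *(3,4) by blast
    qed
    show ?thesis
    proof (cases "i < j")
      case True thus ?thesis using main[of i j \<beta> \<gamma>] * by blast
    next
      case False thus ?thesis using main[of j i \<gamma> \<beta>] * ij eqv_sym by simp
    qed
  qed
  \<comment> \<open>Raise the coincidence to the power \<open>e\<close> and eliminate
    \<open>a / b\<close> by \<open>expo\<close>. Only monomials remain, and their exponents satisfy
    \<open>e * (\<beta> i - \<beta>' i) = k * (\<gamma> i - \<gamma>' i)\<close>. Coprimality makes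
    \<open>k\<close> divide \<open>\<beta> i - \<beta>' i\<close>, the cube makes this zero for
    \<open>i < q\<close>, and the degree settles \<open>i = q\<close>. Then \<open>a ^ k\<close> and
    \<open>b ^ k\<close> have equal values, hence so do \<open>a\<close> and
    \<open>b\<close>.\<close>
  have distinct: "a = b \<and> \<beta> = \<beta>'"
    if k: "k > 0" "coprime k e" and ab: "a \<in> B p" "b \<in> B p" "a \<noteq> 0" "b \<noteq> 0" "eqv a b \<Longrightarrow> a = b"
      and bb: "\<beta> \<in> cube q k" "\<beta>' \<in> cube q k" and 1: "eqv (a ^ k * X \<beta>) (b ^ k * X \<beta>')"
    for a b \<beta> \<beta>' k p
  proof -
    obtain n \<gamma> \<gamma>' where g: "\<gamma> \<in> expon (Suc q) n" "\<gamma>' \<in> expon (Suc q) n" "eqv (a ^ e * X \<gamma>) (b ^ e * X \<gamma>')"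
      using expo[OF ab(1-4)] by blast
    have s: "eqv ((a ^ k) ^ e * X (\<lambda>i. e * \<beta> i)) ((b ^ k) ^ e * X (\<lambda>i. e * \<beta>' i))"
      using eqv_power[OF 1, of e] unfolding X_def xpow_scale by (simp add: power_mult_distrib)
    have t: "eqv ((b ^ k) ^ e * X (\<lambda>i. k * \<gamma>' i)) ((a ^ k) ^ e * X (\<lambda>i. k * \<gamma> i))"
      using eqv_power[OF eqv_sym[OF g(3)], of k] unfolding X_def xpow_scale
      by (simp add: power_mult_distrib power_mult[symmetric] mult.commute)
    define c where "c = (a ^ k) ^ e * (b ^ k) ^ e"
    have "eqv (X (\<lambda>i. e * \<beta> i + k * \<gamma>' i) * c) (X (\<lambda>i. e * \<beta>' i + k * \<gamma> i) * c)"
      using eqv_mult[OF s t] unfolding X_def xpow_add c_def by (simp add: mult_ac)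
    hence "eqv (X (\<lambda>i. e * \<beta> i + k * \<gamma>' i)) (X (\<lambda>i. e * \<beta>' i + k * \<gamma> i))"
      by (rule eqv_cancel[rotated]) (use ab in \<open>auto simp: c_def\<close>)
    moreover have "(\<lambda>i. e * \<beta> i + k * \<gamma>' i) \<in> expon (Suc q) (e * (k * q) + k * n)"
      if "\<beta> \<in> cube q k" "\<gamma>' \<in> expon (Suc q) n" for \<beta> \<gamma>'
      using that unfolding cube_def expon_def
      by (auto simp: sum.distrib sum_distrib_left[symmetric] simp del: sum.lessThan_Suc)
    ultimately have "(\<lambda>i. e * \<beta> i + k * \<gamma>' i) = (\<lambda>i. e * \<beta>' i + k * \<gamma> i)"
      using bb g(1,2) by (intro Xeq)
    hence eq: "e * \<beta> i + k * \<gamma>' i = e * \<beta>' i + k * \<gamma> i" for i by (rule fun_cong)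
    have eqlt: "\<beta> i = \<beta>' i" if i: "i < q" for i
    proof -
      have "int (e * \<beta> i + k * \<gamma>' i) = int (e * \<beta>' i + k * \<gamma> i)" using eq[of i] by simp
      hence "int e * (int (\<beta> i) - int (\<beta>' i)) = int k * (int (\<gamma> i) - int (\<gamma>' i))"
        by (simp add: algebra_simps)
      hence "int k dvd int e * (int (\<beta> i) - int (\<beta>' i))" by simp
      hence "int k dvd int (\<beta> i) - int (\<beta>' i)" using k(2) by (simp add: coprime_dvd_mult_right_iff)
      moreover have "\<beta> i < k" "\<beta>' i < k" using bb i unfolding cube_def by auto
      hence "\<bar>int (\<beta> i) - int (\<beta>' i)\<bar> < int k" by linarith
      ultimately show ?thesis using dvd_imp_le_int[of "int (\<beta> i) - int (\<beta>' i)" "int k"] by auto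
    qed
    have bbe: "\<beta> = \<beta>'"
    proof
      fix i
      have "(\<Sum>i<q. \<beta> i) = (\<Sum>i<q. \<beta>' i)" using eqlt by (intro sum.cong) auto
      hence "\<beta> q = \<beta>' q" using bb unfolding cube_def expon_def by auto
      thus "\<beta> i = \<beta>' i" using eqlt[of i] bb unfolding cube_def expon_def
        by (cases i q rule: linorder_cases) (auto simp: Suc_le_eq)
    qed
    have "eqv (a ^ k * X \<beta>) (b ^ k * X \<beta>)" using 1 bbe by simp
    hence "eqv (a ^ k) (b ^ k)" by (rule eqv_cancel[OF X0])
    hence "a = b" using eqv_power_cancel[OF k(1)] ab(5) by blast
    thus "a = b \<and> \<beta> = \<beta>'" using bbe by simp
  qed
  \<comment> \<open>The maximum is taken over all degrees at once; it exists because
    \<open>E\<close> does not depend on \<open>h\<close>.\<close>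
  define P where "P l \<longleftrightarrow> (\<exists>h u U. resind u U \<and> U \<subseteq> B h \<and> card U = l)" for l
  have P0: "P 0" unfolding P_def by (intro exI[of _ 0] exI[of _ 1] exI[of _ "{}"]) (auto simp: resind_def)
  have Pbd: "l \<le> E" if "P l" for l using that leaf unfolding P_def by blast
  define l where "l = Greatest P"
  have "P l" unfolding l_def using GreatestI_nat[of P 0 E] P0 Pbd by blast
  have lmax: "card U \<le> l" if "resind u U" "U \<subseteq> B h" for u U h
    unfolding l_def using Greatest_le_nat[of P "card U" E] that Pbd unfolding P_def[symmetric] by (metis P_def)
  obtain h u1 U1 where U1: "resind u1 U1" "U1 \<subseteq> B h" "card U1 = l" using \<open>P l\<close> unfolding P_def by blast
  show ?thesis
  proof (rule that[of e C q h])
    show "e > 0" unfolding e_def by simp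
    show "V.dim (V.span (mons Y n)) \<le> C * (n + 1) ^ q" for n by (rule C)
  next
    fix p k R U W
    assume k: "k > 0" "coprime k e" and R: "k * q + h \<le> R" and U: "V.subspace U" "U \<subseteq> V.span (mons Y p)"
      and W: "W \<subseteq> V.span (mons Y (k * p + R))" "\<And>b y. b \<in> U \<Longrightarrow> y \<in> V.span (mons Y R) \<Longrightarrow> b ^ k * y \<in> W"
    have UB: "U \<subseteq> B p" using U(2) unfolding B_def .
    obtain S where S: "finite S" "S \<subseteq> U - {0}" "\<And>a b. a \<in> S \<Longrightarrow> b \<in> S \<Longrightarrow> eqv a b \<Longrightarrow> a = b"
      "V.dim U \<le> l * card S"
      using inequivalent_representatives[OF U(1) findim_subset[OF Bfin UB], of l] lmax UB
      by (metis subset_trans)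
    \<comment> \<open>A power of \<open>x 0\<close> pads the degree from \<open>k * q + h\<close> up
      to \<open>R\<close>.\<close>
    define r where "r = R - (k * q + h)"
    define w where "w p = fst p ^ k * X (snd p) * x 0 ^ r" for p
    have "card (S \<times> cube q k) * card U1 \<le> V.dim W"
    proof (rule resind_product_card_le[where w = w, OF _ _ _ U1(1)])
      show "finite (S \<times> cube q k)" using S(1) finite_cube by simp
      show "findim W" using findim_subset[OF Bfin W(1)[folded B_def]] .
      show "w p \<noteq> 0" if "p \<in> S \<times> cube q k" for p using that S(2) X0 x0B by (auto simp: w_def)
      fix p p' assume p: "p \<in> S \<times> cube q k" "p' \<in> S \<times> cube q k" "eqv (w p) (w p')"
      have "eqv (fst p ^ k * X (snd p)) (fst p' ^ k * X (snd p'))"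
        using p(3) unfolding w_def by (rule eqv_cancel[rotated]) (use x0B in simp)
      hence "fst p = fst p' \<and> snd p = snd p'"
        using distinct[OF k, of "fst p" _ "fst p'" "snd p" "snd p'"] S(2) S(3)[of "fst p" "fst p'"] UB p(1,2)
        by (auto simp: mem_Times_iff)
      thus "p = p'" by (simp add: prod_eq_iff)
    next
      fix p v assume p: "p \<in> S \<times> cube q k" and v: "v \<in> U1"
      have "X (snd p) * x 0 ^ r * v \<in> B (k * q + r * 1 + h)"
        using p v U1(2) x0B by (intro Bmult Bpow cubeB) auto
      hence "X (snd p) * x 0 ^ r * v \<in> V.span (mons Y R)" unfolding B_def using R by (simp add: r_def)
      hence "fst p ^ k * (X (snd p) * x 0 ^ r * v) \<in> W" using W(2) p S(2) by (auto simp: mem_Times_iff)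
      thus "w p * v \<in> W" unfolding w_def by (simp add: mult.assoc)
    qed
    hence "card S * card (cube q k) * l \<le> V.dim W" using U1(3) by (simp add: card_cartesian_product)
    moreover have "k ^ q * V.dim U \<le> card (cube q k) * (l * card S)"
      using card_cube_ge[of k q] S(4) by (rule mult_le_mono)
    ultimately show "k ^ q * V.dim U \<le> V.dim W" by (simp add: mult_ac)
  qed
qed

section \<open>Almost monotone sequences\<close>

text \<open>Every late term is, up to an error, a lower bound for all terms far beyond it. A cluster
  point is then a limit: a late subsequence term bounds later terms from below, and each of these in
  turn lies below still later subsequence terms.\<close>

lemma almost_increasing_convergent:
  fixes u :: "nat \<Rightarrow> real"
  assumes up: "\<And>n. n \<ge> M \<Longrightarrow> u n \<le> K"
    and inc: "\<And>\<epsilon>. \<epsilon> > 0 \<Longrightarrow> \<exists>P. \<forall>p\<ge>P. \<exists>N. \<forall>n\<ge>N. u p - \<epsilon> \<le> u n"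
  shows "\<exists>l. u \<longlonglongrightarrow> l"
proof -
  obtain P1 where P1: "\<forall>p\<ge>P1. \<exists>N. \<forall>n\<ge>N. u p - 1 \<le> u n" using inc[of 1] by auto
  then obtain N1 where N1: "\<forall>n\<ge>N1. u P1 - 1 \<le> u n" by blast
  define m where "m = N1 + M"
  define v where "v n = u (n + m)" for n
  have "range v \<subseteq> {u P1 - 1..K}" unfolding v_def using N1 up by (auto simp: m_def)
  hence "bounded (range v)" using bounded_closed_interval bounded_subset by blast
  then obtain l r where r: "strict_mono (r :: nat \<Rightarrow> nat)" "(v \<circ> r) \<longlonglongrightarrow> l"
    using bounded_imp_convergent_subsequence[of v] by blast
  have "u \<longlonglongrightarrow> l"
  proof (rule LIMSEQ_I)
    fix \<epsilon> :: real assume e: "\<epsilon> > 0"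
    obtain P where P: "\<And>p. p \<ge> P \<Longrightarrow> \<exists>N. \<forall>n\<ge>N. u p - \<epsilon> / 3 \<le> u n" using inc[of "\<epsilon> / 3"] e by auto
    obtain k0 where k0: "\<And>k. k \<ge> k0 \<Longrightarrow> \<bar>u (r k + m) - l\<bar> < \<epsilon> / 3"
      using LIMSEQ_D[OF r(2), of "\<epsilon> / 3"] e unfolding v_def comp_def real_norm_def by (metis zero_less_divide_iff zero_less_numeral)
    define k where "k = max k0 P"
    have "r k \<ge> k" using r(1) by (rule seq_suble)
    hence "r k + m \<ge> P" unfolding k_def by simp
    then obtain N where N: "\<forall>n\<ge>N. u (r k + m) - \<epsilon> / 3 \<le> u n" using P by blast
    have "norm (u n - l) < \<epsilon>" if n: "n \<ge> max N P" for n
    proof -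
      have "u (r k + m) - \<epsilon> / 3 \<le> u n" "\<bar>u (r k + m) - l\<bar> < \<epsilon> / 3" using N n k0[of k] unfolding k_def by auto
      moreover obtain N' where N': "\<forall>n'\<ge>N'. u n - \<epsilon> / 3 \<le> u n'" using P[of n] n by auto
      have "r (max k0 N') \<ge> max k0 N'" using r(1) by (rule seq_suble)
      hence "u n - \<epsilon> / 3 \<le> u (r (max k0 N') + m)" "\<bar>u (r (max k0 N') + m) - l\<bar> < \<epsilon> / 3"
        using N' k0[of "max k0 N'"] by auto
      ultimately show ?thesis using e unfolding real_norm_def by linarith
    qed
    thus "\<exists>no. \<forall>n\<ge>no. norm (u n - l) < \<epsilon>" by blast
  qed
  thus ?thesis by blast
qed

lemma almost_superadditive_convergent:
  fixes a f :: "nat \<Rightarrow> real"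
  assumes n1: "n1 \<ge> 1"
    and super: "\<And>k p s. p \<ge> n1 \<Longrightarrow> s \<ge> n1 \<Longrightarrow> a (k * p + s) \<ge> real k * (a p - f p) + (a s - f s)"
    and up: "\<And>n. n \<ge> M \<Longrightarrow> a n \<le> K * real n"
    and f: "(\<lambda>n. f n / real n) \<longlonglongrightarrow> 0"
  shows "\<exists>l. (\<lambda>n. a n / real n) \<longlonglongrightarrow> l"
proof (rule almost_increasing_convergent[of "M + 1" _ K])
  fix n assume "n \<ge> M + 1"
  thus "a n / real n \<le> K" using up[of n] by (simp add: field_simps)
next
  fix \<epsilon> :: real assume e: "\<epsilon> > 0"
  obtain P0 where P0: "\<And>p. p \<ge> P0 \<Longrightarrow> \<bar>f p / real p\<bar> < \<epsilon> / 2"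
    using LIMSEQ_D[OF f, of "\<epsilon> / 2"] e by auto
  show "\<exists>P. \<forall>p\<ge>P. \<exists>N. \<forall>n\<ge>N. a p / real p - \<epsilon> \<le> a n / real n"
  proof (rule exI[of _ "P0 + n1"], intro allI impI)
    fix p assume p: "P0 + n1 \<le> p"
    hence p0: "p > 0" using n1 by simp
    define c where "c = a p - f p"
    \<comment> \<open>A bound, uniform over the window of \<open>p\<close> possible remainders, for
      everything that does not scale with \<open>n\<close>; division by \<open>n\<close> makes it
      negligible.\<close>
    define G where "G = (\<Sum>s\<in>{n1..<n1 + p}. \<bar>real s * c / real p\<bar> + \<bar>a s - f s\<bar>)"
    have G0: "G \<ge> 0" unfolding G_def by (intro sum_nonneg) auto
    obtain N0 where N0: "real N0 > 2 * G / \<epsilon>" using reals_Archimedean2 by blast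
    show "\<exists>N. \<forall>n\<ge>N. a p / real p - \<epsilon> \<le> a n / real n"
    proof (rule exI[of _ "N0 + n1"], intro allI impI)
      fix n assume n: "N0 + n1 \<le> n"
      \<comment> \<open>The window of remainders starts at \<open>n1\<close> rather than 0 so that
        superadditivity applies to the remainder as well.\<close>
      define s where "s = n1 + (n - n1) mod p"
      define k where "k = (n - n1) div p"
      have "k * p + (n - n1) mod p = n - n1" unfolding k_def by simp
      hence nks: "n = k * p + s" unfolding s_def using n by linarith
      have s: "s \<in> {n1..<n1 + p}" unfolding s_def using p0 by simp
      have "a n \<ge> real k * c + (a s - f s)" unfolding nks c_def using super[of p s k] s p by auto
      moreover have kk: "real k = (real n - real s) / real p" using p0 nks by simp
      have "real k * c = real n * (c / real p) - real s * c / real p"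
        unfolding kk by (simp add: diff_divide_distrib left_diff_distrib)
      moreover have "\<bar>real s * c / real p\<bar> + \<bar>a s - f s\<bar> \<le> G"
        unfolding G_def by (rule member_le_sum) (use s in auto)
      ultimately have "a n \<ge> real n * (c / real p) - G" by linarith
      moreover have "G \<le> real n * (\<epsilon> / 2)"
      proof -
        have "2 * G / \<epsilon> \<le> real n" using N0 n by linarith
        thus ?thesis using e by (simp add: field_simps)
      qed
      moreover have "c / real p \<ge> a p / real p - \<epsilon> / 2"
      proof -
        have "\<bar>f p / real p\<bar> < \<epsilon> / 2" using P0[of p] p by simp
        moreover have "c / real p = a p / real p - f p / real p" by (simp add: c_def diff_divide_distrib)
        ultimately show ?thesis by linarith
      qed
      hence "real n * (c / real p) \<ge> real n * (a p / real p - \<epsilon> / 2)" by (intro mult_left_mono) auto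
      ultimately have "a n \<ge> real n * (a p / real p - \<epsilon>)" by (simp add: algebra_simps)
      moreover have "n > 0" using n n1 by simp
      ultimately show "a p / real p - \<epsilon> \<le> a n / real n" by (simp add: field_simps)
    qed
  qed
qed

text \<open>Taking \<open>k\<close> congruent to 1 modulo \<open>e\<close> ensures coprimality.
  Dividing by multiples of \<open>p + q\<close> instead of \<open>p\<close> reserves the part
  \<open>k * q\<close> of \<open>R\<close>; the rest of \<open>R\<close> is less than
  \<open>h + e * (p + q)\<close>. Half of \<eta> pays for \<open>q / p\<close> once \<open>p\<close>
  is large, the other half for that bounded rest once \<open>k\<close> is large.\<close>

lemma coprime_division:
  fixes \<eta> :: real and e q h :: nat
  assumes "\<eta> > 0" "e > 0"
  shows "\<exists>P. \<forall>p\<ge>P. \<exists>N. \<forall>n\<ge>N. \<exists>k R. k > 0 \<and> coprime k e \<and> n = k * p + R \<and> k * q + h \<le> R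
           \<and> real R \<le> \<eta> * (real k * real p)"
proof -
  obtain P0 :: nat where P0: "real P0 > 2 * real q / \<eta>" using reals_Archimedean2 by blast
  show ?thesis
  proof (rule exI[of _ "P0 + 1"], intro allI impI)
    fix p assume p: "P0 + 1 \<le> p"
    define m where "m = p + q"
    have m0: "m > 0" "p > 0" using p unfolding m_def by auto
    obtain J :: nat where J: "real J > 2 * real (h + e * m) / (\<eta> * real p)" using reals_Archimedean2 by blast
    show "\<exists>N. \<forall>n\<ge>N. \<exists>k R. k > 0 \<and> coprime k e \<and> n = k * p + R \<and> k * q + h \<le> R
           \<and> real R \<le> \<eta> * (real k * real p)"
    proof (rule exI[of _ "h + m + e * m * J"], intro allI impI)
      fix n assume n: "h + m + e * m * J \<le> n"
      define j where "j = (n - h - m) div (e * m)"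
      define t where "t = (n - h - m) mod (e * m)"
      define k where "k = j * e + 1"
      have "e * m > 0" using assms m0 by simp
      hence t: "t < e * m" unfolding t_def by simp
      have "j * (e * m) + t = n - h - m" unfolding j_def t_def by (rule div_mult_mod_eq)
      hence n': "n = k * m + (h + t)" unfolding k_def using n by (simp add: algebra_simps)
      have "J * (e * m) \<le> n - h - m" using n by (simp add: algebra_simps)
      hence "J \<le> j" unfolding j_def using \<open>e * m > 0\<close> by (simp add: less_eq_div_iff_mult_less_eq)
      also have "j \<le> k" unfolding k_def using assms(2) by (cases e) auto
      finally have Jk: "real J \<le> real k" by simp
      have "coprime k e"
      proof (rule coprimeI)
        fix c assume "c dvd k" "c dvd e"
        thus "is_unit c" unfolding k_def using dvd_add_right_iff[of c "j * e" 1] by simp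
      qed
      moreover have "real (k * q + h + t) \<le> \<eta> * (real k * real p)"
      proof -
        have "2 * real q / \<eta> \<le> real p" using P0 p by linarith
        hence "real q \<le> \<eta> * real p / 2" using assms(1) by (simp add: field_simps)
        hence "real k * real q \<le> real k * (\<eta> * real p / 2)" by (intro mult_left_mono) auto
        moreover have "2 * real (h + e * m) / (\<eta> * real p) \<le> real k" using J Jk by linarith
        hence "2 * real (h + e * m) \<le> real k * (\<eta> * real p)" using assms(1) m0 by (simp add: pos_divide_le_eq)
        moreover have "real (h + t) \<le> real (h + e * m)" using t by (simp only: of_nat_le_iff)
        ultimately show ?thesis by (simp add: algebra_simps)
      qed
      moreover have "n = k * p + (k * q + h + t)" using n' unfolding m_def by (simp add: algebra_simps)
      moreover have "k > 0" unfolding k_def by simp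
      ultimately show "\<exists>k R. k > 0 \<and> coprime k e \<and> n = k * p + R \<and> k * q + h \<le> R
           \<and> real R \<le> \<eta> * (real k * real p)"
        by (intro exI[of _ k] exI[of _ "k * q + h + t"]) simp
    qed
  qed
qed

text \<open>Tightness yields one subsequential limit. At a continuity point \<open>x\<close> the
  whole sequence is squeezed between continuity points \<open>y1 < x < y2\<close>: the upper bound
  uses a fixed subsequence member as \<open>p\<close>, the lower bound uses the given
  \<open>n\<close> as \<open>p\<close> and compares with a later subsequence member.\<close>

lemma weak_conv_of_almost_monotone_cdf:
  assumes tight: "tight \<nu>"
    and mono: "\<And>x y \<epsilon>. x < y \<Longrightarrow> \<epsilon> > 0 \<Longrightarrow> \<exists>P. \<forall>p\<ge>P. \<exists>N. \<forall>n\<ge>N. cdf (\<nu> n) x \<le> cdf (\<nu> p) y + \<epsilon>"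
  shows "\<exists>M. real_distribution M \<and> weak_conv_m \<nu> M"
proof -
  obtain r M where r: "strict_mono (r :: nat \<Rightarrow> nat)" and M: "real_distribution M"
    and wc: "weak_conv_m (\<nu> \<circ> id \<circ> r) M"
    using tight_imp_convergent_subsubsequence[OF tight, of id] strict_mono_id by blast
  interpret M: real_distribution M by (rule M)
  define F where "F = cdf M"
  have F: "mono F" unfolding F_def mono_def by (auto intro: M.cdf_nondecreasing)
  have sub: "(\<lambda>k. cdf (\<nu> (r k)) y) \<longlonglongrightarrow> F y" if "isCont F y" for y
    using wc that unfolding weak_conv_m_def weak_conv_def F_def by simp
  have sub': "\<exists>k0. \<forall>k\<ge>k0. \<bar>cdf (\<nu> (r k)) y - F y\<bar> < \<epsilon>" if "isCont F y" "\<epsilon> > 0" for y \<epsilon>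
    using LIMSEQ_D[OF sub[OF that(1)] that(2)] by simp
  have large: "r k \<ge> k" for k using r by (rule seq_suble)
  have "(\<lambda>n. cdf (\<nu> n) x) \<longlonglongrightarrow> F x" if x: "isCont F x" for x
  proof (rule LIMSEQ_I)
    fix \<epsilon> :: real assume e: "\<epsilon> > 0"
    obtain \<delta> where d: "\<delta> > 0" "\<And>y. \<bar>y - x\<bar> < \<delta> \<Longrightarrow> \<bar>F y - F x\<bar> < \<epsilon> / 4"
      using x e unfolding continuous_at_eps_delta dist_real_def by (metis zero_less_divide_iff zero_less_numeral)
    obtain y1 where y1: "x - \<delta> < y1" "y1 < x" "isCont F y1"
      using open_minus_countable[OF mono_ctble_discont[OF F], of "{x - \<delta><..<x}"] d(1) by auto
    obtain y2 where y2: "x < y2" "y2 < x + \<delta>" "isCont F y2"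
      using open_minus_countable[OF mono_ctble_discont[OF F], of "{x<..<x + \<delta>}"] d(1) by auto
    obtain P2 where P2: "\<And>p. p \<ge> P2 \<Longrightarrow> \<exists>N. \<forall>n\<ge>N. cdf (\<nu> n) x \<le> cdf (\<nu> p) y2 + \<epsilon> / 4"
      using mono[OF y2(1), of "\<epsilon> / 4"] e by auto
    obtain k2 where k2: "\<And>k. k \<ge> k2 \<Longrightarrow> \<bar>cdf (\<nu> (r k)) y2 - F y2\<bar> < \<epsilon> / 4"
      using sub'[OF y2(3), of "\<epsilon> / 4"] e by auto
    have "r (max k2 P2) \<ge> P2" using large[of "max k2 P2"] by linarith
    then obtain N where N: "\<And>n. n \<ge> N \<Longrightarrow> cdf (\<nu> n) x \<le> cdf (\<nu> (r (max k2 P2))) y2 + \<epsilon> / 4" using P2 by blast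
    obtain P1 where P1: "\<And>p. p \<ge> P1 \<Longrightarrow> \<exists>N. \<forall>n\<ge>N. cdf (\<nu> n) y1 \<le> cdf (\<nu> p) x + \<epsilon> / 4"
      using mono[OF y1(2), of "\<epsilon> / 4"] e by auto
    obtain k1 where k1: "\<And>k. k \<ge> k1 \<Longrightarrow> \<bar>cdf (\<nu> (r k)) y1 - F y1\<bar> < \<epsilon> / 4"
      using sub'[OF y1(3), of "\<epsilon> / 4"] e by auto
    have "norm (cdf (\<nu> n) x - F x) < \<epsilon>" if n: "n \<ge> max N P1" for n
    proof -
      have "cdf (\<nu> n) x \<le> cdf (\<nu> (r (max k2 P2))) y2 + \<epsilon> / 4" using N n by simp
      moreover have "\<bar>cdf (\<nu> (r (max k2 P2))) y2 - F y2\<bar> < \<epsilon> / 4" by (rule k2) simp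
      moreover have "\<bar>F y2 - F x\<bar> < \<epsilon> / 4" "\<bar>F y1 - F x\<bar> < \<epsilon> / 4" using d(2) y1 y2 by auto
      moreover obtain N' where N': "\<And>m. m \<ge> N' \<Longrightarrow> cdf (\<nu> m) y1 \<le> cdf (\<nu> n) x + \<epsilon> / 4"
        using P1[of n] n by auto
      have "cdf (\<nu> (r (max k1 N'))) y1 \<le> cdf (\<nu> n) x + \<epsilon> / 4"
        using large[of "max k1 N'"] by (intro N') linarith
      moreover have "\<bar>cdf (\<nu> (r (max k1 N'))) y1 - F y1\<bar> < \<epsilon> / 4" by (rule k1) simp
      ultimately show ?thesis unfolding real_norm_def by linarith
    qed
    thus "\<exists>no. \<forall>n\<ge>no. norm (cdf (\<nu> n) x - F x) < \<epsilon>" by blast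
  qed
  hence "weak_conv_m \<nu> M" unfolding weak_conv_m_def weak_conv_def F_def by blast
  thus ?thesis using M by blast
qed

lemma weak_conv_imp_vague_conv:
  assumes "\<And>n. real_distribution (\<nu> n)" "real_distribution M" "weak_conv_m \<nu> M"
  shows "vague_conv \<nu> M"
  unfolding vague_conv_def
proof (intro allI impI)
  fix g :: "real \<Rightarrow> real"
  assume "continuous_on UNIV g \<and> (\<exists>C. compact C \<and> (\<forall>x. x \<notin> C \<longrightarrow> g x = 0))"
  then obtain C where g: "continuous_on UNIV g" "compact C" "\<forall>x. x \<notin> C \<longrightarrow> g x = 0" by blast
  have "compact (g ` C)" using g by (intro compact_continuous_image) (auto intro: continuous_on_subset)
  then obtain K where K: "\<And>x. x \<in> C \<Longrightarrow> norm (g x) \<le> K"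
    using compact_imp_bounded bounded_iff by (metis imageI)
  have "norm (g x) \<le> max K 0" for x
    using K[of x] g(3) by (cases "x \<in> C") auto
  moreover have "isCont g x" for x using g(1) by (simp add: continuous_on_eq_continuous_at)
  ultimately show "(\<lambda>n. integral\<^sup>L (\<nu> n) g) \<longlonglongrightarrow> integral\<^sup>L M g"
    by (intro weak_conv_imp_integral_bdd_continuous_conv[OF assms])
qed

section \<open>Quasi-filtered algebras\<close>

lemma mons_split_many:
  assumes "a \<in> mons S (k * p + s)"
  shows "\<exists>b c. (\<forall>i<k. b i \<in> mons S p) \<and> c \<in> mons S s \<and> a = (\<Prod>i<k. b i) * c"
  using assms
proof (induction k arbitrary: a)
  case 0 thus ?case by simp
next
  case (Suc k)
  hence "a \<in> mons S (p + (k * p + s))" by (simp add: add.assoc)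
  then obtain d a' where d: "d \<in> mons S p" "a' \<in> mons S (k * p + s)" "a = d * a'" by (rule mons_split)
  obtain b c where b: "\<forall>i<k. b i \<in> mons S p" "c \<in> mons S s" "a' = (\<Prod>i<k. b i) * c"
    using Suc.IH[OF d(2)] by blast
  show ?case
    by (rule exI[of _ "b(k := d)"], rule exI[of _ c]) (use b d in \<open>auto simp: less_Suc_eq mult_ac\<close>)
qed

text \<open>If all generators vanished, the algebra would be the image of the field, where a prime
  ideal with a nonzero element contains 1; no strict chain of two primes could exist.\<close>

lemma (in kalgebra) krull_dim_pos_generator_nonzero:
  assumes "krull_dim_pos TYPE('b)" "alg_gen \<phi> Y = UNIV"
  obtains y where "y \<in> Y" "y \<noteq> 0"
proof (rule ccontr)
  assume "\<not> thesis"
  hence Y: "Y \<subseteq> {0}" using that by blast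
  have gen: "x \<in> range \<phi>" if "x \<in> alg_gen \<phi> Y" for x
    using that
  proof induction
    case (gen x)
    hence "x = \<phi> 0" using Y by auto
    thus ?case by blast
  next
    case (add x y)
    then obtain a b where "x = \<phi> a" "y = \<phi> b" by blast
    hence "x + y = \<phi> (a + b)" by (simp add: phi_add)
    thus ?case by blast
  next
    case (mult x y)
    then obtain a b where "x = \<phi> a" "y = \<phi> b" by blast
    hence "x * y = \<phi> (a * b)" by (simp add: phi_mult)
    thus ?case by blast
  qed auto
  obtain P Q :: "'b set" where PQ: "prime_ideal P" "prime_ideal Q" "P \<subset> Q"
    using assms(1) unfolding krull_dim_pos_def by blast
  obtain b where b: "b \<in> Q" "b \<notin> P" using PQ(3) by blast
  have "b \<noteq> 0" using b(2) PQ(1) unfolding prime_ideal_def by blast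
  obtain c where c: "b = \<phi> c" using gen[of b] assms(2) by blast
  have "\<phi> (inverse c) * b = 1" using \<open>b \<noteq> 0\<close> c by (simp add: phi_mult[symmetric])
  moreover have id: "\<forall>x\<in>Q. \<forall>y. y * x \<in> Q" "Q \<noteq> UNIV" using PQ(2) unfolding prime_ideal_def by blast+
  ultimately have "1 \<in> Q" using b(1) by metis
  hence "y \<in> Q" for y using id(1) by (metis mult.right_neutral)
  thus False using id(2) by blast
qed

text \<open>\<open>upper\<close> is the limsup hypothesis in elementary form. The condition
  \<open>n0 \<ge> 1\<close> absorbs the restriction of \<open>quasi_filtered\<close> to positive
  degrees.\<close>

locale quasi_filtered_algebra = kalgebra \<phi> for \<phi> :: "'k::field \<Rightarrow> 'b::idom" +
  fixes Y :: "'b set" and y0 :: 'b and Bn :: "nat \<Rightarrow> 'b set" and f :: "nat \<Rightarrow> real"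
    and F :: "nat \<Rightarrow> real \<Rightarrow> 'b set" and n0 :: nat and K :: real and N0 :: nat
  assumes Y: "finite Y" "y0 \<in> Y" "y0 \<noteq> 0"
    and Bn: "\<And>n. n \<ge> 1 \<Longrightarrow> Bn n = V.span (mons Y n)"
    and f_lim: "(\<lambda>n. f n / real n) \<longlonglongrightarrow> 0"
    and filt: "\<And>n. n \<ge> 1 \<Longrightarrow> is_filtration \<phi> (Bn n) (F n)"
    and sep: "\<And>n. n \<ge> 1 \<Longrightarrow> separated_filt (F n)"
    and exh: "\<And>n. n \<ge> 1 \<Longrightarrow> exhaustive_filt (Bn n) (F n)"
    and lcont: "\<And>n. n \<ge> 1 \<Longrightarrow> left_cont_filt (F n)"
    and n0: "n0 \<ge> 1"
    and qf: "\<And>r n s x. r > 0 \<Longrightarrow> (\<And>i. i < r \<Longrightarrow> n i \<ge> n0 \<and> x i \<in> F (n i) (s i)) \<Longrightarrow>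
       (\<Prod>i<r. x i) \<in> F (\<Sum>i<r. n i) (\<Sum>i<(r::nat). s i - f (n i))"
    and upper: "\<And>n r a. n \<ge> N0 \<Longrightarrow> a \<in> F n r \<Longrightarrow> a \<noteq> 0 \<Longrightarrow> r \<le> K * real n"
begin

section \<open>Filtration steps and the minimal index\<close>

lemma F_subspace: "n \<ge> 1 \<Longrightarrow> V.subspace (F n r)"
  and F_subset: "n \<ge> 1 \<Longrightarrow> F n r \<subseteq> Bn n"
  and F_antimono: "n \<ge> 1 \<Longrightarrow> r \<le> s \<Longrightarrow> F n s \<subseteq> F n r"
  using filt unfolding is_filtration_def by auto

lemma Bn_findim: "n \<ge> 1 \<Longrightarrow> findim (Bn n)"
  using Bn Y(1) by (simp add: findim_span_finite finite_mons)

lemma F_findim: "n \<ge> 1 \<Longrightarrow> findim (F n r)"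
  using findim_subset[OF Bn_findim F_subset] .

lemma y0_power: "n \<ge> 1 \<Longrightarrow> y0 ^ n \<in> Bn n" "y0 ^ n \<noteq> 0"
  using Bn[of n] mons_power[of y0 Y 1 n] Y by (auto intro: V.span_base)

lemma dim_Bn_pos: "n \<ge> 1 \<Longrightarrow> V.dim (Bn n) > 0"
  using dim_eq_0_subset[OF Bn_findim[of n]] y0_power[of n] by fastforce

text \<open>The last step at which the filtration is still everything; this is the minimum of the
  index over nonzero elements of \<open>Bn n\<close>.\<close>

definition min_index :: "nat \<Rightarrow> real" where
  "min_index n = Sup {r. F n r = Bn n}"

lemma full_step_exists:
  assumes n: "n \<ge> 1"
  shows "\<exists>r. F n r = Bn n"
proof -
  have "\<forall>a\<in>mons Y n. \<exists>r. a \<in> F n r"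
    using exh[OF n] Bn[OF n] V.span_base unfolding exhaustive_filt_def by blast
  then obtain r where r: "\<And>a. a \<in> mons Y n \<Longrightarrow> a \<in> F n (r a)" by metis
  define R where "R = Min (insert 0 (r ` mons Y n))"
  have "a \<in> F n R" if "a \<in> mons Y n" for a
  proof -
    have "R \<le> r a" unfolding R_def using that finite_mons[OF Y(1)] by (intro Min_le) auto
    thus ?thesis using F_antimono[OF n] r[OF that] by blast
  qed
  hence "Bn n \<subseteq> F n R" unfolding Bn[OF n] by (intro V.span_minimal F_subspace[OF n]) blast
  thus ?thesis using F_subset[OF n] by blast
qed

text \<open>The supremum is finite by separatedness, since otherwise \<open>y0 ^ n\<close> would lie
  in every step, and it is attained by left continuity.\<close>

lemma min_index:
  assumes n: "n \<ge> 1"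
  shows F_min_index: "F n (min_index n) = Bn n"
    and min_index_ge: "F n r = Bn n \<Longrightarrow> r \<le> min_index n"
proof -
  define A where "A = {r. F n r = Bn n}"
  have ne: "A \<noteq> {}" using full_step_exists[OF n] unfolding A_def by blast
  have down: "s \<in> A" if "r \<in> A" "s \<le> r" for r s
    using that F_antimono[OF n that(2)] F_subset[OF n, of s] unfolding A_def by blast
  have "\<exists>r. r \<notin> A"
  proof (rule ccontr)
    assume "\<not> ?thesis"
    hence "(\<Inter>r. F n r) = Bn n" unfolding A_def by simp
    hence "y0 ^ n \<in> {0}" using sep[OF n] y0_power(1)[OF n] unfolding separated_filt_def by simp
    thus False using y0_power(2) by blast
  qed
  then obtain r0 where "r0 \<notin> A" by blast
  hence "bdd_above A" using down by (intro bdd_aboveI[of _ r0]) (meson linear)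
  hence le: "r \<le> Sup A" if "r \<in> A" for r using that cSup_upper by blast
  thus "F n r = Bn n \<Longrightarrow> r \<le> min_index n" unfolding min_index_def A_def by simp
  have "s \<in> A" if s: "s < Sup A" for s
  proof -
    obtain r where "r \<in> A" "s < r" using less_cSupE[OF s ne] by blast
    thus ?thesis using down by simp
  qed
  moreover have "F n (Sup A) = (\<Inter>s\<in>{s. s < Sup A}. F n s)"
    using lcont[OF n] unfolding left_cont_filt_def by blast
  ultimately have "F n (Sup A) = (\<Inter>s\<in>{s. s < Sup A}. Bn n)" unfolding A_def by auto
  moreover have "{s. s < Sup A} \<noteq> {}" using lt_ex by blast
  ultimately show "F n (min_index n) = Bn n" unfolding min_index_def A_def by auto
qed

lemma F_full: "n \<ge> 1 \<Longrightarrow> r \<le> min_index n \<Longrightarrow> F n r = Bn n"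
  using F_min_index[of n] F_antimono[of n r "min_index n"] F_subset[of n r] by blast

lemma INF_filt_index:
  assumes n: "n \<ge> 1"
  shows "(INF a\<in>Bn n - {0}. filt_index (F n) a) = ereal (min_index n)"
proof (rule antisym)
  show "ereal (min_index n) \<le> (INF a\<in>Bn n - {0}. filt_index (F n) a)"
    unfolding filt_index_def using F_min_index[OF n] by (auto intro!: INF_greatest Sup_upper)
  show "(INF a\<in>Bn n - {0}. filt_index (F n) a) \<le> ereal (min_index n)"
  proof (rule ereal_le_epsilon2)
    fix e :: real assume e: "0 < e"
    have "F n (min_index n + e) \<noteq> Bn n" using min_index_ge[OF n, of "min_index n + e"] e by auto
    then obtain a where a: "a \<in> Bn n" "a \<notin> F n (min_index n + e)" using F_subset[OF n] by blast
    have "a \<noteq> 0" using a(2) V.subspace_0[OF F_subspace[OF n]] by blast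
    have "r \<le> min_index n + e" if "a \<in> F n r" for r
      using that a(2) F_antimono[OF n, of "min_index n + e" r] by (meson linear subsetD)
    hence "filt_index (F n) a \<le> ereal (min_index n + e)"
      unfolding filt_index_def by (auto intro!: Sup_least)
    moreover have "(INF a\<in>Bn n - {0}. filt_index (F n) a) \<le> filt_index (F n) a"
      using a(1) \<open>a \<noteq> 0\<close> by (intro INF_lower) auto
    ultimately show "(INF a\<in>Bn n - {0}. filt_index (F n) a) \<le> ereal (min_index n) + ereal e" by simp
  qed
qed

lemma product_index:
  assumes "p \<ge> n0" "R \<ge> n0" "\<And>i. i < k \<Longrightarrow> b i \<in> F p r" "y \<in> F R s"
  shows "(\<Prod>i<k. b i) * y \<in> F (k * p + R) (real k * (r - f p) + (s - f R))"
proof -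
  have "(\<Prod>i<Suc k. if i < k then b i else y) \<in> F (\<Sum>i<Suc k. if i < k then p else R)
     (\<Sum>i<Suc k. (if i < k then r else s) - f (if i < k then p else R))"
    by (rule qf) (use assms in auto)
  thus ?thesis by (simp add: algebra_simps)
qed

text \<open>Generation in degree one enters here: a monomial of degree \<open>k * p + s\<close>
  splits into \<open>k\<close> monomials of degree \<open>p\<close> and one of degree
  \<open>s\<close>, whose indices are at least the respective minima, and such monomials
  span.\<close>

lemma min_index_superadditive:
  assumes "p \<ge> n0" "s \<ge> n0"
  shows "min_index (k * p + s) \<ge> real k * (min_index p - f p) + (min_index s - f s)"
proof (rule min_index_ge)
  have ge: "p \<ge> 1" "s \<ge> 1" "k * p + s \<ge> 1" using assms n0 by auto
  show "k * p + s \<ge> 1" by fact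
  have "mons Y (k * p + s) \<subseteq> F (k * p + s) (real k * (min_index p - f p) + (min_index s - f s))"
  proof
    fix a assume "a \<in> mons Y (k * p + s)"
    then obtain b c where "\<And>i. i < k \<Longrightarrow> b i \<in> mons Y p" "c \<in> mons Y s" "a = (\<Prod>i<k. b i) * c"
      using mons_split_many by blast
    thus "a \<in> F (k * p + s) (real k * (min_index p - f p) + (min_index s - f s))"
      using product_index[OF assms, of k b "min_index p" c "min_index s"]
        F_min_index[OF ge(1)] F_min_index[OF ge(2)] Bn[OF ge(1)] Bn[OF ge(2)] V.span_base by simp
  qed
  hence "Bn (k * p + s) \<subseteq> F (k * p + s) (real k * (min_index p - f p) + (min_index s - f s))"
    unfolding Bn[OF ge(3)] by (intro V.span_minimal F_subspace[OF ge(3)])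
  thus "F (k * p + s) (real k * (min_index p - f p) + (min_index s - f s)) = Bn (k * p + s)"
    using F_subset[OF ge(3)] by blast
qed

lemma min_index_convergent: "\<exists>l. (\<lambda>n. min_index n / real n) \<longlonglongrightarrow> l"
proof (rule almost_superadditive_convergent[OF n0 min_index_superadditive _ f_lim])
  fix n assume "n \<ge> N0 + 1"
  thus "min_index n \<le> K * real n"
    using upper[of n "y0 ^ n" "min_index n"] F_min_index[of n] y0_power[of n] by auto
qed

lemma linear_bounds:
  obtains C where "C \<ge> 0" "\<And>n. n \<ge> 1 \<Longrightarrow> min_index n \<ge> - C * real n" "\<And>n. n \<ge> 1 \<Longrightarrow> f n \<le> C * real n"
proof -
  obtain l where "(\<lambda>n. min_index n / real n) \<longlonglongrightarrow> l" using min_index_convergent by blast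
  hence "Bseq (\<lambda>n. min_index n / real n)" using convergentI convergent_imp_Bseq by blast
  then obtain C1 where C1: "C1 > 0" "\<And>n. \<bar>min_index n / real n\<bar> \<le> C1" unfolding Bseq_def by auto
  have "Bseq (\<lambda>n. f n / real n)" using f_lim convergentI convergent_imp_Bseq by blast
  then obtain C2 where C2: "C2 > 0" "\<And>n. \<bar>f n / real n\<bar> \<le> C2" unfolding Bseq_def by auto
  show ?thesis
  proof (rule that[of "max C1 C2"])
    show "max C1 C2 \<ge> 0" using C1 by simp
    fix n :: nat assume n: "n \<ge> 1"
    have "min_index n / real n \<ge> - max C1 C2" "f n / real n \<le> max C1 C2" using C1(2)[of n] C2(2)[of n] by linarith+
    thus "min_index n \<ge> - max C1 C2 * real n" "f n \<le> max C1 C2 * real n"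
      using n by (auto simp: pos_le_divide_eq pos_divide_le_eq)
  qed
qed

text \<open>\<open>power_growth\<close> is applied to \<open>U = F p (real p * t)\<close> and
  \<open>W = F n (real n * t')\<close>. The gap \<open>t - t'\<close> pays for two losses, half of
  it for each: the \<open>k\<close> terms \<open>f p\<close>, and the factor from degree
  \<open>R\<close>. The ratio of \<open>n\<close> to \<open>k * p\<close> accounts for
  \<open>(1 + \<eta>) ^ q\<close>.\<close>

theorem filtration_growth:
  obtains q C where "\<And>n. V.dim (V.span (mons Y n)) \<le> C * (n + 1) ^ q"
    "\<And>t t' \<eta>. t' < t \<Longrightarrow> \<eta> > 0 \<Longrightarrow> \<exists>P. \<forall>p\<ge>P. \<exists>N. \<forall>n\<ge>N.
       real (V.dim (F p (real p * t))) / real p ^ q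
         \<le> (1 + \<eta>) ^ q * (real (V.dim (F n (real n * t'))) / real n ^ q)"
proof (rule power_growth[OF Y])
  fix q e h C
  assume e: "e > 0" and C: "\<And>n. V.dim (V.span (mons Y n)) \<le> C * (n + 1) ^ q"
    and growth: "\<And>p k R U W. k > 0 \<Longrightarrow> coprime k e \<Longrightarrow> k * q + h \<le> R \<Longrightarrow> V.subspace U \<Longrightarrow>
       U \<subseteq> V.span (mons Y p) \<Longrightarrow> W \<subseteq> V.span (mons Y (k * p + R)) \<Longrightarrow>
       (\<And>b y. b \<in> U \<Longrightarrow> y \<in> V.span (mons Y R) \<Longrightarrow> b ^ k * y \<in> W) \<Longrightarrow> k ^ q * V.dim U \<le> V.dim W"
  obtain C1 where C1: "C1 \<ge> 0" "\<And>n. n \<ge> 1 \<Longrightarrow> min_index n \<ge> - C1 * real n" "\<And>n. n \<ge> 1 \<Longrightarrow> f n \<le> C1 * real n"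
    using linear_bounds by blast
  show ?thesis
  proof (rule that[of C q])
    show "V.dim (V.span (mons Y n)) \<le> C * (n + 1) ^ q" for n by (rule C)
    fix t t' \<eta> :: real assume t: "t' < t" and eta: "\<eta> > 0"
    \<comment> \<open>The price per unit of \<open>R\<close>: \<open>2 * C1\<close> from
      \<open>min_index R - f R\<close>, and \<open>\<bar>t'\<bar>\<close> because \<open>n\<close>
      exceeds \<open>k * p\<close> by \<open>R\<close>; the summand 1 keeps \<open>c\<close>
      positive.\<close>
    define c where "c = 2 * C1 + \<bar>t'\<bar> + 1"
    have c0: "c > 0" unfolding c_def using C1(1) by linarith
    define \<eta>' where "\<eta>' = min \<eta> ((t - t') / (2 * c))"
    have eta': "\<eta>' > 0" "\<eta>' \<le> \<eta>" "c * \<eta>' \<le> (t - t') / 2"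
    proof -
      show "\<eta>' > 0" "\<eta>' \<le> \<eta>" unfolding \<eta>'_def using eta t c0 by auto
      have "c * \<eta>' \<le> c * ((t - t') / (2 * c))" unfolding \<eta>'_def using c0 by (intro mult_left_mono) auto
      thus "c * \<eta>' \<le> (t - t') / 2" using c0 by simp
    qed
    obtain P1 where P1: "\<And>p. p \<ge> P1 \<Longrightarrow> \<bar>f p / real p\<bar> < (t - t') / 2"
      using LIMSEQ_D[OF f_lim, of "(t - t') / 2"] t by auto
    \<comment> \<open>Adding \<open>n0\<close> to \<open>h\<close> keeps \<open>R\<close> in the
      range where the quasi-filtration inequality holds.\<close>
    obtain P2 where P2: "\<And>p. p \<ge> P2 \<Longrightarrow> \<exists>N. \<forall>n\<ge>N. \<exists>k R. k > 0 \<and> coprime k e \<and> n = k * p + R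
        \<and> k * q + (h + n0) \<le> R \<and> real R \<le> \<eta>' * (real k * real p)"
      using coprime_division[OF eta'(1) e, of q "h + n0"] by blast
    show "\<exists>P. \<forall>p\<ge>P. \<exists>N. \<forall>n\<ge>N.
       real (V.dim (F p (real p * t))) / real p ^ q
         \<le> (1 + \<eta>) ^ q * (real (V.dim (F n (real n * t'))) / real n ^ q)"
    proof (rule exI[of _ "P1 + P2 + n0"], intro allI impI)
      fix p assume p: "P1 + P2 + n0 \<le> p"
      hence p1: "p \<ge> 1" "p \<ge> n0" using n0 by auto
      have fp: "f p \<le> real p * ((t - t') / 2)" using P1[of p] p p1 by (simp add: abs_less_iff field_simps)
      obtain N where N: "\<And>n. n \<ge> N \<Longrightarrow> \<exists>k R. k > 0 \<and> coprime k e \<and> n = k * p + R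
        \<and> k * q + (h + n0) \<le> R \<and> real R \<le> \<eta>' * (real k * real p)" using P2[of p] p by auto
      show "\<exists>N. \<forall>n\<ge>N. real (V.dim (F p (real p * t))) / real p ^ q
         \<le> (1 + \<eta>) ^ q * (real (V.dim (F n (real n * t'))) / real n ^ q)"
      proof (rule exI[of _ N], intro allI impI)
        fix n assume "N \<le> n"
        then obtain k R where k: "k > 0" "coprime k e" "n = k * p + R" "k * q + (h + n0) \<le> R"
          "real R \<le> \<eta>' * (real k * real p)" using N by blast
        have R: "R \<ge> 1" "R \<ge> n0" "k * q + h \<le> R" using k(4) n0 by auto
        have n1: "n \<ge> 1" using k(3) R by simp
        have "real n * t' \<le> real k * (real p * t - f p) + (min_index R - f R)"
        proof -
          have "real k * f p \<le> real k * (real p * ((t - t') / 2))" using fp by (intro mult_left_mono) auto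
          moreover have "min_index R - f R \<ge> - (2 * C1) * real R" using C1(2,3)[OF R(1)] by (simp add: algebra_simps)
          moreover have "real R * t' \<le> \<bar>t'\<bar> * real R" by (simp add: mult.commute mult_right_mono)
          moreover have "c * real R \<le> c * (\<eta>' * (real k * real p))" using k(5) c0 by (intro mult_left_mono) auto
          moreover have "(c * \<eta>') * (real k * real p) \<le> ((t - t') / 2) * (real k * real p)"
            using eta'(3) by (intro mult_right_mono) auto
          moreover have "c * real R = 2 * C1 * real R + \<bar>t'\<bar> * real R + real R"
            unfolding c_def by (simp add: algebra_simps)
          moreover have "real n * t' = real k * real p * t' + real R * t'" using k(3) by (simp add: algebra_simps)
          moreover have "real R \<ge> 0" by simp
          ultimately show ?thesis by (simp add: algebra_simps)
        qed
        note idx = this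
        have "k ^ q * V.dim (F p (real p * t)) \<le> V.dim (F n (real n * t'))"
        proof (rule growth[OF k(1,2) R(3) F_subspace[OF p1(1)]])
          show "F p (real p * t) \<subseteq> V.span (mons Y p)" using F_subset[OF p1(1)] Bn[OF p1(1)] by simp
          show "F n (real n * t') \<subseteq> V.span (mons Y (k * p + R))" using F_subset[OF n1] Bn[OF n1] k(3) by simp
          fix b y assume b: "b \<in> F p (real p * t)" and y: "y \<in> V.span (mons Y R)"
          have "y \<in> F R (min_index R)" using y Bn[OF R(1)] F_min_index[OF R(1)] by simp
          hence "(\<Prod>i<k. b) * y \<in> F (k * p + R) (real k * (real p * t - f p) + (min_index R - f R))"
            using b by (intro product_index[OF p1(2) R(2)])
          thus "b ^ k * y \<in> F n (real n * t')" using F_antimono[OF n1 idx] k(3) by auto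
        qed
        hence gr: "real k ^ q * real (V.dim (F p (real p * t))) \<le> real (V.dim (F n (real n * t')))"
          by (metis of_nat_le_iff of_nat_mult of_nat_power)
        have "real n \<le> real k * real p * (1 + \<eta>)"
        proof -
          have "\<eta>' * (real k * real p) \<le> \<eta> * (real k * real p)" using eta'(2) by (intro mult_right_mono) auto
          thus ?thesis using k(3,5) by (simp add: algebra_simps)
        qed
        hence "real n ^ q \<le> (real k * real p * (1 + \<eta>)) ^ q" by (intro power_mono) auto
        hence "real n ^ q * real (V.dim (F p (real p * t))) \<le> (real k * real p * (1 + \<eta>)) ^ q * real (V.dim (F p (real p * t)))"
          by (intro mult_right_mono) auto
        also have "\<dots> = (real p * (1 + \<eta>)) ^ q * (real k ^ q * real (V.dim (F p (real p * t))))"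
          by (simp add: power_mult_distrib mult_ac)
        also have "\<dots> \<le> (real p * (1 + \<eta>)) ^ q * real (V.dim (F n (real n * t')))"
          using gr eta by (intro mult_left_mono) auto
        finally have "real n ^ q * real (V.dim (F p (real p * t))) \<le> real p ^ q * ((1 + \<eta>) ^ q * real (V.dim (F n (real n * t'))))"
          by (simp add: power_mult_distrib mult_ac)
        moreover have "real n ^ q > 0" "real p ^ q > 0" using n1 p1 by auto
        ultimately show "real (V.dim (F p (real p * t))) / real p ^ q
         \<le> (1 + \<eta>) ^ q * (real (V.dim (F n (real n * t'))) / real n ^ q)"
          by (simp add: field_simps)
      qed
    qed
  qed
qed

end

section \<open>From dimension growth to the scaled measures\<close>

lemma exists_power_close_to_1:
  fixes \<epsilon> :: real assumes "\<epsilon> > 0"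
  shows "\<exists>\<eta>>0. (1 + \<eta>) ^ q \<le> 1 + \<epsilon>"
proof -
  have "((\<lambda>\<eta>::real. (1 + \<eta>) ^ q) \<longlongrightarrow> (1 + 0) ^ q) (at_right 0)" by (intro tendsto_intros)
  hence "\<forall>\<^sub>F \<eta>::real in at_right 0. (1 + \<eta>) ^ q < 1 + \<epsilon>"
    using assms by (intro order_tendstoD) auto
  hence "\<forall>\<^sub>F \<eta>::real in at_right 0. (1 + \<eta>) ^ q < 1 + \<epsilon> \<and> \<eta> > 0"
    using eventually_at_right_less[of "0::real"] by eventually_elim auto
  thus ?thesis using eventually_happens[of _ "at_right (0::real)"] by (force simp: less_imp_le)
qed

lemma eventually_ratio_close_to_1:
  fixes v :: "nat \<Rightarrow> real"
  assumes "v \<longlonglongrightarrow> l" "l > 0" "\<epsilon> > 0"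
  shows "\<exists>P. \<forall>p\<ge>P. \<forall>n\<ge>P. v p > 0 \<and> v n \<le> (1 + \<epsilon>) * v p"
proof -
  \<comment> \<open>Chosen so that
    \<open>(1 + \<epsilon>) * (l - \<kappa>) = l + \<kappa>\<close>.\<close>
  define \<kappa> where "\<kappa> = l * \<epsilon> / (2 + \<epsilon>)"
  have k: "\<kappa> > 0" "\<kappa> * (2 + \<epsilon>) = l * \<epsilon>" "\<kappa> < l" unfolding \<kappa>_def using assms by (auto simp: field_simps)
  obtain P where P: "\<And>n. n \<ge> P \<Longrightarrow> \<bar>v n - l\<bar> < \<kappa>" using LIMSEQ_D[OF assms(1) k(1)] by auto
  have "v p > 0 \<and> v n \<le> (1 + \<epsilon>) * v p" if "p \<ge> P" "n \<ge> P" for n p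
  proof -
    have "(1 + \<epsilon>) * (l - \<kappa>) \<le> (1 + \<epsilon>) * v p" using P[OF that(1)] assms(3) by (intro mult_left_mono) auto
    moreover have "(1 + \<epsilon>) * (l - \<kappa>) = l + \<kappa>" using k(2) by (simp add: algebra_simps)
    ultimately show ?thesis using P[OF that(1)] P[OF that(2)] k(3) by linarith
  qed
  thus ?thesis by blast
qed

context quasi_filtered_algebra
begin

text \<open>The mass that the scaled measure of degree \<open>n\<close> gives to
  \<open>{t..}\<close>.\<close>

definition tail :: "nat \<Rightarrow> real \<Rightarrow> real" where
  "tail n t = real (V.dim (F n (real n * t))) / real (V.dim (Bn n))"

lemma tail_nonneg: "tail n t \<ge> 0"
  unfolding tail_def by simp

lemma tail_le_1: "n \<ge> 1 \<Longrightarrow> tail n t \<le> 1"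
  using dim_mono[OF Bn_findim F_subset] dim_Bn_pos unfolding tail_def by simp

text \<open>\<open>filtration_growth\<close> normalizes by \<open>n ^ q\<close>, whereas
  \<open>tail\<close> normalizes by the dimension of \<open>Bn n\<close>. The two agree
  asymptotically up to a positive constant, and this is again obtained from
  \<open>filtration_growth\<close>, applied at levels so low that the filtration steps are
  full.\<close>

lemma tail_almost_monotone:
  assumes "t' < t" "\<epsilon> > 0"
  shows "\<exists>P. \<forall>p\<ge>P. \<exists>N. \<forall>n\<ge>N. tail p t \<le> tail n t' + \<epsilon>"
proof (rule filtration_growth)
  fix q C
  assume C: "\<And>n. V.dim (V.span (mons Y n)) \<le> C * (n + 1) ^ q"
    and growth: "\<And>t t' \<eta>. t' < t \<Longrightarrow> \<eta> > 0 \<Longrightarrow> \<exists>P. \<forall>p\<ge>P. \<exists>N. \<forall>n\<ge>N.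
       real (V.dim (F p (real p * t))) / real p ^ q
         \<le> (1 + \<eta>) ^ q * (real (V.dim (F n (real n * t'))) / real n ^ q)"
  obtain C1 where C1: "\<And>n. n \<ge> 1 \<Longrightarrow> min_index n \<ge> - C1 * real n" using linear_bounds by blast
  have full: "F n (real n * t) = Bn n" if "n \<ge> 1" "t \<le> - C1" for n t
  proof (rule F_full[OF that(1)])
    have "real n * t \<le> real n * (- C1)" using that by (intro mult_left_mono) auto
    thus "real n * t \<le> min_index n" using C1[OF that(1)] by (simp add: mult.commute)
  qed
  define v where "v n = real (V.dim (Bn n)) / real n ^ q" for n
  define c where "c = real C * 2 ^ q"
  have v_pos: "v n > 0" if "n \<ge> 1" for n unfolding v_def using dim_Bn_pos[OF that] that by simp
  have v_le: "v n \<le> c" if n: "n \<ge> 1" for n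
  proof -
    have "V.dim (Bn n) \<le> C * (n + 1) ^ q" using C[of n] Bn[OF n] by simp
    also have "\<dots> \<le> C * (2 * n) ^ q" using n by (intro mult_left_mono power_mono) auto
    finally have "real (V.dim (Bn n)) \<le> real (C * (2 * n) ^ q)" by (simp only: of_nat_le_iff)
    hence "real (V.dim (Bn n)) \<le> c * real n ^ q" unfolding c_def by (simp add: power_mult_distrib mult.assoc)
    thus ?thesis unfolding v_def using n by (simp add: pos_divide_le_eq)
  qed
  have c0: "c > 0" using v_le[of 1] v_pos[of 1] by simp
  \<comment> \<open>The levels \<open>- C1 - 1 < - C1\<close> both lie in the range where the
    filtration is all of \<open>Bn n\<close>, so the growth estimate becomes one for
    \<open>v\<close> itself.\<close>
  have vgrow: "\<exists>P. \<forall>p\<ge>P. \<exists>N. \<forall>n\<ge>N. p \<ge> 1 \<and> n \<ge> 1 \<and> v p \<le> (1 + \<eta>) ^ q * v n" if eta: "\<eta> > 0" for \<eta>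
  proof -
    obtain P where P: "\<forall>p\<ge>P. \<exists>N. \<forall>n\<ge>N. real (V.dim (F p (real p * (- C1)))) / real p ^ q
         \<le> (1 + \<eta>) ^ q * (real (V.dim (F n (real n * (- C1 - 1)))) / real n ^ q)"
      using growth[of "- C1 - 1" "- C1" \<eta>] eta by auto
    show ?thesis
    proof (rule exI[of _ "P + 1"], intro allI impI)
      fix p assume p: "p \<ge> P + 1"
      hence p': "p \<ge> P" "p \<ge> 1" by auto
      obtain N where N: "\<forall>n\<ge>N. real (V.dim (F p (real p * (- C1)))) / real p ^ q
         \<le> (1 + \<eta>) ^ q * (real (V.dim (F n (real n * (- C1 - 1)))) / real n ^ q)" using P p'(1) by blast
      show "\<exists>N. \<forall>n\<ge>N. p \<ge> 1 \<and> n \<ge> 1 \<and> v p \<le> (1 + \<eta>) ^ q * v n"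
      proof (rule exI[of _ "N + 1"], intro allI impI)
        fix n assume n: "n \<ge> N + 1"
        have fp: "F p (real p * (- C1)) = Bn p" using p'(2) by (rule full) simp
        have fn: "F n (real n * (- C1 - 1)) = Bn n" by (rule full) (use n in auto)
        have "v p \<le> (1 + \<eta>) ^ q * v n" unfolding v_def using N[rule_format, of n, unfolded fp fn] n by linarith
        thus "p \<ge> 1 \<and> n \<ge> 1 \<and> v p \<le> (1 + \<eta>) ^ q * v n" using p' n by simp
      qed
    qed
  qed
  have "\<exists>l. v \<longlonglongrightarrow> l"
  proof (rule almost_increasing_convergent[of 1 v c])
    fix e :: real assume e: "e > 0"
    obtain \<eta> where eta: "\<eta> > 0" "(1 + \<eta>) ^ q \<le> 1 + e / c"
      using exists_power_close_to_1[of "e / c" q] e c0 by auto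
    obtain P where P: "\<forall>p\<ge>P. \<exists>N. \<forall>n\<ge>N. p \<ge> 1 \<and> n \<ge> 1 \<and> v p \<le> (1 + \<eta>) ^ q * v n" using vgrow[OF eta(1)] by blast
    have le: "v p - e \<le> v n" if n: "n \<ge> 1" "v p \<le> (1 + \<eta>) ^ q * v n" for n p
    proof -
      have "(1 + \<eta>) ^ q * v n \<le> (1 + e / c) * v n" using eta(2) v_pos[OF n(1)] by (intro mult_right_mono) auto
      also have "\<dots> = v n + e / c * v n" by (simp add: algebra_simps)
      also have "e / c * v n \<le> e / c * c" using v_le[OF n(1)] e c0 by (intro mult_left_mono) auto
      finally show ?thesis using n(2) c0 by simp
    qed
    show "\<exists>P. \<forall>p\<ge>P. \<exists>N. \<forall>n\<ge>N. v p - e \<le> v n" using P le by meson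
  qed (rule v_le)
  then obtain l where l: "v \<longlonglongrightarrow> l" by blast
  have "l > 0"
  proof -
    obtain P where "\<forall>p\<ge>P. \<exists>N. \<forall>n\<ge>N. p \<ge> 1 \<and> n \<ge> 1 \<and> v p \<le> (1 + 1) ^ q * v n" using vgrow[of 1] by auto
    then obtain N where N: "\<forall>n\<ge>N. P + 1 \<ge> 1 \<and> n \<ge> 1 \<and> v (P + 1) \<le> (1 + 1) ^ q * v n" by (meson le_add1)
    have "v (P + 1) / 2 ^ q \<le> l"
      by (rule LIMSEQ_le_const[OF l]) (use N in \<open>auto simp: pos_divide_le_eq mult.commute\<close>)
    moreover have "v (P + 1) / 2 ^ q > 0" using v_pos[of "P + 1"] by simp
    ultimately show ?thesis by linarith
  qed
  \<comment> \<open>Two factors \<open>1 + e\<close> arise, one from \<eta> and one from the ratio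
    of \<open>v n\<close> to \<open>v p\<close>; for \<open>e \<le> 1\<close> their product is at
    most \<open>1 + 3 * e\<close>.\<close>
  define e where "e = min 1 (\<epsilon> / 3)"
  have e: "e > 0" "(1 + e) * (1 + e) \<le> 1 + \<epsilon>"
  proof -
    show "e > 0" unfolding e_def using assms by simp
    have "e * e \<le> e * 1" unfolding e_def using assms by (intro mult_left_mono) auto
    moreover have "3 * e \<le> \<epsilon>" unfolding e_def by auto
    ultimately show "(1 + e) * (1 + e) \<le> 1 + \<epsilon>" by (simp add: algebra_simps)
  qed
  obtain \<eta> where eta: "\<eta> > 0" "(1 + \<eta>) ^ q \<le> 1 + e" using exists_power_close_to_1[OF e(1)] by blast
  obtain P1 where P1: "\<And>p n. p \<ge> P1 \<Longrightarrow> n \<ge> P1 \<Longrightarrow> v p > 0 \<and> v n \<le> (1 + e) * v p"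
    using eventually_ratio_close_to_1[OF l \<open>l > 0\<close> e(1)] by blast
  obtain P2 where P2: "\<And>p. p \<ge> P2 \<Longrightarrow> \<exists>N. \<forall>n\<ge>N. real (V.dim (F p (real p * t))) / real p ^ q
         \<le> (1 + \<eta>) ^ q * (real (V.dim (F n (real n * t'))) / real n ^ q)"
    using growth[OF assms(1) eta(1)] by blast
  have tail_v: "real (V.dim (F n (real n * s))) / real n ^ q = tail n s * v n" if n: "n \<ge> 1" for n s
    unfolding tail_def v_def using n dim_Bn_pos[OF n] by simp
  show ?thesis
  proof (rule exI[of _ "P1 + P2 + 1"], intro allI impI)
    fix p assume p: "P1 + P2 + 1 \<le> p"
    then obtain N where N: "\<And>n. n \<ge> N \<Longrightarrow> real (V.dim (F p (real p * t))) / real p ^ q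
         \<le> (1 + \<eta>) ^ q * (real (V.dim (F n (real n * t'))) / real n ^ q)" using P2[of p] by auto
    show "\<exists>N. \<forall>n\<ge>N. tail p t \<le> tail n t' + \<epsilon>"
    proof (rule exI[of _ "N + P1 + 1"], intro allI impI)
      fix n assume n: "N + P1 + 1 \<le> n"
      have vp: "v p > 0" "v n \<le> (1 + e) * v p" using P1[of p n] p n by auto
      have "tail p t * v p \<le> (1 + \<eta>) ^ q * (tail n t' * v n)"
        using N[of n] n p tail_v[of p t] tail_v[of n t'] by simp
      also have "\<dots> \<le> (1 + e) * (tail n t' * ((1 + e) * v p))"
        using eta e(1) vp tail_nonneg v_pos[of n] n by (intro mult_mono mult_nonneg_nonneg) auto
      also have "\<dots> = ((1 + e) * (1 + e)) * tail n t' * v p" by (simp add: mult_ac)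
      also have "\<dots> \<le> (1 + \<epsilon>) * tail n t' * v p"
        using e(2) tail_nonneg vp by (intro mult_right_mono) auto
      finally have "tail p t \<le> (1 + \<epsilon>) * tail n t'" using vp(1) by simp
      moreover have "\<epsilon> * tail n t' \<le> \<epsilon> * 1" using tail_le_1[of n] n assms(2) by (intro mult_left_mono) auto
      ultimately show "tail p t \<le> tail n t' + \<epsilon>" by (simp add: algebra_simps)
    qed
  qed
qed

lemma min_index_limit:
  "\<exists>L::real. (\<lambda>n. (INF a\<in>Bn n - {0}. filt_index (F n) a) / ereal (real n)) \<longlonglongrightarrow> ereal L"
proof -
  obtain L where L: "(\<lambda>n. min_index n / real n) \<longlonglongrightarrow> L" using min_index_convergent by blast
  hence lim: "(\<lambda>n. ereal (min_index n / real n)) \<longlonglongrightarrow> ereal L" by simp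
  have "\<forall>\<^sub>F n in sequentially. ereal (min_index n / real n)
      = (INF a\<in>Bn n - {0}. filt_index (F n) a) / ereal (real n)"
    using eventually_ge_at_top[of 1] by eventually_elim (simp add: INF_filt_index)
  from Lim_transform_eventually[OF lim this] show ?thesis ..
qed

lemma
  fixes \<mu> :: "nat \<Rightarrow> real measure"
  assumes mu: "\<And>n. n \<ge> 1 \<Longrightarrow> sets (\<mu> n) = sets borel" "\<And>n. n \<ge> 1 \<Longrightarrow> prob_space (\<mu> n)"
    "\<And>n r. n \<ge> 1 \<Longrightarrow> measure (\<mu> n) {r..} = real (V.dim (F n r)) / real (V.dim (Bn n))"
  defines "\<nu> \<equiv> (\<lambda>n. distr (\<mu> n) borel (\<lambda>x. x / real n))"
  shows scaled_real_distribution: "n \<ge> 1 \<Longrightarrow> real_distribution (\<nu> n)"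
    and scaled_tail: "n \<ge> 1 \<Longrightarrow> measure (\<nu> n) {t..} = tail n t"
    and scaled_support: "\<exists>a b. \<forall>n\<ge>1. measure (\<nu> n) (UNIV - {a..b}) = 0"
proof -
  have meas: "(\<lambda>x. x / real n) \<in> borel_measurable (\<mu> n)" if "n \<ge> 1" for n
  proof -
    have "(\<lambda>x. x / real n) \<in> borel_measurable borel" by simp
    thus ?thesis using measurable_cong_sets[OF mu(1)[OF that] refl] by blast
  qed
  have space: "space (\<mu> n) = UNIV" if "n \<ge> 1" for n
    using sets_eq_imp_space_eq[OF mu(1)[OF that]] by simp
  show rd: "real_distribution (\<nu> n)" if "n \<ge> 1" for n
    unfolding \<nu>_def using prob_space.real_distribution_distr[OF mu(2)[OF that] meas[OF that]] .
  show tl: "measure (\<nu> n) {t..} = tail n t" if n: "n \<ge> 1" for n t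
  proof -
    have "(\<lambda>x. x / real n) -` {t..} \<inter> space (\<mu> n) = {real n * t..}"
      unfolding space[OF n] using n by (auto simp: pos_le_divide_eq mult.commute)
    thus ?thesis unfolding \<nu>_def tail_def
      using measure_distr[OF meas[OF n], of "{t..}"] mu(3)[OF n] by simp
  qed
  obtain C1 where C1: "\<And>n. n \<ge> 1 \<Longrightarrow> min_index n \<ge> - C1 * real n" using linear_bounds by blast
  have low: "tail n (- C1) = 1" if n: "n \<ge> 1" for n
    using F_full[OF n, of "real n * (- C1)"] C1[OF n] dim_Bn_pos[OF n] by (simp add: tail_def mult.commute)
  \<comment> \<open>The tail of a probability measure tends to 0, and here its values are multiples
    of \<open>1 / V.dim (Bn n)\<close>, so it vanishes from some point on.\<close>
  have "\<exists>b. tail n b = 0" if n: "n \<ge> 1" for n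
  proof -
    interpret N: real_distribution "\<nu> n" by (rule rd[OF n])
    have "1 - 1 / real (V.dim (Bn n)) < 1" using dim_Bn_pos[OF n] by simp
    from order_tendstoD(1)[OF N.cdf_lim_infty_prob this]
    obtain i where i: "cdf (\<nu> n) (real i) > 1 - 1 / real (V.dim (Bn n))"
      unfolding eventually_sequentially by blast
    have "measure (\<nu> n) {real i + 1..} \<le> measure (\<nu> n) (space (\<nu> n) - {..real i})"
      by (rule N.finite_measure_mono) auto
    also have "\<dots> = 1 - cdf (\<nu> n) (real i)" unfolding cdf_def by (rule N.prob_compl) simp
    finally have "tail n (real i + 1) < 1 / real (V.dim (Bn n))" using tl[OF n] i by simp
    hence "tail n (real i + 1) = 0" unfolding tail_def using dim_Bn_pos[OF n] by (simp add: field_simps)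
    thus ?thesis by blast
  qed
  then obtain b where b: "\<And>n. n \<ge> 1 \<Longrightarrow> tail n (b n) = 0" by metis
  \<comment> \<open>From degree \<open>N0\<close> on, \<open>K + 1\<close> bounds the supports
    uniformly; the finitely many earlier degrees contribute their individual bounds.\<close>
  define b' where "b' = Max (insert (K + 1) (b ` {..N0}))"
  have tail_antimono: "tail n t \<le> tail n s" if "s \<le> t" "n \<ge> 1" for n s t
  proof -
    have "F n (real n * t) \<subseteq> F n (real n * s)" using that by (intro F_antimono mult_left_mono) auto
    thus ?thesis unfolding tail_def using dim_mono[OF F_findim[OF that(2)]]
      by (intro divide_right_mono) auto
  qed
  have high: "tail n b' = 0" if n: "n \<ge> 1" for n
  proof (cases "n \<le> N0")
    case True
    hence "b n \<le> b'" unfolding b'_def by (intro Max_ge) auto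
    thus ?thesis using tail_antimono[of "b n" b' n] b[OF n] n tail_nonneg[of n b'] by simp
  next
    case False
    have "K + 1 \<le> b'" unfolding b'_def by (intro Max_ge) auto
    moreover have "tail n (K + 1) = 0"
    proof -
      have "a = 0" if "a \<in> F n (real n * (K + 1))" for a
      proof (rule ccontr)
        assume "a \<noteq> 0"
        hence "real n * (K + 1) \<le> K * real n" using upper[OF _ that] False by simp
        thus False using n by (simp add: algebra_simps)
      qed
      hence "F n (real n * (K + 1)) \<subseteq> V.span {}" by auto
      hence "V.dim (F n (real n * (K + 1))) \<le> card ({} :: 'b set)" by (rule V.dim_le_card) simp
      thus ?thesis unfolding tail_def by simp
    qed
    ultimately show ?thesis using tail_antimono[of "K + 1" b' n] n tail_nonneg[of n b'] by simp
  qed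
  have "measure (\<nu> n) (UNIV - {- C1..b'}) = 0" if n: "n \<ge> 1" for n
  proof -
    interpret N: real_distribution "\<nu> n" by (rule rd[OF n])
    have "measure (\<nu> n) (UNIV - {- C1..b'}) \<le> measure (\<nu> n) ((space (\<nu> n) - {- C1..}) \<union> {b'..})"
      by (rule N.finite_measure_mono) auto
    also have "\<dots> \<le> measure (\<nu> n) (space (\<nu> n) - {- C1..}) + measure (\<nu> n) {b'..}"
      by (rule measure_Un_le) auto
    also have "measure (\<nu> n) (space (\<nu> n) - {- C1..}) = 1 - measure (\<nu> n) {- C1..}"
      by (rule N.prob_compl) simp
    finally show ?thesis using tl[OF n] low[OF n] high[OF n] measure_nonneg[of "\<nu> n"] by (simp add: antisym)
  qed
  thus "\<exists>a b. \<forall>n\<ge>1. measure (\<nu> n) (UNIV - {a..b}) = 0" by blast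
qed

text \<open>In terms of distribution functions the tail estimate from \<open>p\<close> to all large
  \<open>n\<close> is exactly the almost monotonicity that rules out a second limit point; bounded
  supports give tightness. The index is shifted because nothing is assumed about
  \<open>\<mu> 0\<close>.\<close>

lemma scaled_measures_converge:
  fixes \<mu> :: "nat \<Rightarrow> real measure"
  assumes mu: "\<And>n. n \<ge> 1 \<Longrightarrow> sets (\<mu> n) = sets borel" "\<And>n. n \<ge> 1 \<Longrightarrow> prob_space (\<mu> n)"
    "\<And>n r. n \<ge> 1 \<Longrightarrow> measure (\<mu> n) {r..} = real (V.dim (F n r)) / real (V.dim (Bn n))"
  shows "\<exists>M. sets M = sets borel \<and> prob_space M \<and>
     vague_conv (\<lambda>n. distr (\<mu> (Suc n)) borel (\<lambda>x. x / real (Suc n))) M"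
proof -
  define \<nu> where "\<nu> n = distr (\<mu> (Suc n)) borel (\<lambda>x. x / real (Suc n))" for n
  have rd: "real_distribution (\<nu> n)" for n
    unfolding \<nu>_def by (rule scaled_real_distribution[OF mu]) auto
  have tl: "measure (\<nu> n) {t..} = tail (Suc n) t" for n t
    unfolding \<nu>_def by (rule scaled_tail[OF mu]) auto
  obtain a b where ab: "\<forall>n\<ge>1. measure (distr (\<mu> n) borel (\<lambda>x. x / real n)) (UNIV - {a..b}) = 0"
    using scaled_support[OF mu] by blast
  have supp: "measure (\<nu> n) (UNIV - {a..b}) = 0" for n
    unfolding \<nu>_def by (rule ab[rule_format]) simp
  have tight: "tight \<nu>"
    unfolding tight_def
  proof (intro conjI allI impI rd)
    fix e :: real assume e: "e > 0"
    have one: "measure (\<nu> n) {a..b} = 1" for n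
    proof -
      interpret N: real_distribution "\<nu> n" by (rule rd)
      show ?thesis using N.prob_compl[of "{a..b}"] supp[of n] by simp
    qed
    hence "{a..b} \<noteq> {}" by (metis measure_empty zero_neq_one)
    \<comment> \<open>Tightness is tested on half-open intervals, so the left end is moved to
      include \<open>a\<close>.\<close>
    hence ab: "a - 1 < b" by simp
    have "measure (\<nu> n) {a - 1<..b} > 1 - e" for n
    proof -
      interpret N: real_distribution "\<nu> n" by (rule rd)
      have "measure (\<nu> n) {a..b} \<le> measure (\<nu> n) {a - 1<..b}" by (rule N.finite_measure_mono) auto
      thus ?thesis using one[of n] e by simp
    qed
    thus "\<exists>a b. a < b \<and> (\<forall>n. 1 - e < measure (\<nu> n) {a<..b})" using ab by blast
  qed
  have "\<exists>M. real_distribution M \<and> weak_conv_m \<nu> M"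
  proof (rule weak_conv_of_almost_monotone_cdf[OF tight])
    fix x y e :: real assume xy: "x < y" and e: "e > 0"
    \<comment> \<open>Tails use closed half-lines while complements of distribution functions are
      open ones. The intermediate point gives \<open>{z..} \<subseteq> {x<..}\<close> and still
      leaves \<open>z < y\<close> for the tail estimate.\<close>
    define z where "z = (x + y) / 2"
    have z: "x < z" "z < y" unfolding z_def using xy by auto
    obtain P where P: "\<And>p. p \<ge> P \<Longrightarrow> \<exists>N. \<forall>n\<ge>N. tail p y \<le> tail n z + e"
      using tail_almost_monotone[OF z(2) e] by blast
    have comp: "cdf (\<nu> n) t = 1 - measure (\<nu> n) {t<..}" for n t
    proof -
      interpret N: real_distribution "\<nu> n" by (rule rd)
      have "space (\<nu> n) - {..t} = {t<..}" by auto
      thus ?thesis using N.prob_compl[of "{..t}"] by (simp add: cdf_def)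
    qed
    have lower: "tail (Suc n) z \<le> measure (\<nu> n) {x<..}" for n
    proof -
      interpret N: real_distribution "\<nu> n" by (rule rd)
      show ?thesis unfolding tl[symmetric] using z by (intro N.finite_measure_mono) auto
    qed
    have upper: "measure (\<nu> p) {y<..} \<le> tail (Suc p) y" for p
    proof -
      interpret N: real_distribution "\<nu> p" by (rule rd)
      show ?thesis unfolding tl[symmetric] by (intro N.finite_measure_mono) auto
    qed
    show "\<exists>P. \<forall>p\<ge>P. \<exists>N. \<forall>n\<ge>N. cdf (\<nu> n) x \<le> cdf (\<nu> p) y + e"
    proof (rule exI[of _ P], intro allI impI)
      fix p assume "P \<le> p"
      then obtain N where N: "\<And>n. n \<ge> N \<Longrightarrow> tail (Suc p) y \<le> tail n z + e" using P[of "Suc p"] by auto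
      show "\<exists>N. \<forall>n\<ge>N. cdf (\<nu> n) x \<le> cdf (\<nu> p) y + e"
      proof (rule exI[of _ N], intro allI impI)
        fix n assume "N \<le> n"
        hence "tail (Suc p) y \<le> tail (Suc n) z + e" by (intro N) simp
        thus "cdf (\<nu> n) x \<le> cdf (\<nu> p) y + e"
          unfolding comp using lower[of n] upper[of p] by linarith
      qed
    qed
  qed
  then obtain M where M: "real_distribution M" "weak_conv_m \<nu> M" by blast
  interpret M: real_distribution M by (rule M(1))
  have "vague_conv \<nu> M" by (rule weak_conv_imp_vague_conv[OF rd M])
  thus ?thesis unfolding \<nu>_def using M.prob_space_axioms M.events_eq_borel by blast
qed

end

lemma limsup_ratio_bound:
  fixes g :: "nat \<Rightarrow> 'a \<Rightarrow> ereal"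
  assumes "limsup (\<lambda>n. SUP a\<in>A n. g n a / ereal (real n)) < \<infinity>"
  shows "\<exists>K::real. \<exists>N. \<forall>n\<ge>N. \<forall>a\<in>A n. g n a \<le> ereal (K * real n)"
proof -
  obtain K :: real where K: "limsup (\<lambda>n. SUP a\<in>A n. g n a / ereal (real n)) < ereal K"
    using less_PInf_Ex_of_nat[THEN iffD1, OF less_imp_neq[OF assms]] by blast
  hence "\<forall>\<^sub>F n in sequentially. (SUP a\<in>A n. g n a / ereal (real n)) < ereal K"
    by (rule Limsup_lessD)
  then obtain N where N: "\<And>n. n \<ge> N \<Longrightarrow> (SUP a\<in>A n. g n a / ereal (real n)) < ereal K"
    unfolding eventually_sequentially by blast
  show ?thesis
  proof (intro exI[of _ K] exI[of _ "N + 1"] allI impI ballI)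
    fix n a assume n: "n \<ge> N + 1" and a: "a \<in> A n"
    have "g n a / ereal (real n) \<le> (SUP a\<in>A n. g n a / ereal (real n))" by (rule SUP_upper[OF a])
    hence "g n a / ereal (real n) \<le> ereal K" using N[of n] n by (meson add_leD1 less_imp_le order_trans)
    thus "g n a \<le> ereal (K * real n)"
      using n by (cases "g n a") (auto simp: pos_divide_le_eq)
  qed
qed

theorem mainTheorem8:
  fixes \<phi> :: "'k::field \<Rightarrow> 'b::idom"
    and Bn :: "nat \<Rightarrow> 'b set"
    and f :: "nat \<Rightarrow> real"
    and F :: "nat \<Rightarrow> real \<Rightarrow> 'b set"
    and \<mu> :: "nat \<Rightarrow> real measure"
  assumes hom: "alg_hom_str \<phi>"
    and f_nonneg: "\<forall>n. f n \<ge> 0"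
    and f_lim: "(\<lambda>n. f n / real n) \<longlonglongrightarrow> 0"
    and graded: "graded_algebra \<phi> Bn"
    and fin_type: "finite_type \<phi>"
    and gen1: "alg_gen \<phi> (Bn 1) = UNIV"
    and kdim: "krull_dim_pos TYPE('b)"
    and filt: "\<forall>n\<ge>1. is_filtration \<phi> (Bn n) (F n) \<and> separated_filt (F n)
                  \<and> exhaustive_filt (Bn n) (F n) \<and> left_cont_filt (F n)"
    and qf: "quasi_filtered f F"
    and bounded_sup: "limsup (\<lambda>n. SUP a\<in>Bn n - {0}. filt_index (F n) a / ereal (real n)) < \<infinity>"
    and nuB: "\<forall>n\<ge>1. sets (\<mu> n) = sets borel \<and> prob_space (\<mu> n) \<and>
               (\<forall>r. measure (\<mu> n) {r..} =
                    real (vector_space.dim (kscale \<phi>) (F n r)) / real (vector_space.dim (kscale \<phi>) (Bn n)))"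
  shows "(\<exists>L::real. (\<lambda>n. (INF a\<in>Bn n - {0}. filt_index (F n) a) / ereal (real n)) \<longlonglongrightarrow> ereal L)
       \<and> (\<exists>a b::real. \<forall>n\<ge>1. measure (distr (\<mu> n) borel (\<lambda>x. x / real n)) (UNIV - {a..b}) = 0)
       \<and> (\<exists>\<nu>. sets \<nu> = sets borel \<and> prob_space \<nu> \<and>
              vague_conv (\<lambda>n. distr (\<mu> (Suc n)) borel (\<lambda>x. x / real (Suc n))) \<nu>)"
proof -
  interpret kalgebra \<phi> by unfold_locales (rule hom)
  obtain Y where Y: "finite Y" "Y \<subseteq> Bn 1" "alg_gen \<phi> Y = UNIV"
    using finite_generators_in[OF fin_type gen1] by blast
  obtain y0 where y0: "y0 \<in> Y" "y0 \<noteq> 0"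
    using krull_dim_pos_generator_nonzero[OF kdim Y(3)] by blast
  obtain n0 where n0: "\<And>r n s x. r > 0 \<Longrightarrow> (\<And>i. i < r \<Longrightarrow> n i \<ge> n0 \<and> n i \<ge> 1 \<and> x i \<in> F (n i) (s i)) \<Longrightarrow>
      (\<Prod>i<r. x i) \<in> F (\<Sum>i<r. n i) (\<Sum>i<(r::nat). s i - f (n i))"
    using qf unfolding quasi_filtered_def by blast
  obtain K :: real and N0 where KN: "\<forall>n\<ge>N0. \<forall>a\<in>Bn n - {0}. filt_index (F n) a \<le> ereal (K * real n)"
    using limsup_ratio_bound[OF bounded_sup] by auto
  \<comment> \<open>The increments by one force positive degrees, where the filtrations are
    given.\<close>
  interpret quasi_filtered_algebra \<phi> Y y0 Bn f F "n0 + 1" K "N0 + 1"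
  proof unfold_locales
    fix n :: nat and r a assume *: "N0 + 1 \<le> n" "a \<in> F n r" "a \<noteq> 0"
    have "F n r \<subseteq> Bn n" using filt *(1) unfolding is_filtration_def by auto
    hence "filt_index (F n) a \<le> ereal (K * real n)" using KN * by auto
    moreover have "ereal r \<le> filt_index (F n) a"
      unfolding filt_index_def using *(2) by (auto intro!: Sup_upper)
    ultimately show "r \<le> K * real n" using order_trans ereal_less_eq(3) by metis
  next
    fix r :: nat and n s x assume "r > 0" "\<And>i. i < r \<Longrightarrow> n i \<ge> n0 + 1 \<and> x i \<in> F (n i) (s i)"
    thus "(\<Prod>i<r. x i) \<in> F (\<Sum>i<r. n i) (\<Sum>i<r. s i - f (n i))" by (intro n0) fastforce+
  qed (use Y y0 f_lim filt graded_eq_span_mons[OF graded Y(2,3)] in auto)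
  have mu: "\<And>n. n \<ge> 1 \<Longrightarrow> sets (\<mu> n) = sets borel" "\<And>n. n \<ge> 1 \<Longrightarrow> prob_space (\<mu> n)"
    "\<And>n r. n \<ge> 1 \<Longrightarrow> measure (\<mu> n) {r..} = real (V.dim (F n r)) / real (V.dim (Bn n))"
    using nuB by auto
  show ?thesis
    using min_index_limit scaled_support[OF mu] scaled_measures_converge[OF mu] by blast
qed

end
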